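(* Let $d\in\mathbb{N}$, $0<p<1$, $0<q\le\infty$, $\alpha>\max\{d(\frac1p-1),\,d(1-\frac1q)\}$ (with $\frac1q=0$ if $q=\infty$), and $\psi\in\mathcal{H}_\alpha$. Then for every $f\in L_q(\mathbb{R}^d)$ (with $f\in C_0(\mathbb{R}^d)$ if $q=\infty$) and every $\delta>0$, $$ K\big(f,\delta;L_q(\mathbb{R}^d),W_p^\psi(\mathbb{R}^d)\big)=\inf_{g\in W_p^\psi(\mathbb{R}^d)}\Big(\|f-g\|_{L_q(\mathbb{R}^d)}+\delta\,\|\psi(D)g\|_{L_p(\mathbb{R}^d)}\Big)=0 . $$
   Context: Functions are complex-valued. For $0<p<\infty$, $L_p(\mathbb{R}^d)$ is the space of measurable $f$ with $\|f\|_{L_p(\mathbb{R}^d)}=\big(\int_{\mathbb{R}^d}|f(x)|^p\,dx\big)^{1/p}<\infty$ (a quasi-norm if $p<1$), and $L_\infty(\mathbb{R}^d)$ carries the essential supremum norm. $C_0(\mathbb{R}^d)$ is the set of continuous functions $f$ on $\mathbb{R}^d$ with $\lim_{|x|\to\infty}f(x)=0$. $\mathcal{S}(\mathbb{R}^d)$ is the Schwartz space of infinitely differentiable rapidly decreasing functions. The Fourier transform of $f\in L_1(\mathbb{R}^d)$ is $\mathcal{F}f(\xi)=\widehat f(\xi)=(2\pi)^{-d/2}\int_{\mathbb{R}^d}f(x)e^{-i(x,\xi)}\,dx$, and $\mathcal{F}^{-1}$ denotes its inverse. The class $\mathcal{H}_\alpha$, $\alpha\in\mathbb{R}$, consists of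 all functions $\psi$ such that $\psi(\xi)\ne 0$ for $\xi\in\mathbb{R}^d\setminus\{0\}$, $\psi\in C^\infty(\mathbb{R}^d\setminus\{0\})$ (complex-valued), and $\psi$ is homogeneous of order $\alpha$: $\psi(\tau\xi)=\tau^\alpha\psi(\xi)$ for all $\tau>0$ and $\xi\in\mathbb{R}^d\setminus\{0\}$. For $\psi\in\mathcal{H}_\alpha$, $\alpha>0$, and $g\in\mathcal{S}(\mathbb{R}^d)$, put $\psi(D)g=\mathcal{F}^{-1}(\psi\,\widehat g)$ (here $\psi\widehat g$ is integrable). For $0<p\le1$, $$ W_p^\psi(\mathbb{R}^d)=\{g\in\mathcal{S}(\mathbb{R}^d):\ \psi(D)g\in L_p(\mathbb{R}^d)\},\qquad |g|_{W_p^\psi(\mathbb{R}^d)}=\|\psi(D)g\|_{L_p(\mathbb{R}^d)} . $$ *)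

theory Defs
  imports "HOL-Analysis.Analysis" "HOL-Probability.Essential_Supremum"
begin

text \<open>
  Elements of \<open>L\<^sub>p\<close> are represented by functions, not by classes modulo null sets.
  The (quasi-)norm takes values in \<^typ>\<open>ennreal\<close>, so it is \<open>\<infinity>\<close>
  (rather than an arbitrary value) when the integral diverges.
\<close>

definition ennreal_power :: "ennreal \<Rightarrow> real \<Rightarrow> ennreal" where
  "ennreal_power a r = (if a = \<infinity> then \<infinity> else ennreal (enn2real a powr r))"

definition Lp_norm :: "ennreal \<Rightarrow> (real ^ 'd \<Rightarrow> complex) \<Rightarrow> ennreal" where
  "Lp_norm p f =
     (if p = \<infinity> then esssup lebesgue (\<lambda>x. ennreal (norm (f x)))
      else ennreal_power (\<integral>\<^sup>+ x. ennreal (norm (f x) powr enn2real p) \<partial>lebesgue)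
             (1 / enn2real p))"

definition Lp_space :: "ennreal \<Rightarrow> (real ^ 'd \<Rightarrow> complex) set" where
  "Lp_space p = {f. f \<in> borel_measurable lebesgue \<and> Lp_norm p f < \<infinity>}"

definition C0_space :: "(real ^ 'd \<Rightarrow> complex) set" where
  "C0_space = {f. continuous_on UNIV f \<and> (f \<longlongrightarrow> 0) at_infinity}"

definition partial_deriv :: "'d \<Rightarrow> (real ^ 'd \<Rightarrow> complex) \<Rightarrow> real ^ 'd \<Rightarrow> complex" where
  "partial_deriv i f x = frechet_derivative f (at x) (axis i 1)"

text \<open>A list of coordinate indices plays the role of a multi-index.\<close>

definition iter_partial :: "'d list \<Rightarrow> (real ^ 'd \<Rightarrow> complex) \<Rightarrow> real ^ 'd \<Rightarrow> complex" where
  "iter_partial is f = foldr partial_deriv is f"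

text \<open>
  \<open>C\<^sup>\<infinity>(S)\<close>, intended for open \<open>S\<close>: every iterated partial derivative, including \<open>f\<close> itself,
  is differentiable (hence continuous) at every point of \<open>S\<close>. The values of \<open>f\<close> outside \<open>S\<close>
  do not matter.
\<close>

definition smooth_on :: "(real ^ 'd) set \<Rightarrow> (real ^ 'd \<Rightarrow> complex) \<Rightarrow> bool" where
  "smooth_on S f \<longleftrightarrow> (\<forall>is. \<forall>x\<in>S. iter_partial is f differentiable (at x))"

definition schwartz_space :: "(real ^ 'd \<Rightarrow> complex) set" where
  "schwartz_space =
     {g. smooth_on UNIV g \<and> (\<forall>is k. bounded (range (\<lambda>x. norm x ^ k *\<^sub>R iter_partial is g x)))}"

definition fourier :: "(real ^ 'd \<Rightarrow> complex) \<Rightarrow> real ^ 'd \<Rightarrow> complex" where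
  "fourier f \<xi> =
     of_real ((2 * pi) powr (- real CARD('d) / 2)) *
     (LINT x|lebesgue. f x * exp (- \<i> * of_real (x \<bullet> \<xi>)))"

text \<open>The inverse transform is given by its integral formula, for integrable arguments.\<close>

definition inv_fourier :: "(real ^ 'd \<Rightarrow> complex) \<Rightarrow> real ^ 'd \<Rightarrow> complex" where
  "inv_fourier h x =
     of_real ((2 * pi) powr (- real CARD('d) / 2)) *
     (LINT \<xi>|lebesgue. h \<xi> * exp (\<i> * of_real (x \<bullet> \<xi>)))"

text \<open>The value of a symbol at the origin is irrelevant and left arbitrary.\<close>

definition homogeneous_class :: "real \<Rightarrow> (real ^ 'd \<Rightarrow> complex) set" where
  "homogeneous_class \<alpha> =
     {\<psi>. (\<forall>\<xi>. \<xi> \<noteq> 0 \<longrightarrow> \<psi> \<xi> \<noteq> 0) \<and> smooth_on (UNIV - {0}) \<psi> \<and>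
         (\<forall>\<tau>>0. \<forall>\<xi>. \<xi> \<noteq> 0 \<longrightarrow> \<psi> (\<tau> *\<^sub>R \<xi>) = of_real (\<tau> powr \<alpha>) * \<psi> \<xi>)}"

definition multiplier_op ::
    "(real ^ 'd \<Rightarrow> complex) \<Rightarrow> (real ^ 'd \<Rightarrow> complex) \<Rightarrow> real ^ 'd \<Rightarrow> complex" where
  "multiplier_op \<psi> g = inv_fourier (\<lambda>\<xi>. \<psi> \<xi> * fourier g \<xi>)"

definition W_space :: "ennreal \<Rightarrow> (real ^ 'd \<Rightarrow> complex) \<Rightarrow> (real ^ 'd \<Rightarrow> complex) set" where
  "W_space p \<psi> = {g \<in> schwartz_space. multiplier_op \<psi> g \<in> Lp_space p}"

definition W_seminorm :: "ennreal \<Rightarrow> (real ^ 'd \<Rightarrow> complex) \<Rightarrow> (real ^ 'd \<Rightarrow> complex) \<Rightarrow> ennreal" where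
  "W_seminorm p \<psi> g = Lp_norm p (multiplier_op \<psi> g)"

definition K_functional ::
    "(real ^ 'd \<Rightarrow> complex) \<Rightarrow> real \<Rightarrow> ennreal \<Rightarrow> ennreal \<Rightarrow> (real ^ 'd \<Rightarrow> complex) \<Rightarrow> ennreal" where
  "K_functional f \<delta> q p \<psi> =
     (INF g\<in>W_space p \<psi>. Lp_norm q (\<lambda>x. f x - g x) + ennreal \<delta> * W_seminorm p \<psi> g)"

end

theory Submission
  imports Defs "HOL-Probability.Characteristic_Functions" "HOL-Probability.Sinc_Integral"
begin

text \<open>
  For \<open>p < 1\<close> the \<open>L\<^sub>p\<close> quasi-norm of a function can be made small without changing its local averages,
  by concentrating its mass on small sets. This is why the seminorm \<open>\<parallel>\<psi>(D) g\<parallel>\<^sub>p\<close> does not penalise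
  anything: every \<open>f\<close> has arbitrarily close approximants \<open>g\<close> for which it is arbitrarily small.

  The concentration is done by modulation. Let \<open>g\<close> be band-limited with a spectrum away from the
  origin, and \<open>u = \<psi>(D) g\<close>. Replace \<open>u\<close> by \<open>u (1 + cos (n x\<^sub>j))\<close>. By the Riemann-Lebesgue lemma and the
  strict concavity of the \<open>p\<close>-th power, this decreases the integral of \<open>\<bar>u\<bar>\<^sup>p\<close> by a fixed factor as
  \<open>n\<close> tends to infinity (\<open>mass_modulated\<close>). The corresponding change of \<open>g\<close> lives at frequencies of
  size \<open>n\<close>, where \<open>\<psi>\<close> is of size \<open>n\<^sup>\<alpha>\<close>; so it is of order \<open>n\<^sup>-\<^sup>\<alpha>\<close>, even in weighted uniform norms
  (\<open>osc_int_shifted_symbol_decay\<close>, \<open>contraction_step\<close>). Iterating makes \<open>u\<close> as small as desired and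
  leaves \<open>g\<close> essentially unchanged (\<open>small_mass_approximation\<close>).

  Frequencies near the origin cannot be treated in this way, as \<open>1 / \<psi>\<close> is singular there. But the part
  of \<open>g\<close> with frequencies below \<open>2\<^sup>-\<^sup>J\<close> already has a small seminorm: a dyadic decomposition and
  homogeneity bound the \<open>p\<close>-th power of its seminorm by a geometric series of order
  \<open>2\<close> to the power \<open>- J ((\<alpha> + d) p - d)\<close>, which converges precisely for \<open>\<alpha> > d (1 / p - 1)\<close>
  (\<open>nn_integral_low_freq_small\<close>). Together this gives \<open>band_limited_approximation\<close>.

  It remains to approximate \<open>f\<close> by band-limited functions. Continuous functions with compact support are
  dense in \<open>L\<^sub>q\<close> and in \<open>C\<^sub>0\<close>, and mollifying them with the Fourier transform of a cut-off function
  gives band-limited approximants in weighted uniform norms (\<open>Cc_band_limited_approximation\<close>).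
  That these lie in the Schwartz space and have the expected Fourier transform rests on the decay of
  Fourier integrals of test functions (\<open>osc_int_decay\<close>) and on Fourier inversion
  (\<open>fourier_inv_fourier\<close>).
\<close>

section \<open>Smooth functions\<close>

lemma iter_partial_Nil [simp]: "iter_partial [] f = f"
  by (simp add: iter_partial_def)

lemma iter_partial_snoc: "iter_partial (is @ [i]) f = iter_partial is (partial_deriv i f)"
  by (simp add: iter_partial_def)

lemma iter_partial_Cons: "iter_partial (i # is) f = partial_deriv i (iter_partial is f)"
  by (simp add: iter_partial_def)

lemma partial_deriv_eqI:
  "(f has_derivative f') (at x) \<Longrightarrow> partial_deriv i f x = f' (axis i 1)"
  by (metis partial_deriv_def frechet_derivative_at)

lemma frechet_derivative_cong_open:
  assumes "open S" "x \<in> S" "\<And>y. y \<in> S \<Longrightarrow> f y = g y"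
  shows "frechet_derivative f (at x) = frechet_derivative g (at x)"
proof -
  have "(f has_derivative D) (at x) \<longleftrightarrow> (g has_derivative D) (at x)" for D
    by (metis has_derivative_transform_within_open assms)
  then show ?thesis
    by (simp add: frechet_derivative_def)
qed

lemma partial_deriv_cong_open:
  assumes "open S" "x \<in> S" "\<And>y. y \<in> S \<Longrightarrow> f y = g y"
  shows "partial_deriv i f x = partial_deriv i g x"
  using frechet_derivative_cong_open[OF assms] by (simp add: partial_deriv_def)

lemma iter_partial_cong_open:
  assumes "open S" "x \<in> S" "\<And>y. y \<in> S \<Longrightarrow> f y = g y"
  shows "iter_partial is f x = iter_partial is g x"
  using assms(2)
proof (induction "is" arbitrary: x)
  case Nil
  then show ?case using assms(3) by simp
next
  case (Cons i "is")
  then show ?case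
    unfolding iter_partial_Cons using partial_deriv_cong_open[OF assms(1)] by blast
qed

lemma differentiable_cong_open:
  assumes "open S" "x \<in> S" "\<And>y. y \<in> S \<Longrightarrow> f y = g y" "f differentiable (at x)"
  shows "g differentiable (at x)"
  using assms has_derivative_transform_within_open unfolding differentiable_def by blast

lemma smooth_on_cong:
  assumes "open S" "\<And>y. y \<in> S \<Longrightarrow> f y = g y" "smooth_on S f"
  shows "smooth_on S g"
  unfolding smooth_on_def
proof (intro allI ballI)
  fix "is" x assume "x \<in> S"
  moreover have "iter_partial is f differentiable (at x)"
    using assms \<open>x \<in> S\<close> by (auto simp: smooth_on_def)
  moreover have "iter_partial is f y = iter_partial is g y" if "y \<in> S" for y
    using iter_partial_cong_open[OF assms(1) that assms(2)] .
  ultimately show "iter_partial is g differentiable (at x)"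
    using differentiable_cong_open[OF assms(1)] by metis
qed

lemma smooth_on_differentiable: "smooth_on S f \<Longrightarrow> x \<in> S \<Longrightarrow> f differentiable (at x)"
  unfolding smooth_on_def by (metis iter_partial_Nil)

lemma smooth_on_partial_deriv: "smooth_on S f \<Longrightarrow> smooth_on S (partial_deriv i f)"
  unfolding smooth_on_def by (metis iter_partial_snoc)

lemma smooth_on_subset: "smooth_on S f \<Longrightarrow> T \<subseteq> S \<Longrightarrow> smooth_on T f"
  unfolding smooth_on_def by blast

text \<open>
  Smoothness is the greatest property that implies differentiability and is inherited by the
  partial derivatives. This coinduction principle replaces inductions over multi-indices: to show
  that \<open>f\<close> is smooth one only has to name a class of differentiable functions that contains \<open>f\<close> and
  that differentiation does not leave.
\<close>

lemma smooth_on_coinduct: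
  assumes S: "open S" and "P f"
    and diff: "\<And>f x. P f \<Longrightarrow> x \<in> S \<Longrightarrow> f differentiable (at x)"
    and deriv: "\<And>f i. P f \<Longrightarrow> \<exists>g. P g \<and> (\<forall>x\<in>S. partial_deriv i f x = g x)"
  shows "smooth_on S f"
proof -
  have *: "\<exists>g. P g \<and> (\<forall>x\<in>S. iter_partial is f x = g x)" if "P f" for "is" f
    using that
  proof (induction "is" arbitrary: f)
    case (Cons i "is")
    obtain g where g: "P g" "\<forall>x\<in>S. iter_partial is f x = g x"
      using Cons by blast
    obtain g' where g': "P g'" "\<forall>x\<in>S. partial_deriv i g x = g' x"
      using deriv[OF g(1)] by blast
    show ?case
      unfolding iter_partial_Cons
      using partial_deriv_cong_open[OF S, of _ "iter_partial is f" g] g g' by metis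
  qed auto
  show ?thesis
    unfolding smooth_on_def
  proof (intro allI ballI)
    fix "is" x assume x: "x \<in> S"
    obtain g where g: "P g" "\<forall>x\<in>S. iter_partial is f x = g x"
      using *[OF \<open>P f\<close>] by blast
    show "iter_partial is f differentiable (at x)"
      using differentiable_cong_open[OF S x, of g "iter_partial is f"] g diff x by auto
  qed
qed

text \<open>
  For \<open>P = 1\<close> this is the standard smooth function that is flat at \<open>0\<close>. The polynomial factor
  makes the family closed under differentiation.
\<close>

definition flat_exp :: "real poly \<Rightarrow> real \<Rightarrow> real" where
  "flat_exp P t = (if t > 0 then poly P (1 / t) * exp (- 1 / t) else 0)"

lemma poly_times_exp_minus_tendsto_0: "((\<lambda>x::real. poly P x * exp (- x)) \<longlongrightarrow> 0) at_top"
proof -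
  have "((\<lambda>x::real. \<Sum>i\<le>degree P. coeff P i * (x ^ i / exp x)) \<longlongrightarrow> 0) at_top"
    by (intro tendsto_null_sum tendsto_mult_right_zero tendsto_power_div_exp_0)
  then show ?thesis
    by (simp add: poly_altdef exp_minus sum_distrib_right divide_inverse mult.assoc)
qed

text \<open>
  Away from \<open>0\<close> this is the product rule; at \<open>0\<close> it holds since \<open>exp (- 1 / t)\<close> beats every power of
  \<open>1 / t\<close>.
\<close>

lemma flat_has_field_derivative:
  "(flat_exp P has_field_derivative flat_exp ([:0,0,1:] * (P - pderiv P)) t) (at t)"
proof -
  consider "t > 0" | "t < 0" | "t = 0" by linarith
  then show ?thesis
  proof cases
    case 1
    have "((\<lambda>t. poly P (1 / t) * exp (- 1 / t)) has_field_derivative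
        flat_exp ([:0,0,1:] * (P - pderiv P)) t) (at t)"
      using 1 unfolding flat_exp_def
      by (auto intro!: derivative_eq_intros DERIV_chain2[OF poly_DERIV] simp: field_simps power2_eq_square)
    then show ?thesis
      by (rule has_field_derivative_transform_within_open[where S = "{0<..}"])
        (use 1 in \<open>auto simp: flat_exp_def\<close>)
  next
    case 2
    have "((\<lambda>t. 0) has_field_derivative flat_exp ([:0,0,1:] * (P - pderiv P)) t) (at t)"
      using 2 by (simp add: flat_exp_def)
    then show ?thesis
      by (rule has_field_derivative_transform_within_open[where S = "{..<0}"])
        (use 2 in \<open>auto simp: flat_exp_def\<close>)
  next
    case 3
    have "((\<lambda>y. flat_exp P y / y) \<longlongrightarrow> 0) (at_right 0)"
    proof -
      have "((\<lambda>x::real. poly (pCons 0 P) x * exp (- x)) \<longlongrightarrow> 0) at_top"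
        by (rule poly_times_exp_minus_tendsto_0)
      then have "((\<lambda>y::real. poly (pCons 0 P) (inverse y) * exp (- inverse y)) \<longlongrightarrow> 0) (at_right 0)"
        by (rule filterlim_compose) (rule filterlim_inverse_at_top_right)
      then show ?thesis
        by (rule Lim_transform_eventually)
          (auto simp: eventually_at_filter flat_exp_def field_simps)
    qed
    moreover have "((\<lambda>y. flat_exp P y / y) \<longlongrightarrow> 0) (at_left 0)"
      by (rule tendsto_eventually) (auto simp: eventually_at_filter flat_exp_def)
    ultimately have "((\<lambda>y. flat_exp P y / y) \<longlongrightarrow> 0) (at 0)"
      by (simp add: filterlim_split_at)
    then show ?thesis
      using 3 by (simp add: has_field_derivative_iff flat_exp_def)
  qed
qed

text \<open>
  A class of expressions that is visibly closed under differentiation; by coinduction its members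
  are smooth. This gives the closure properties of smooth functions and the smoothness of cut-off
  functions at one stroke.
\<close>

inductive smooth_expr :: "(real ^ 'd) set \<Rightarrow> (real ^ 'd \<Rightarrow> complex) \<Rightarrow> bool" for S where
  smooth: "smooth_on S f \<Longrightarrow> smooth_expr S f"
| const: "smooth_expr S (\<lambda>x. c)"
| coord: "smooth_expr S (\<lambda>x. of_real (x $ i))"
| flat: "smooth_expr S (\<lambda>x. of_real (flat_exp P (r + s * (x \<bullet> x))))"
| add: "smooth_expr S f \<Longrightarrow> smooth_expr S g \<Longrightarrow> smooth_expr S (\<lambda>x. f x + g x)"
| mult: "smooth_expr S f \<Longrightarrow> smooth_expr S g \<Longrightarrow> smooth_expr S (\<lambda>x. f x * g x)"
| inverse: "smooth_expr S f \<Longrightarrow> (\<And>x. x \<in> S \<Longrightarrow> f x \<noteq> 0) \<Longrightarrow> smooth_expr S (\<lambda>x. inverse (f x))"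

lemma has_derivative_flat_quadratic:
  "((\<lambda>x::real^'d. of_real (flat_exp P (r + s * (x \<bullet> x))) :: complex) has_derivative
    (\<lambda>h. of_real (flat_exp ([:0,0,1:] * (P - pderiv P)) (r + s * (x \<bullet> x)) * (2 * s * (x \<bullet> h))))) (at x)"
proof -
  have "((\<lambda>x::real^'d. r + s * (x \<bullet> x)) has_derivative (\<lambda>h. 2 * s * (x \<bullet> h))) (at x)"
    by (auto intro!: derivative_eq_intros simp: inner_commute algebra_simps)
  from has_derivative_compose[OF this flat_has_field_derivative[unfolded has_field_derivative_def]]
  have "((\<lambda>x::real^'d. flat_exp P (r + s * (x \<bullet> x))) has_derivative
      (\<lambda>h. flat_exp ([:0,0,1:] * (P - pderiv P)) (r + s * (x \<bullet> x)) * (2 * s * (x \<bullet> h)))) (at x)"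
    by simp
  then show ?thesis
    by (rule has_derivative_of_real)
qed

lemma smooth_expr_deriv:
  fixes S :: "(real ^ 'd) set"
  assumes "smooth_expr S f"
  shows "(\<forall>x\<in>S. f differentiable (at x)) \<and>
         (\<forall>i. \<exists>g. smooth_expr S g \<and> (\<forall>x\<in>S. partial_deriv i f x = g x))"
  using assms
proof induction
  case (smooth f)
  then show ?case
    using smooth_on_differentiable smooth_on_partial_deriv smooth_expr.smooth by blast
next
  case (const c)
  have "partial_deriv i (\<lambda>x. c) x = 0" for i x
    by (rule partial_deriv_eqI) (auto intro: derivative_eq_intros)
  then show ?case
    by (intro conjI allI ballI exI[of _ "\<lambda>x. 0"]) (auto intro: smooth_expr.const)
next
  case (coord j)
  have d: "((\<lambda>x. complex_of_real (x $ j)) has_derivative (\<lambda>h. of_real (h $ j))) (at x)" for x :: "real^'d"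
    by (intro has_derivative_of_real bounded_linear_imp_has_derivative bounded_linear_vec_nth)
  have "partial_deriv i (\<lambda>x. complex_of_real (x $ j)) x = of_real (axis i 1 $ j)" for i x
    by (rule partial_deriv_eqI[OF d])
  then show ?case
    by (intro conjI allI ballI exI[of _ "\<lambda>x. of_real (axis _ 1 $ j)"])
      (use d in \<open>auto intro: smooth_expr.const simp: differentiable_def\<close>)
next
  case (flat P r s)
  let ?D = "\<lambda>i (x :: real ^ 'd). complex_of_real (flat_exp ([:0,0,1:] * (P - pderiv P)) (r + s * (x \<bullet> x))) *
      (of_real (2 * s) * of_real (x $ i))"
  show ?case
  proof (intro conjI allI ballI)
    fix x :: "real ^ 'd"
    show "(\<lambda>x. complex_of_real (flat_exp P (r + s * (x \<bullet> x)))) differentiable (at x)"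
      using has_derivative_flat_quadratic by (rule differentiableI)
  next
    fix i
    have "partial_deriv i (\<lambda>x. of_real (flat_exp P (r + s * (x \<bullet> x)))) x = ?D i x" for x
      by (subst partial_deriv_eqI[OF has_derivative_flat_quadratic]) (simp add: inner_axis)
    moreover have "smooth_expr S (?D i)"
      by (intro smooth_expr.mult smooth_expr.flat smooth_expr.const smooth_expr.coord)
    ultimately show "\<exists>g. smooth_expr S g \<and>
        (\<forall>x\<in>S. partial_deriv i (\<lambda>x. of_real (flat_exp P (r + s * (x \<bullet> x)))) x = g x)"
      by (intro exI[of _ "?D i"]) simp
  qed
next
  case (add f g)
  have d: "((\<lambda>x. f x + g x) has_derivative (\<lambda>h. frechet_derivative f (at x) h + frechet_derivative g (at x) h)) (at x)"
    if "x \<in> S" for x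
    using add.IH that by (auto intro!: has_derivative_add simp: frechet_derivative_works)
  show ?case
  proof (intro conjI allI ballI)
    fix i
    obtain f' g' where "smooth_expr S f'" "\<forall>x\<in>S. partial_deriv i f x = f' x"
      "smooth_expr S g'" "\<forall>x\<in>S. partial_deriv i g x = g' x"
      using add.IH by metis
    then show "\<exists>h. smooth_expr S h \<and> (\<forall>x\<in>S. partial_deriv i (\<lambda>x. f x + g x) x = h x)"
      using partial_deriv_eqI[OF d] smooth_expr.add[of S f' g'] by (auto simp: partial_deriv_def)
  qed (use d in \<open>auto simp: differentiable_def\<close>)
next
  case (mult f g)
  have d: "((\<lambda>x. f x * g x) has_derivative
      (\<lambda>h. f x * frechet_derivative g (at x) h + frechet_derivative f (at x) h * g x)) (at x)"
    if "x \<in> S" for x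
    using mult.IH that by (auto intro!: has_derivative_mult simp: frechet_derivative_works)
  show ?case
  proof (intro conjI allI ballI)
    fix i
    obtain f' g' where "smooth_expr S f'" "\<forall>x\<in>S. partial_deriv i f x = f' x"
      "smooth_expr S g'" "\<forall>x\<in>S. partial_deriv i g x = g' x"
      using mult.IH by metis
    then show "\<exists>h. smooth_expr S h \<and> (\<forall>x\<in>S. partial_deriv i (\<lambda>x. f x * g x) x = h x)"
      using partial_deriv_eqI[OF d] mult.hyps
        smooth_expr.add[OF smooth_expr.mult[of S f g'] smooth_expr.mult[of S f' g]]
      by (auto simp: partial_deriv_def)
  qed (use d in \<open>auto simp: differentiable_def\<close>)
next
  case (inverse f)
  have d: "((\<lambda>x. inverse (f x)) has_derivative
      (\<lambda>h. - (inverse (f x) * frechet_derivative f (at x) h * inverse (f x)))) (at x)"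
    if "x \<in> S" for x
    by (rule Deriv.has_derivative_inverse) (use inverse that in \<open>auto simp: frechet_derivative_works\<close>)
  show ?case
  proof (intro conjI allI ballI)
    fix i
    obtain f' where f': "smooth_expr S f'" "\<forall>x\<in>S. partial_deriv i f x = f' x"
      using inverse.IH by metis
    have "smooth_expr S (\<lambda>x. (- 1) * (inverse (f x) * f' x * inverse (f x)))"
      using inverse.hyps f'(1) by (intro smooth_expr.mult smooth_expr.const smooth_expr.inverse) auto
    then show "\<exists>h. smooth_expr S h \<and> (\<forall>x\<in>S. partial_deriv i (\<lambda>x. inverse (f x)) x = h x)"
      using partial_deriv_eqI[OF d] f'(2)
      by (intro exI[of _ "\<lambda>x. (- 1) * (inverse (f x) * f' x * inverse (f x))"]) (auto simp: partial_deriv_def)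
  qed (use d in \<open>auto simp: differentiable_def\<close>)
qed

lemma smooth_on_smooth_expr:
  assumes "open S" "smooth_expr S f"
  shows "smooth_on S f"
  using assms
proof (rule smooth_on_coinduct[where P = "smooth_expr S"])
  fix g x i assume g: "smooth_expr S g"
  show "\<exists>h. smooth_expr S h \<and> (\<forall>x\<in>S. partial_deriv i g x = h x)"
    using smooth_expr_deriv[OF g] by metis
  show "g differentiable (at x)" if "x \<in> S"
    using smooth_expr_deriv[OF g] that by metis
qed

lemma smooth_on_add: "open S \<Longrightarrow> smooth_on S f \<Longrightarrow> smooth_on S g \<Longrightarrow> smooth_on S (\<lambda>x. f x + g x)"
  by (intro smooth_on_smooth_expr smooth_expr.add) (auto intro: smooth_expr.smooth)

lemma smooth_on_mult: "open S \<Longrightarrow> smooth_on S f \<Longrightarrow> smooth_on S g \<Longrightarrow> smooth_on S (\<lambda>x. f x * g x)"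
  by (intro smooth_on_smooth_expr smooth_expr.mult) (auto intro: smooth_expr.smooth)

lemma smooth_on_const: "open S \<Longrightarrow> smooth_on S (\<lambda>x. c)"
  by (intro smooth_on_smooth_expr smooth_expr.const)

lemma smooth_on_coord: "open S \<Longrightarrow> smooth_on S (\<lambda>x. of_real (x $ i))"
  by (intro smooth_on_smooth_expr smooth_expr.coord)

lemma smooth_on_inverse:
  "open S \<Longrightarrow> smooth_on S f \<Longrightarrow> (\<And>x. x \<in> S \<Longrightarrow> f x \<noteq> 0) \<Longrightarrow> smooth_on S (\<lambda>x. inverse (f x))"
  by (intro smooth_on_smooth_expr smooth_expr.inverse) (auto intro: smooth_expr.smooth)

lemma has_derivative_affine_compose:
  fixes f :: "real^'d \<Rightarrow> complex"
  assumes "f differentiable (at (a + s *\<^sub>R x))"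
  shows "((\<lambda>x. f (a + s *\<^sub>R x)) has_derivative
     (\<lambda>h. of_real s * frechet_derivative f (at (a + s *\<^sub>R x)) h)) (at x)"
proof -
  have 1: "(f has_derivative frechet_derivative f (at (a + s *\<^sub>R x))) (at (a + s *\<^sub>R x))"
    using assms frechet_derivative_works by blast
  have 2: "((\<lambda>x. a + s *\<^sub>R x) has_derivative (\<lambda>h. s *\<^sub>R h)) (at x)"
    by (auto intro!: derivative_eq_intros)
  have "linear (frechet_derivative f (at (a + s *\<^sub>R x)))"
    using 1 has_derivative_linear by blast
  with has_derivative_compose[OF 2 1] show ?thesis
    by (simp add: linear_scale scaleR_conv_of_real[where 'a = complex])
qed

lemma partial_deriv_affine_compose:
  fixes f :: "real^'d \<Rightarrow> complex"
  assumes "f differentiable (at (a + s *\<^sub>R x))"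
  shows "partial_deriv i (\<lambda>x. f (a + s *\<^sub>R x)) x = of_real s * partial_deriv i f (a + s *\<^sub>R x)"
  using partial_deriv_eqI[OF has_derivative_affine_compose[OF assms]] by (simp add: partial_deriv_def)

lemma smooth_on_affine_compose:
  fixes f :: "real^'d \<Rightarrow> complex"
  assumes "smooth_on UNIV f"
  shows "smooth_on UNIV (\<lambda>x. f (a + s *\<^sub>R x))"
proof -
  let ?P = "\<lambda>u. \<exists>c f. smooth_on UNIV f \<and> u = (\<lambda>x. c * f (a + s *\<^sub>R x))"
  show ?thesis
  proof (rule smooth_on_coinduct[where P = ?P])
    show "?P (\<lambda>x. f (a + s *\<^sub>R x))"
      using assms by (intro exI[of _ 1] exI[of _ f]) auto
  next
    fix u x assume "?P u"
    then obtain c f where u: "smooth_on UNIV f" "u = (\<lambda>x. c * f (a + s *\<^sub>R x))" by blast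
    have "(\<lambda>x. f (a + s *\<^sub>R x)) differentiable (at x)"
      using has_derivative_affine_compose smooth_on_differentiable[OF u(1)] unfolding differentiable_def by blast
    then show "u differentiable (at x)"
      unfolding u(2) by (intro differentiable_mult) auto
  next
    fix u i assume "?P u"
    then obtain c f where u: "smooth_on UNIV f" "u = (\<lambda>x. c * f (a + s *\<^sub>R x))" by blast
    have "partial_deriv i u x = (c * of_real s) * partial_deriv i f (a + s *\<^sub>R x)" for x
      unfolding u(2)
      using partial_deriv_eqI[OF has_derivative_mult_right[OF has_derivative_affine_compose], of f a s x i c]
        smooth_on_differentiable[OF u(1)] by (simp add: partial_deriv_def)
    then show "\<exists>g. ?P g \<and> (\<forall>x\<in>UNIV. partial_deriv i u x = g x)"
      using smooth_on_partial_deriv[OF u(1), of i]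
      by (intro exI[of _ "\<lambda>x. (c * of_real s) * partial_deriv i f (a + s *\<^sub>R x)"]) blast
  qed auto
qed

section \<open>Test functions and the Fourier integral\<close>

definition test_fun :: "(real ^ 'd \<Rightarrow> complex) set" where
  "test_fun = {h. smooth_on UNIV h \<and> (\<exists>R. \<forall>\<xi>. norm \<xi> > R \<longrightarrow> h \<xi> = 0)}"

definition Cc_space :: "(real ^ 'd \<Rightarrow> complex) set" where
  "Cc_space = {f. continuous_on UNIV f \<and> (\<exists>R. \<forall>x. norm x > R \<longrightarrow> f x = 0)}"

lemma smooth_on_imp_continuous_on: "smooth_on S f \<Longrightarrow> continuous_on S f"
  by (meson continuous_at_imp_continuous_on differentiable_imp_continuous_within smooth_on_differentiable)

lemma test_fun_smooth: "h \<in> test_fun \<Longrightarrow> smooth_on UNIV h"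
  by (simp add: test_fun_def)

lemma test_funI: "smooth_on UNIV h \<Longrightarrow> (\<And>\<xi>. norm \<xi> > R \<Longrightarrow> h \<xi> = 0) \<Longrightarrow> h \<in> test_fun"
  by (auto simp: test_fun_def)

lemma test_fun_subset_Cc_space: "test_fun \<subseteq> Cc_space"
  by (auto simp: test_fun_def Cc_space_def smooth_on_imp_continuous_on)

lemma test_fun_imp_Cc: "h \<in> test_fun \<Longrightarrow> h \<in> Cc_space"
  using test_fun_subset_Cc_space by blast

lemma test_fun_add:
  assumes "h \<in> test_fun" "k \<in> test_fun"
  shows "(\<lambda>x. h x + k x) \<in> test_fun"
proof -
  obtain R1 R2 where R: "\<forall>\<xi>. norm \<xi> > R1 \<longrightarrow> h \<xi> = 0" "\<forall>\<xi>. norm \<xi> > R2 \<longrightarrow> k \<xi> = 0"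
    using assms by (auto simp: test_fun_def)
  show ?thesis
    by (rule test_funI[where R = "max R1 R2"])
      (use R in \<open>auto intro: smooth_on_add test_fun_smooth assms\<close>)
qed

lemma test_fun_mult:
  assumes "h \<in> test_fun" "smooth_on UNIV k"
  shows "(\<lambda>x. h x * k x) \<in> test_fun"
  using assms by (auto simp: test_fun_def smooth_on_mult)

lemma test_fun_mult_left:
  assumes "h \<in> test_fun" "smooth_on UNIV k"
  shows "(\<lambda>x. k x * h x) \<in> test_fun"
  using test_fun_mult[OF assms] by (simp add: mult.commute)

lemma test_fun_scale: "h \<in> test_fun \<Longrightarrow> (\<lambda>x. c * h x) \<in> test_fun"
  by (rule test_fun_mult_left) (auto intro: smooth_on_const)

lemma test_fun_affine:
  fixes h :: "real ^ 'd \<Rightarrow> complex"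
  assumes "h \<in> test_fun" "s \<noteq> 0"
  shows "(\<lambda>x. h (a + s *\<^sub>R x)) \<in> test_fun"
proof -
  obtain R where R: "\<forall>\<xi>. norm \<xi> > R \<longrightarrow> h \<xi> = 0"
    using assms by (auto simp: test_fun_def)
  have "h (a + s *\<^sub>R x) = 0" if "norm x > (R + norm a) / \<bar>s\<bar>" for x
  proof -
    have "R + norm a < \<bar>s\<bar> * norm x"
      using that assms(2) by (simp add: field_simps)
    also have "\<dots> = norm (s *\<^sub>R x)" by simp
    also have "\<dots> \<le> norm (a + s *\<^sub>R x) + norm a"
      using norm_triangle_ineq4[of "a + s *\<^sub>R x" a] by simp
    finally show ?thesis using R by simp
  qed
  with smooth_on_affine_compose[OF test_fun_smooth[OF assms(1)]] show ?thesis
    by (rule test_funI)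
qed

lemma test_fun_shift:
  fixes h :: "real ^ 'd \<Rightarrow> complex"
  assumes "h \<in> test_fun"
  shows "(\<lambda>x. h (x - a)) \<in> test_fun"
  using test_fun_affine[OF assms, of 1 "- a"] by simp

lemma test_fun_partial_deriv:
  assumes "h \<in> test_fun"
  shows "partial_deriv i h \<in> test_fun"
proof -
  obtain R where R: "\<forall>\<xi>. norm \<xi> > R \<longrightarrow> h \<xi> = 0"
    using assms by (auto simp: test_fun_def)
  have "partial_deriv i h \<xi> = 0" if "norm \<xi> > R" for \<xi>
  proof -
    have "partial_deriv i h \<xi> = partial_deriv i (\<lambda>x. 0) \<xi>"
      by (rule partial_deriv_cong_open[of "{\<xi>. R < norm \<xi>}"])
        (use that R in \<open>auto intro: open_Collect_less continuous_intros\<close>)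
    also have "\<dots> = 0"
      by (rule partial_deriv_eqI) (auto intro: derivative_eq_intros)
    finally show ?thesis .
  qed
  then show ?thesis
    using assms by (auto simp: test_fun_def smooth_on_partial_deriv)
qed

text \<open>
  This is how the symbols \<open>\<psi>\<close> and \<open>1 / \<psi>\<close>, which are singular at the origin, enter the calculus of
  test functions: the singularity is hidden where the other factor is zero.
\<close>

lemma test_fun_mult_vanishing_near_0:
  fixes h :: "real ^ 'd \<Rightarrow> complex"
  assumes h: "h \<in> test_fun" and r: "r > 0" "\<And>\<xi>. norm \<xi> < r \<Longrightarrow> h \<xi> = 0"
    and k: "smooth_on (UNIV - {0}) k"
  shows "(\<lambda>\<xi>. h \<xi> * k \<xi>) \<in> test_fun"
proof -
  have "smooth_on (UNIV - {0}) (\<lambda>\<xi>. h \<xi> * k \<xi>)"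
    using h k by (intro smooth_on_mult) (auto intro: smooth_on_subset[OF test_fun_smooth])
  moreover have "smooth_on (ball 0 r) (\<lambda>\<xi>. h \<xi> * k \<xi>)"
    by (rule smooth_on_cong[of _ "\<lambda>x. 0"]) (use r in \<open>auto intro: smooth_on_const\<close>)
  ultimately have "smooth_on UNIV (\<lambda>\<xi>. h \<xi> * k \<xi>)"
    using r(1) unfolding smooth_on_def by (metis DiffI UNIV_I centre_in_ball singletonD)
  then show ?thesis
    using h by (auto simp: test_fun_def)
qed

definition cutoff :: "real ^ 'd \<Rightarrow> complex" where
  "cutoff x = of_real (flat_exp 1 (4 - x \<bullet> x) / (flat_exp 1 (4 - x \<bullet> x) + flat_exp 1 (x \<bullet> x - 1)))"

lemma flat_exp_1_nonneg: "flat_exp 1 t \<ge> 0" and flat_exp_1_pos: "t > 0 \<Longrightarrow> flat_exp 1 t > 0"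
  and flat_exp_1_eq_0: "t \<le> 0 \<Longrightarrow> flat_exp 1 t = 0"
  by (auto simp: flat_exp_def)

lemma cutoff_denominator_pos: "flat_exp 1 (4 - t) + flat_exp 1 (t - 1) > 0"
proof (cases "t < 4")
  case True
  then show ?thesis
    by (intro add_pos_nonneg flat_exp_1_pos flat_exp_1_nonneg) auto
next
  case False
  then show ?thesis
    by (intro add_nonneg_pos flat_exp_1_pos flat_exp_1_nonneg) auto
qed

lemma cutoff_eq_1: "norm x \<le> 1 \<Longrightarrow> cutoff x = 1"
proof -
  assume "norm x \<le> 1"
  then have "x \<bullet> x \<le> 1"
    by (simp add: dot_square_norm power_le_one)
  then show ?thesis
    using cutoff_denominator_pos[of "x \<bullet> x"] by (simp add: cutoff_def flat_exp_1_eq_0)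
qed

lemma cutoff_eq_0: "norm x \<ge> 2 \<Longrightarrow> cutoff x = 0"
proof -
  assume "norm x \<ge> 2"
  then have "x \<bullet> x \<ge> 2 ^ 2"
    unfolding dot_square_norm by (intro power_mono) auto
  then show ?thesis
    by (simp add: cutoff_def flat_exp_1_eq_0)
qed

lemma norm_cutoff_le_1: "norm (cutoff x) \<le> 1"
  using cutoff_denominator_pos[of "x \<bullet> x"] flat_exp_1_nonneg[of "4 - x \<bullet> x"] flat_exp_1_nonneg[of "x \<bullet> x - 1"]
  by (simp add: cutoff_def norm_divide del: of_real_add of_real_divide)

lemma cutoff_test_fun: "cutoff \<in> test_fun"
proof -
  have "smooth_on UNIV (\<lambda>x :: real ^ 'd. complex_of_real (flat_exp 1 (4 + (-1) * (x \<bullet> x))) *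
      inverse (of_real (flat_exp 1 (4 + (-1) * (x \<bullet> x))) + of_real (flat_exp 1 (-1 + 1 * (x \<bullet> x)))))"
  proof (intro smooth_on_smooth_expr smooth_expr.mult smooth_expr.inverse smooth_expr.add smooth_expr.flat)
    fix x :: "real ^ 'd"
    show "complex_of_real (flat_exp 1 (4 + (-1) * (x \<bullet> x))) + of_real (flat_exp 1 (-1 + 1 * (x \<bullet> x))) \<noteq> 0"
      using cutoff_denominator_pos[of "x \<bullet> x"]
      by (simp flip: of_real_add)
  qed simp
  moreover have "(\<lambda>x :: real ^ 'd. complex_of_real (flat_exp 1 (4 + (-1) * (x \<bullet> x))) *
      inverse (of_real (flat_exp 1 (4 + (-1) * (x \<bullet> x))) + of_real (flat_exp 1 (-1 + 1 * (x \<bullet> x))))) = cutoff"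
    by (simp add: fun_eq_iff cutoff_def divide_inverse)
  ultimately have "smooth_on UNIV (cutoff :: real ^ 'd \<Rightarrow> complex)"
    by (rule back_subst)
  then show ?thesis
    by (rule test_funI[where R = 2]) (simp add: cutoff_eq_0)
qed

lemma Cc_space_bounded:
  assumes "f \<in> Cc_space"
  obtains B R where "B \<ge> 0" "R \<ge> 0" "\<And>x. norm (f x) \<le> B" "\<And>x. norm x > R \<Longrightarrow> f x = 0"
proof -
  obtain R where R: "\<forall>x. norm x > R \<longrightarrow> f x = 0" and c: "continuous_on UNIV f"
    using assms by (auto simp: Cc_space_def)
  have "bounded (f ` cball 0 R)"
    by (intro compact_imp_bounded compact_continuous_image continuous_on_subset[OF c]) auto
  then obtain B where B: "\<forall>x\<in>cball 0 R. norm (f x) \<le> B"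
    by (auto simp: bounded_iff)
  have "norm (f x) \<le> max B 0" for x
    using R B by (cases "norm x \<le> R") (auto simp: not_le intro: max.coboundedI1)
  then show thesis
    using that[of "max B 0" "max R 0"] R by auto
qed

lemma Cc_space_borel [measurable_dest]: "f \<in> Cc_space \<Longrightarrow> f \<in> borel_measurable borel"
  by (auto simp: Cc_space_def intro: borel_measurable_continuous_onI)

lemma Cc_space_integrable:
  assumes "f \<in> Cc_space"
  shows "integrable lborel f"
proof -
  obtain B R where R: "\<And>x. norm x > R \<Longrightarrow> f x = 0"
    using Cc_space_bounded[OF assms] by metis
  have "integrable lborel (\<lambda>x. indicator (cball 0 R) x *\<^sub>R f x)"
    using assms by (intro borel_integrable_compact) (auto simp: Cc_space_def intro: continuous_on_subset)
  moreover have "(\<lambda>x. indicator (cball 0 R) x *\<^sub>R f x) = f"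
    using R by (auto simp: fun_eq_iff indicator_def not_le)
  ultimately show ?thesis by simp
qed

lemma Cc_space_mult:
  assumes "f \<in> Cc_space" "continuous_on UNIV g"
  shows "(\<lambda>x. f x * g x) \<in> Cc_space"
  using assms by (auto simp: Cc_space_def intro!: continuous_intros)

lemma Cc_space_mult_left:
  assumes "f \<in> Cc_space" "continuous_on UNIV g"
  shows "(\<lambda>x. g x * f x) \<in> Cc_space"
  using assms by (auto simp: Cc_space_def intro!: continuous_intros)

lemma integral_lborel_affine:
  fixes f :: "'a::euclidean_space \<Rightarrow> 'b::{banach, second_countable_topology}"
  assumes [measurable]: "f \<in> borel_measurable borel" and "c \<noteq> 0"
  shows "(LINT x|lborel. f x) = \<bar>c\<bar> ^ DIM('a) *\<^sub>R (LINT x|lborel. f (t + c *\<^sub>R x))"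
  by (subst lborel_affine[OF assms(2), of t]) (simp add: integral_density integral_distr)

lemma integrable_lborel_affine:
  fixes f :: "'a::euclidean_space \<Rightarrow> 'b::{banach, second_countable_topology}"
  assumes "integrable lborel f" and "c \<noteq> 0"
  shows "integrable lborel (\<lambda>x. f (t + c *\<^sub>R x))"
proof -
  have [measurable]: "f \<in> borel_measurable borel" using assms(1) by auto
  have "integrable (density (distr lborel borel (\<lambda>x. t + c *\<^sub>R x)) (\<lambda>_. ennreal (\<bar>c\<bar> ^ DIM('a)))) f"
    using assms lborel_affine[OF assms(2), of t] by (simp add: ennreal_power)
  then have "integrable (distr lborel borel (\<lambda>x. t + c *\<^sub>R x)) (\<lambda>x. \<bar>c\<bar> ^ DIM('a) *\<^sub>R f x)"
    by (subst (asm) integrable_density) auto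
  then have "integrable lborel (\<lambda>x. \<bar>c\<bar> ^ DIM('a) *\<^sub>R f (t + c *\<^sub>R x))"
    by (subst (asm) integrable_distr_eq) auto
  then have "integrable lborel (\<lambda>x. inverse (\<bar>c\<bar> ^ DIM('a)) *\<^sub>R (\<bar>c\<bar> ^ DIM('a) *\<^sub>R f (t + c *\<^sub>R x)))"
    by (rule integrable_scaleR_right)
  moreover have "inverse (\<bar>c\<bar> ^ DIM('a)) *\<^sub>R (\<bar>c\<bar> ^ DIM('a) *\<^sub>R y) = y" for y :: 'b
    using assms(2) by simp
  ultimately show ?thesis
    by (simp only:)
qed

lemma nn_integral_lborel_affine:
  fixes f :: "'a::euclidean_space \<Rightarrow> ennreal"
  assumes [measurable]: "f \<in> borel_measurable borel" and "c \<noteq> 0"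
  shows "(\<integral>\<^sup>+x. f x \<partial>lborel) = ennreal (\<bar>c\<bar> ^ DIM('a)) * (\<integral>\<^sup>+x. f (t + c *\<^sub>R x) \<partial>lborel)"
  by (subst lborel_affine[OF assms(2), of t])
    (simp add: nn_integral_density nn_integral_distr nn_integral_cmult ennreal_power)

lemma integral_lborel_shift:
  fixes f :: "'a::euclidean_space \<Rightarrow> 'b::{banach, second_countable_topology}"
  assumes "f \<in> borel_measurable borel"
  shows "(LINT x|lborel. f (x - t)) = (LINT x|lborel. f x)"
  using integral_lborel_affine[OF assms, of 1 "- t"] by simp

text \<open>
  The Fourier integral without its normalising constant and with the sign of the inverse
  transform. Up to a constant and a reflection, both transforms are instances of it.
\<close>

definition osc_int :: "(real ^ 'd \<Rightarrow> complex) \<Rightarrow> real ^ 'd \<Rightarrow> complex" where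
  "osc_int h x = (LINT \<xi>|lborel. h \<xi> * cis (x \<bullet> \<xi>))"

abbreviation osc_mult :: "(real ^ 'd \<Rightarrow> complex) \<Rightarrow> (real ^ 'd \<Rightarrow> complex) \<Rightarrow> real ^ 'd \<Rightarrow> complex" where
  "osc_mult \<psi> h \<equiv> osc_int (\<lambda>\<xi>. \<psi> \<xi> * h \<xi>)"

abbreviation osc_quot :: "(real ^ 'd \<Rightarrow> complex) \<Rightarrow> (real ^ 'd \<Rightarrow> complex) \<Rightarrow> real ^ 'd \<Rightarrow> complex" where
  "osc_quot \<psi> H \<equiv> osc_int (\<lambda>\<xi>. H \<xi> * inverse (\<psi> \<xi>))"

definition fourier_const :: "'d::finite itself \<Rightarrow> real" where
  "fourier_const _ = (2 * pi) powr (- real CARD('d) / 2)"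

lemma fourier_const_pos: "fourier_const TYPE('d::finite) > 0"
  by (simp add: fourier_const_def)

lemma cis_borel [measurable]: "cis \<in> borel_measurable borel"
  by (intro borel_measurable_continuous_onI continuous_intros)

lemma inv_fourier_eq_osc_int:
  fixes h :: "real ^ 'd \<Rightarrow> complex"
  assumes [measurable]: "h \<in> borel_measurable borel"
  shows "inv_fourier h x = of_real (fourier_const TYPE('d)) * osc_int h x"
proof -
  have "(LINT \<xi>|lebesgue. h \<xi> * exp (\<i> * of_real (x \<bullet> \<xi>))) = (LINT \<xi>|lborel. h \<xi> * cis (x \<bullet> \<xi>))"
    unfolding cis_conv_exp by (subst integral_completion) (auto simp flip: cis_conv_exp)
  then show ?thesis
    by (simp add: inv_fourier_def osc_int_def fourier_const_def)
qed

lemma fourier_eq_osc_int: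
  fixes h :: "real ^ 'd \<Rightarrow> complex"
  assumes [measurable]: "h \<in> borel_measurable borel"
  shows "fourier h x = of_real (fourier_const TYPE('d)) * osc_int h (- x)"
proof -
  have *: "exp (- \<i> * of_real (\<xi> \<bullet> x)) = cis ((- x) \<bullet> \<xi>)" for \<xi>
    by (simp add: cis_conv_exp inner_commute)
  have "(LINT \<xi>|lebesgue. h \<xi> * exp (- \<i> * of_real (\<xi> \<bullet> x))) = (LINT \<xi>|lborel. h \<xi> * cis ((- x) \<bullet> \<xi>))"
    unfolding * by (subst integral_completion) auto
  then show ?thesis
    by (simp add: fourier_def osc_int_def fourier_const_def)
qed

lemma integrable_mult_cis:
  assumes "integrable lborel h"
  shows "integrable lborel (\<lambda>\<xi>. h \<xi> * cis (x \<bullet> \<xi>))"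
proof -
  have [measurable]: "h \<in> borel_measurable borel" using assms by auto
  show ?thesis
    by (rule Bochner_Integration.integrable_bound[OF assms]) (auto simp: norm_mult)
qed

lemma osc_int_add:
  "integrable lborel h \<Longrightarrow> integrable lborel k \<Longrightarrow> osc_int (\<lambda>\<xi>. h \<xi> + k \<xi>) x = osc_int h x + osc_int k x"
  unfolding osc_int_def by (simp add: distrib_right integrable_mult_cis)

lemma osc_int_diff:
  "integrable lborel h \<Longrightarrow> integrable lborel k \<Longrightarrow> osc_int (\<lambda>\<xi>. h \<xi> - k \<xi>) x = osc_int h x - osc_int k x"
  unfolding osc_int_def by (simp add: left_diff_distrib integrable_mult_cis)

lemma osc_int_cmult: "osc_int (\<lambda>\<xi>. c * h \<xi>) x = c * osc_int h x"
  unfolding osc_int_def by (simp add: mult.assoc)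

lemma norm_osc_int_le:
  assumes "integrable lborel h"
  shows "norm (osc_int h x) \<le> (LINT \<xi>|lborel. norm (h \<xi>))"
  unfolding osc_int_def
  using integral_norm_bound[of lborel "\<lambda>\<xi>. h \<xi> * cis (x \<bullet> \<xi>)"] by (simp add: norm_mult)

lemma osc_int_shift:
  assumes [measurable]: "h \<in> borel_measurable borel"
  shows "osc_int (\<lambda>\<xi>. h (\<xi> - a)) x = cis (x \<bullet> a) * osc_int h x"
proof -
  have "osc_int (\<lambda>\<xi>. h (\<xi> - a)) x = (LINT \<xi>|lborel. h (\<xi> - a) * cis (x \<bullet> ((\<xi> - a) + a)))"
    by (simp add: osc_int_def)
  also have "\<dots> = (LINT \<xi>|lborel. h \<xi> * cis (x \<bullet> (\<xi> + a)))"
    by (rule integral_lborel_shift) measurable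
  also have "\<dots> = (LINT \<xi>|lborel. cis (x \<bullet> a) * (h \<xi> * cis (x \<bullet> \<xi>)))"
    by (simp add: inner_add_right cis_mult[symmetric] mult_ac)
  finally show ?thesis
    by (simp add: osc_int_def)
qed

lemma osc_int_dilate:
  fixes h :: "real ^ 'd \<Rightarrow> complex"
  assumes [measurable]: "h \<in> borel_measurable borel" and "s > 0"
  shows "osc_int (\<lambda>\<xi>. h (s *\<^sub>R \<xi>)) x = of_real (inverse s ^ CARD('d)) * osc_int h (x /\<^sub>R s)"
proof -
  have "osc_int h (x /\<^sub>R s) = s ^ CARD('d) *\<^sub>R (LINT \<xi>|lborel. h (s *\<^sub>R \<xi>) * cis ((x /\<^sub>R s) \<bullet> (s *\<^sub>R \<xi>)))"
    unfolding osc_int_def using \<open>s > 0\<close>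
    by (subst integral_lborel_affine[where c = s and t = 0]) auto
  also have "\<dots> = s ^ CARD('d) *\<^sub>R osc_int (\<lambda>\<xi>. h (s *\<^sub>R \<xi>)) x"
    using \<open>s > 0\<close> by (simp add: osc_int_def flip: mult.assoc)
  finally show ?thesis
    using \<open>s > 0\<close> by (simp add: scaleR_conv_of_real field_simps flip: of_real_mult)
qed

section \<open>Differentiation of Fourier integrals and integration by parts\<close>

lemma norm_cis_sub_linear: "norm (cis (a + b) - cis a - \<i> * of_real b * cis a) \<le> b\<^sup>2 / 2"
proof -
  have "cis (a + b) - cis a - \<i> * of_real b * cis a = cis a * (iexp b - (\<Sum>k\<le>1. (\<i> * b) ^ k / fact k))"
    by (simp add: cis_mult[symmetric] cis_conv_exp[symmetric] algebra_simps)
  also have "norm \<dots> \<le> \<bar>b\<bar> ^ Suc 1 / fact (Suc 1)"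
    unfolding norm_mult using iexp_approx1[of b 1] by simp
  finally show ?thesis
    by (simp add: numeral_2_eq_2)
qed

lemma Cc_space_moment:
  fixes h :: "real ^ 'd \<Rightarrow> complex"
  assumes "h \<in> Cc_space"
  shows "(\<lambda>\<xi>. \<i> * of_real (y \<bullet> \<xi>) * h \<xi>) \<in> Cc_space"
  by (rule Cc_space_mult_left[OF assms]) (auto intro!: continuous_intros)

text \<open>
  The remainder of the linearisation is bounded by the second moment of \<open>h\<close> times
  \<open>(norm y)\<^sup>2\<close>, because \<open>cis\<close> differs from its linear Taylor polynomial by at most half the square of
  the increment.
\<close>

lemma has_derivative_osc_int:
  fixes h :: "real ^ 'd \<Rightarrow> complex"
  assumes "h \<in> Cc_space"
  shows "(osc_int h has_derivative (\<lambda>y. osc_int (\<lambda>\<xi>. \<i> * of_real (y \<bullet> \<xi>) * h \<xi>) x)) (at x)"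
proof -
  let ?D = "\<lambda>y. osc_int (\<lambda>\<xi>. \<i> * of_real (y \<bullet> \<xi>) * h \<xi>) x"
  have int1: "integrable lborel h" and int2: "integrable lborel (\<lambda>\<xi>. \<i> * of_real (y \<bullet> \<xi>) * h \<xi>)" for y
    using Cc_space_integrable[OF assms] Cc_space_integrable[OF Cc_space_moment[OF assms]] by auto
  have int_norm: "integrable lborel (\<lambda>\<xi>. norm \<xi> ^ k * norm (h \<xi>))" for k
  proof -
    have "(\<lambda>\<xi>. of_real (norm \<xi> ^ k) * h \<xi>) \<in> Cc_space"
      by (rule Cc_space_mult_left[OF assms]) (auto intro!: continuous_intros)
    from integrable_norm[OF Cc_space_integrable[OF this]] show ?thesis
      by (simp add: norm_mult norm_power)
  qed
  have bl: "bounded_linear ?D"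
  proof (rule bounded_linear_intro[where K = "LINT \<xi>|lborel. norm \<xi> * norm (h \<xi>)"])
    fix y z
    have "(\<lambda>\<xi>. \<i> * of_real ((y + z) \<bullet> \<xi>) * h \<xi>) =
        (\<lambda>\<xi>. \<i> * of_real (y \<bullet> \<xi>) * h \<xi> + \<i> * of_real (z \<bullet> \<xi>) * h \<xi>)"
      by (simp add: fun_eq_iff algebra_simps inner_add_left)
    then show "?D (y + z) = ?D y + ?D z"
      by (simp add: osc_int_add[OF int2 int2])
  next
    fix r y
    have "(\<lambda>\<xi>. \<i> * of_real ((r *\<^sub>R y) \<bullet> \<xi>) * h \<xi>) = (\<lambda>\<xi>. of_real r * (\<i> * of_real (y \<bullet> \<xi>) * h \<xi>))"
      by (simp add: fun_eq_iff algebra_simps)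
    then show "?D (r *\<^sub>R y) = r *\<^sub>R ?D y"
      by (simp only: osc_int_cmult scaleR_conv_of_real)
  next
    fix y
    have "norm (?D y) \<le> (LINT \<xi>|lborel. norm (\<i> * of_real (y \<bullet> \<xi>) * h \<xi>))"
      by (rule norm_osc_int_le[OF int2])
    also have "\<dots> \<le> (LINT \<xi>|lborel. norm y * (norm \<xi> * norm (h \<xi>)))"
    proof (rule integral_mono)
      show "integrable lborel (\<lambda>\<xi>. norm y * (norm \<xi> * norm (h \<xi>)))"
        using int_norm[of 1] by simp
      show "norm (\<i> * of_real (y \<bullet> \<xi>) * h \<xi>) \<le> norm y * (norm \<xi> * norm (h \<xi>))" for \<xi>
        using mult_right_mono[OF Cauchy_Schwarz_ineq2[of y \<xi>], of "norm (h \<xi>)"]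
        by (simp add: norm_mult mult.assoc)
    qed (use int2 in auto)
    finally show "norm (?D y) \<le> norm y * (LINT \<xi>|lborel. norm \<xi> * norm (h \<xi>))"
      by simp
  qed
  define C where "C = (LINT \<xi>|lborel. norm \<xi> ^ 2 * norm (h \<xi>)) / 2"
  have C0: "C \<ge> 0" unfolding C_def by (intro divide_nonneg_pos integral_nonneg) auto
  have bound: "norm (osc_int h (x + y) - osc_int h x - ?D y) \<le> C * (norm y)\<^sup>2" for y
  proof -
    have "norm (osc_int h (x + y) - osc_int h x - ?D y) =
        norm (LINT \<xi>|lborel. h \<xi> * cis ((x + y) \<bullet> \<xi>) - h \<xi> * cis (x \<bullet> \<xi>) - \<i> * of_real (y \<bullet> \<xi>) * h \<xi> * cis (x \<bullet> \<xi>))"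
      unfolding osc_int_def using int1 int2[of y] by (simp add: integrable_mult_cis)
    also have "\<dots> \<le> (LINT \<xi>|lborel. norm (h \<xi> * cis ((x + y) \<bullet> \<xi>) - h \<xi> * cis (x \<bullet> \<xi>)
        - \<i> * of_real (y \<bullet> \<xi>) * h \<xi> * cis (x \<bullet> \<xi>)))"
      by (rule integral_norm_bound)
    also have "\<dots> \<le> (LINT \<xi>|lborel. (norm y)\<^sup>2 / 2 * (norm \<xi> ^ 2 * norm (h \<xi>)))"
    proof (rule integral_mono)
      fix \<xi>
      have "norm (h \<xi> * cis ((x + y) \<bullet> \<xi>) - h \<xi> * cis (x \<bullet> \<xi>) - \<i> * of_real (y \<bullet> \<xi>) * h \<xi> * cis (x \<bullet> \<xi>))
        = norm (h \<xi>) * norm (cis (x \<bullet> \<xi> + y \<bullet> \<xi>) - cis (x \<bullet> \<xi>) - \<i> * of_real (y \<bullet> \<xi>) * cis (x \<bullet> \<xi>))"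
        by (simp add: inner_add_left algebra_simps flip: norm_mult)
      also have "\<dots> \<le> norm (h \<xi>) * ((y \<bullet> \<xi>)\<^sup>2 / 2)"
        by (intro mult_left_mono norm_cis_sub_linear) auto
      also have "\<dots> \<le> norm (h \<xi>) * ((norm y * norm \<xi>)\<^sup>2 / 2)"
        using power_mono[OF Cauchy_Schwarz_ineq2[of y \<xi>], of 2] by (intro mult_left_mono) auto
      finally show "norm (h \<xi> * cis ((x + y) \<bullet> \<xi>) - h \<xi> * cis (x \<bullet> \<xi>) - \<i> * of_real (y \<bullet> \<xi>) * h \<xi> * cis (x \<bullet> \<xi>))
        \<le> (norm y)\<^sup>2 / 2 * (norm \<xi> ^ 2 * norm (h \<xi>))"
        by (simp add: power_mult_distrib mult_ac)
    qed (use int1 int2[of y] int_norm[of 2] in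
        \<open>auto intro!: integrable_mult_cis integrable_norm Bochner_Integration.integrable_diff\<close>)
    finally show ?thesis
      unfolding integral_mult_right_zero C_def by (simp add: mult.commute)
  qed
  have "((\<lambda>y. norm (osc_int h (x + y) - osc_int h x - ?D y) / norm y) \<longlongrightarrow> 0) (at 0)"
  proof (rule Lim_null_comparison)
    show "\<forall>\<^sub>F y in at 0. norm (norm (osc_int h (x + y) - osc_int h x - ?D y) / norm y) \<le> C * norm y"
      using bound by (auto simp: eventually_at_filter power2_eq_square field_simps)
    show "((\<lambda>y. C * norm y) \<longlongrightarrow> 0) (at 0)"
      by (auto intro!: tendsto_eq_intros)
  qed
  with bl show ?thesis
    by (simp add: has_derivative_at)
qed

lemma partial_deriv_osc_int:
  fixes h :: "real ^ 'd \<Rightarrow> complex"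
  assumes "h \<in> Cc_space"
  shows "partial_deriv j (osc_int h) = osc_int (\<lambda>\<xi>. \<i> * of_real (\<xi> $ j) * h \<xi>)"
  using partial_deriv_eqI[OF has_derivative_osc_int[OF assms]]
  by (simp add: fun_eq_iff inner_axis inner_commute)

lemma Cc_space_coord:
  fixes h :: "real ^ 'd \<Rightarrow> complex"
  assumes "h \<in> Cc_space"
  shows "(\<lambda>\<xi>. \<i> * of_real (\<xi> $ j) * h \<xi>) \<in> Cc_space"
  using Cc_space_moment[OF assms, of "axis j 1"] by (simp add: inner_axis inner_commute)

lemma smooth_on_osc_int:
  fixes h :: "real ^ 'd \<Rightarrow> complex"
  assumes "h \<in> Cc_space"
  shows "smooth_on UNIV (osc_int h)"
proof (rule smooth_on_coinduct[where P = "\<lambda>u. \<exists>h. h \<in> Cc_space \<and> u = osc_int h"])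
  fix u :: "real ^ 'd \<Rightarrow> complex" and i x
  assume "\<exists>h. h \<in> Cc_space \<and> u = osc_int h"
  then obtain h where h: "h \<in> Cc_space" "u = osc_int h" by blast
  show "u differentiable (at x)"
    using has_derivative_osc_int[OF h(1)] unfolding h(2) by (rule differentiableI)
  show "\<exists>g. (\<exists>h. h \<in> Cc_space \<and> g = osc_int h) \<and> (\<forall>x\<in>UNIV. partial_deriv i u x = g x)"
    unfolding h(2) partial_deriv_osc_int[OF h(1)] using Cc_space_coord[OF h(1)] by blast
qed (use assms in auto)

lemma iter_partial_osc_int:
  fixes h :: "real ^ 'd \<Rightarrow> complex"
  assumes "h \<in> test_fun"
  shows "\<exists>k\<in>test_fun. iter_partial is (osc_int h) = osc_int k"
proof (induction "is")
  case (Cons i "is")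
  then obtain k where k: "k \<in> test_fun" "iter_partial is (osc_int h) = osc_int k" by blast
  have "(\<lambda>\<xi>. \<i> * of_real (\<xi> $ i) * k \<xi>) \<in> test_fun"
    by (rule test_fun_mult_left[OF k(1)])
      (auto intro!: smooth_on_mult smooth_on_const smooth_on_coord)
  then show ?case
    unfolding iter_partial_Cons k(2) partial_deriv_osc_int[OF test_fun_imp_Cc[OF k(1)]] by blast
qed (use assms in auto)

lemma has_vector_derivative_along_axis:
  fixes h :: "real ^ 'd \<Rightarrow> complex"
  assumes "h differentiable (at (\<xi> + t *\<^sub>R axis j 1))"
  shows "((\<lambda>t. h (\<xi> + t *\<^sub>R axis j 1)) has_vector_derivative partial_deriv j h (\<xi> + t *\<^sub>R axis j 1)) (at t)"
proof -
  have "((\<lambda>t::real. h (\<xi> + t *\<^sub>R axis j 1)) has_derivative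
      (\<lambda>s. frechet_derivative h (at (\<xi> + t *\<^sub>R axis j 1)) (s *\<^sub>R axis j 1))) (at t)"
    by (rule has_derivative_compose[of "\<lambda>t. \<xi> + t *\<^sub>R axis j 1" "\<lambda>t. t *\<^sub>R axis j 1"])
      (use assms in \<open>auto intro!: derivative_eq_intros simp: frechet_derivative_works\<close>)
  moreover have "linear (frechet_derivative h (at (\<xi> + t *\<^sub>R axis j 1)))"
    using assms linear_frechet_derivative by blast
  ultimately show ?thesis
    by (simp add: has_vector_derivative_def linear_scale partial_deriv_def)
qed

lemma has_vector_derivative_imp_tendsto_diff_quotient:
  assumes "(f has_vector_derivative c) (at 0)"
  shows "((\<lambda>t. (f t - f 0) /\<^sub>R t) \<longlongrightarrow> c) (at 0)"
proof -
  have "((\<lambda>t. norm (f t - f 0 - t *\<^sub>R c) / \<bar>t\<bar>) \<longlongrightarrow> 0) (at 0)"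
    using assms by (simp add: has_vector_derivative_def has_derivative_iff_norm)
  then have "((\<lambda>t. norm ((f t - f 0) /\<^sub>R t - c)) \<longlongrightarrow> 0) (at 0)"
  proof (rule Lim_transform_eventually)
    have "norm (f t - f 0 - t *\<^sub>R c) / \<bar>t\<bar> = norm ((f t - f 0) /\<^sub>R t - c)" if "t \<noteq> 0" for t
    proof -
      have "(f t - f 0) /\<^sub>R t - c = (f t - f 0 - t *\<^sub>R c) /\<^sub>R t"
        using that by (simp add: algebra_simps)
      then show ?thesis by (simp add: divide_inverse)
    qed
    then show "\<forall>\<^sub>F t in at 0. norm (f t - f 0 - t *\<^sub>R c) / \<bar>t\<bar> = norm ((f t - f 0) /\<^sub>R t - c)"
      by (auto simp: eventually_at_filter)
  qed
  then show ?thesis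
    using LIM_zero_iff tendsto_norm_zero_iff by blast
qed

lemma partial_deriv_diff_quotient:
  fixes h :: "real ^ 'd \<Rightarrow> complex"
  assumes "h differentiable (at \<xi>)"
  shows "(\<lambda>n. (h (\<xi> + (1 / Suc n) *\<^sub>R axis j 1) - h \<xi>) /\<^sub>R (1 / Suc n)) \<longlonglongrightarrow> partial_deriv j h \<xi>"
proof -
  have "((\<lambda>t::real. h (\<xi> + t *\<^sub>R axis j 1)) has_vector_derivative partial_deriv j h \<xi>) (at 0)"
    using has_vector_derivative_along_axis[of h \<xi> 0 j] assms by simp
  then have "((\<lambda>t::real. (h (\<xi> + t *\<^sub>R axis j 1) - h \<xi>) /\<^sub>R t) \<longlongrightarrow> partial_deriv j h \<xi>) (at 0)"
    using has_vector_derivative_imp_tendsto_diff_quotient by fastforce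
  moreover have "filterlim (\<lambda>n. 1 / real (Suc n)) (at 0) sequentially"
    by (intro filterlim_atI LIMSEQ_Suc lim_1_over_n) auto
  ultimately show ?thesis
    by (rule filterlim_compose)
qed

lemma norm_diff_along_axis_le:
  fixes h :: "real ^ 'd \<Rightarrow> complex"
  assumes "\<And>x. h differentiable (at x)" "\<And>x. norm (partial_deriv j h x) \<le> B"
  shows "norm (h (\<xi> + t *\<^sub>R axis j 1) - h \<xi>) \<le> B * \<bar>t\<bar>"
proof -
  have "norm (h (\<xi> + t *\<^sub>R axis j 1) - h (\<xi> + 0 *\<^sub>R axis j 1)) \<le> B * norm (t - 0)"
  proof (rule differentiable_bound[of UNIV])
    fix t :: real
    show "((\<lambda>t. h (\<xi> + t *\<^sub>R axis j 1)) has_derivative (\<lambda>s. s *\<^sub>R partial_deriv j h (\<xi> + t *\<^sub>R axis j 1))) (at t)"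
      using has_vector_derivative_along_axis[of h \<xi> t j] assms(1) by (simp add: has_vector_derivative_def)
    show "onorm (\<lambda>s. s *\<^sub>R partial_deriv j h (\<xi> + t *\<^sub>R axis j 1)) \<le> B"
    proof (rule onorm_le)
      show "norm (s *\<^sub>R partial_deriv j h (\<xi> + t *\<^sub>R axis j 1)) \<le> B * norm s" for s
        using mult_left_mono[OF assms(2), of "\<bar>s\<bar>"] by (simp add: mult.commute)
    qed
  qed auto
  then show ?thesis by simp
qed

text \<open>
  Integration by parts, obtained from translation invariance: the difference quotients of \<open>h\<close> with
  step \<open>t\<close> have the Fourier integral \<open>(cis (- t x\<^sub>j) - 1) / t\<close> times that of \<open>h\<close>; dominated convergence
  applies since they are bounded by the supremum of the partial derivative.
\<close>

lemma osc_int_partial_deriv: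
  fixes h :: "real ^ 'd \<Rightarrow> complex"
  assumes "h \<in> test_fun"
  shows "osc_int (partial_deriv j h) x = - \<i> * of_real (x $ j) * osc_int h x"
proof -
  let ?t = "\<lambda>n. 1 / real (Suc n)"
  let ?q = "\<lambda>n \<xi>. (h (\<xi> + ?t n *\<^sub>R axis j 1) - h \<xi>) /\<^sub>R ?t n"
  have int: "integrable lborel h"
    using Cc_space_integrable test_fun_imp_Cc assms by blast
  then have [measurable]: "h \<in> borel_measurable borel" by auto
  have diff: "h differentiable (at \<xi>)" for \<xi>
    using smooth_on_differentiable[OF test_fun_smooth[OF assms]] by simp
  have d_test: "partial_deriv j h \<in> Cc_space"
    by (intro test_fun_imp_Cc test_fun_partial_deriv assms)
  then have [measurable]: "partial_deriv j h \<in> borel_measurable borel"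
    by (rule Cc_space_borel)
  obtain B where B: "B \<ge> 0" "\<And>x. norm (partial_deriv j h x) \<le> B"
    using Cc_space_bounded[OF d_test] by metis
  obtain R where R: "R \<ge> 0" "\<And>x. norm x > R \<Longrightarrow> h x = 0"
    using Cc_space_bounded[OF test_fun_imp_Cc[OF assms]] by metis
  have q_bound: "norm (?q n \<xi>) \<le> B * indicator (cball 0 (R + 1)) \<xi>" for n \<xi>
  proof (cases "norm \<xi> \<le> R + 1")
    case True
    have "norm (?q n \<xi>) = norm (h (\<xi> + ?t n *\<^sub>R axis j 1) - h \<xi>) / \<bar>?t n\<bar>"
      by (simp add: divide_inverse)
    also have "\<dots> \<le> (B * \<bar>?t n\<bar>) / \<bar>?t n\<bar>"
      by (intro divide_right_mono norm_diff_along_axis_le diff B) auto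
    finally show ?thesis
      using True by simp
  next
    case False
    have "norm (?t n *\<^sub>R axis j (1::real) :: real ^ 'd) \<le> 1" by simp
    moreover have "norm \<xi> \<le> norm (\<xi> + ?t n *\<^sub>R axis j 1) + norm (?t n *\<^sub>R axis j (1::real) :: real ^ 'd)"
      using norm_triangle_ineq4[of "\<xi> + ?t n *\<^sub>R axis j 1" "?t n *\<^sub>R axis j 1"]
      by (simp only: add_diff_cancel_right')
    ultimately have "norm (\<xi> + ?t n *\<^sub>R axis j 1) > R"
      using False by linarith
    then show ?thesis
      using False R by simp
  qed
  have lim1: "(\<lambda>n. LINT \<xi>|lborel. ?q n \<xi> * cis (x \<bullet> \<xi>)) \<longlonglongrightarrow> (LINT \<xi>|lborel. partial_deriv j h \<xi> * cis (x \<bullet> \<xi>))"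
  proof (rule integral_dominated_convergence[where w = "\<lambda>\<xi>. B * indicator (cball 0 (R + 1)) \<xi>"])
    show "integrable lborel (\<lambda>\<xi>::real^'d. B * indicator (cball 0 (R + 1)) \<xi>)"
      using emeasure_bounded_finite[of "cball (0::real^'d) (R + 1)"] by auto
    show "AE \<xi> in lborel. (\<lambda>n. ?q n \<xi> * cis (x \<bullet> \<xi>)) \<longlonglongrightarrow> partial_deriv j h \<xi> * cis (x \<bullet> \<xi>)"
      by (intro AE_I2 tendsto_mult tendsto_const partial_deriv_diff_quotient diff)
    show "AE \<xi> in lborel. norm (?q n \<xi> * cis (x \<bullet> \<xi>)) \<le> B * indicator (cball 0 (R + 1)) \<xi>" for n
      using q_bound by (intro AE_I2) (simp add: norm_mult)
  qed auto
  have eq: "(LINT \<xi>|lborel. ?q n \<xi> * cis (x \<bullet> \<xi>)) = (cis (- (x $ j) * ?t n) - 1) /\<^sub>R ?t n * osc_int h x" for n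
  proof -
    have "osc_int (\<lambda>\<xi>. h (\<xi> + ?t n *\<^sub>R axis j 1)) x = cis (- (x $ j) * ?t n) * osc_int h x"
      using osc_int_shift[of h "- ?t n *\<^sub>R axis j 1" x] by (simp add: inner_axis mult.commute)
    moreover have "integrable lborel (\<lambda>\<xi>. h (\<xi> + ?t n *\<^sub>R axis j 1))"
      using integrable_lborel_affine[OF int, of 1 "?t n *\<^sub>R axis j 1"] by (simp add: add.commute)
    ultimately have "osc_int (\<lambda>\<xi>. h (\<xi> + ?t n *\<^sub>R axis j 1) - h \<xi>) x = (cis (- (x $ j) * ?t n) - 1) * osc_int h x"
      using int by (simp add: osc_int_diff algebra_simps)
    then show ?thesis
      by (simp add: osc_int_def scaleR_conv_of_real mult.assoc)
  qed
  have lim2: "(\<lambda>n. (cis (- (x $ j) * ?t n) - 1) /\<^sub>R ?t n * osc_int h x) \<longlonglongrightarrow> - \<i> * of_real (x $ j) * osc_int h x"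
  proof -
    have "((\<lambda>t. cis (- (x $ j) * t)) has_vector_derivative (- \<i> * of_real (x $ j))) (at 0)"
      unfolding cis_conv_exp
      by (auto intro!: derivative_eq_intros has_vector_derivative_real_field simp: algebra_simps)
    then have "((\<lambda>t. (cis (- (x $ j) * t) - 1) /\<^sub>R t) \<longlongrightarrow> - \<i> * of_real (x $ j)) (at 0)"
      using has_vector_derivative_imp_tendsto_diff_quotient by fastforce
    moreover have "filterlim (\<lambda>n. 1 / real (Suc n)) (at 0) sequentially"
      by (intro filterlim_atI LIMSEQ_Suc lim_1_over_n) auto
    ultimately show ?thesis
      by (intro tendsto_mult tendsto_const) (rule filterlim_compose)
  qed
  have "(LINT \<xi>|lborel. partial_deriv j h \<xi> * cis (x \<bullet> \<xi>)) = - \<i> * of_real (x $ j) * osc_int h x"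
    by (rule LIMSEQ_unique[OF lim1]) (unfold eq, rule lim2)
  then show ?thesis
    by (simp only: osc_int_def)
qed

section \<open>Rapid decay\<close>

text \<open>
  Some coordinate of \<open>x\<close> is at least \<open>norm x / d\<close>, so it suffices to control the powers of the single
  coordinates.
\<close>

lemma one_plus_norm_power_le:
  fixes x :: "real ^ 'd"
  assumes A: "A \<ge> 0" "A \<le> M" and coord: "\<And>j. \<bar>x $ j\<bar> ^ K * A \<le> M"
  shows "A * (1 + norm x) ^ K \<le> (2 * real CARD('d)) ^ K * M"
proof (cases "norm x \<le> 1")
  case True
  have "(1 + norm x) ^ K \<le> (2 * real CARD('d)) ^ K"
  proof (rule power_mono)
    have "real CARD('d) \<ge> 1" by (simp add: Suc_leI)
    then show "1 + norm x \<le> 2 * real CARD('d)" using True by linarith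
  qed auto
  then show ?thesis
    using A by (subst mult.commute) (intro mult_mono, auto)
next
  case False
  have "\<exists>j. norm x \<le> real CARD('d) * \<bar>x $ j\<bar>"
  proof (rule ccontr)
    assume "\<not> ?thesis"
    then have "(\<Sum>j\<in>UNIV. \<bar>x $ j\<bar>) < (\<Sum>j\<in>(UNIV::'d set). norm x / real CARD('d))"
      by (intro sum_strict_mono) (auto simp: not_le field_simps)
    then show False
      using norm_le_l1_cart[of x] by simp
  qed
  then obtain j where j: "norm x \<le> real CARD('d) * \<bar>x $ j\<bar>" by blast
  have "(1 + norm x) ^ K \<le> (2 * real CARD('d) * \<bar>x $ j\<bar>) ^ K"
    using False j by (intro power_mono) auto
  then have "A * (1 + norm x) ^ K \<le> A * (2 * real CARD('d) * \<bar>x $ j\<bar>) ^ K"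
    using A by (intro mult_left_mono)
  also have "\<dots> = (2 * real CARD('d)) ^ K * (\<bar>x $ j\<bar> ^ K * A)"
    by (simp add: power_mult_distrib)
  also have "\<dots> \<le> (2 * real CARD('d)) ^ K * M"
    by (intro mult_left_mono coord) auto
  finally show ?thesis .
qed

lemma osc_int_iter_partial:
  fixes h :: "real ^ 'd \<Rightarrow> complex"
  assumes "h \<in> test_fun"
  shows "iter_partial (replicate K j) h \<in> test_fun \<and>
    osc_int (iter_partial (replicate K j) h) x = (- \<i> * of_real (x $ j)) ^ K * osc_int h x"
  using assms
proof (induction K arbitrary: h)
  case (Suc K)
  have "replicate (Suc K) j = replicate K j @ [j]"
    by (simp add: replicate_append_same)
  then show ?case
    using Suc.IH[OF test_fun_partial_deriv[OF Suc.prems, of j]] osc_int_partial_deriv[OF Suc.prems, of j x]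
    by (simp only: iter_partial_snoc) (simp add: mult_ac)
qed simp

lemma iter_partial_add:
  assumes "smooth_on UNIV f" "smooth_on UNIV g"
  shows "iter_partial is (\<lambda>x. f x + g x) x = iter_partial is f x + iter_partial is g x"
  using assms
proof (induction "is" arbitrary: f g rule: rev_induct)
  case (snoc i "is")
  have "partial_deriv i (\<lambda>x. f x + g x) = (\<lambda>x. partial_deriv i f x + partial_deriv i g x)"
  proof
    fix x
    have "((\<lambda>x. f x + g x) has_derivative
        (\<lambda>h. frechet_derivative f (at x) h + frechet_derivative g (at x) h)) (at x)"
      using snoc.prems by (auto intro!: has_derivative_add smooth_on_differentiable simp flip: frechet_derivative_works)
    then show "partial_deriv i (\<lambda>x. f x + g x) x = partial_deriv i f x + partial_deriv i g x"
      by (subst partial_deriv_eqI) (auto simp: partial_deriv_def)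
  qed
  then show ?case
    using snoc by (simp add: iter_partial_snoc smooth_on_partial_deriv)
qed simp

lemma iter_partial_cmult:
  assumes "smooth_on UNIV f"
  shows "iter_partial is (\<lambda>x. c * f x) x = c * iter_partial is f x"
  using assms
proof (induction "is" arbitrary: f rule: rev_induct)
  case (snoc i "is")
  have "partial_deriv i (\<lambda>x. c * f x) = (\<lambda>x. c * partial_deriv i f x)"
  proof
    fix x
    have "((\<lambda>x. c * f x) has_derivative (\<lambda>h. c * frechet_derivative f (at x) h)) (at x)"
      using snoc.prems by (auto intro!: has_derivative_mult_right smooth_on_differentiable simp flip: frechet_derivative_works)
    then show "partial_deriv i (\<lambda>x. c * f x) x = c * partial_deriv i f x"
      by (subst partial_deriv_eqI) (auto simp: partial_deriv_def)
  qed
  then show ?case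
    using snoc by (simp add: iter_partial_snoc smooth_on_partial_deriv)
qed simp

lemma partial_deriv_mult:
  assumes "f differentiable (at x)" "g differentiable (at x)"
  shows "partial_deriv i (\<lambda>x. f x * g x) x = f x * partial_deriv i g x + partial_deriv i f x * g x"
proof -
  have "((\<lambda>x. f x * g x) has_derivative
      (\<lambda>h. f x * frechet_derivative g (at x) h + frechet_derivative f (at x) h * g x)) (at x)"
    using assms by (auto intro!: has_derivative_mult simp flip: frechet_derivative_works)
  then show ?thesis
    by (subst partial_deriv_eqI) (auto simp: partial_deriv_def)
qed

text \<open>
  All derivatives of \<open>H \<omega> * k (a + s \<omega>)\<close> are bounded uniformly in \<open>s \<in> [0, 1]\<close>, because every
  differentiation of the second factor only produces a further factor \<open>s\<close>.
\<close>

lemma iter_partial_scaled_product_bounded: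
  fixes H k :: "real ^ 'd \<Rightarrow> complex"
  assumes "H \<in> test_fun" "k \<in> test_fun"
  shows "\<exists>B. \<forall>s\<in>{0..1}. \<forall>\<omega>. norm (iter_partial is (\<lambda>\<omega>. H \<omega> * k (a + s *\<^sub>R \<omega>)) \<omega>) \<le> B"
  using assms
proof (induction "is" arbitrary: H k rule: rev_induct)
  case Nil
  obtain B1 B2 where "B1 \<ge> 0" "B2 \<ge> 0" "\<And>x. norm (H x) \<le> B1" "\<And>x. norm (k x) \<le> B2"
    by (metis Cc_space_bounded test_fun_imp_Cc Nil)
  then show ?case
    by (intro exI[of _ "B1 * B2"]) (auto simp: norm_mult intro!: mult_mono)
next
  case (snoc i "is")
  note dH = smooth_on_differentiable[OF test_fun_smooth[OF snoc.prems(1)] UNIV_I]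
    and dk = smooth_on_differentiable[OF test_fun_smooth[OF snoc.prems(2)] UNIV_I]
  obtain B1 where B1: "\<forall>s\<in>{0..1}. \<forall>\<omega>. norm (iter_partial is (\<lambda>\<omega>. partial_deriv i H \<omega> * k (a + s *\<^sub>R \<omega>)) \<omega>) \<le> B1"
    using snoc.IH[OF test_fun_partial_deriv[OF snoc.prems(1)] snoc.prems(2)] by blast
  obtain B2 where B2: "\<forall>s\<in>{0..1}. \<forall>\<omega>. norm (iter_partial is (\<lambda>\<omega>. H \<omega> * partial_deriv i k (a + s *\<^sub>R \<omega>)) \<omega>) \<le> B2"
    using snoc.IH[OF snoc.prems(1) test_fun_partial_deriv[OF snoc.prems(2)]] by blast
  show ?case
  proof (intro exI ballI allI)
    fix s :: real and \<omega> assume s: "s \<in> {0..1}"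
    let ?u = "\<lambda>\<omega>. partial_deriv i H \<omega> * k (a + s *\<^sub>R \<omega>)" and ?v = "\<lambda>\<omega>. H \<omega> * partial_deriv i k (a + s *\<^sub>R \<omega>)"
    have sm: "smooth_on UNIV ?u" "smooth_on UNIV ?v"
      by (intro test_fun_smooth[OF test_fun_mult] test_fun_partial_deriv smooth_on_affine_compose
          smooth_on_partial_deriv test_fun_smooth[OF snoc.prems(2)] snoc.prems)+
    have "partial_deriv i (\<lambda>\<omega>. H \<omega> * k (a + s *\<^sub>R \<omega>)) \<omega> = ?u \<omega> + of_real s * ?v \<omega>" for \<omega>
    proof -
      have "(\<lambda>\<omega>. k (a + s *\<^sub>R \<omega>)) differentiable (at \<omega>)"
        by (rule smooth_on_differentiable[OF smooth_on_affine_compose[OF test_fun_smooth[OF snoc.prems(2)]] UNIV_I])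
      from partial_deriv_mult[OF dH this, of i] show ?thesis
        by (simp add: partial_deriv_affine_compose[OF dk] algebra_simps)
    qed
    then have "partial_deriv i (\<lambda>\<omega>. H \<omega> * k (a + s *\<^sub>R \<omega>)) = (\<lambda>\<omega>. ?u \<omega> + of_real s * ?v \<omega>)"
      by (rule ext)
    then have "iter_partial (is @ [i]) (\<lambda>\<omega>. H \<omega> * k (a + s *\<^sub>R \<omega>)) \<omega>
        = iter_partial is (\<lambda>\<omega>. ?u \<omega> + of_real s * ?v \<omega>) \<omega>"
      by (simp add: iter_partial_snoc)
    also have "\<dots> = iter_partial is ?u \<omega> + of_real s * iter_partial is ?v \<omega>"
      using sm by (simp add: iter_partial_add iter_partial_cmult smooth_on_mult smooth_on_const)
    also have "norm \<dots> \<le> B1 + \<bar>B2\<bar>"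
    proof -
      have "s * norm (iter_partial is ?v \<omega>) \<le> 1 * norm (iter_partial is ?v \<omega>)"
        using s by (intro mult_right_mono) auto
      also have "\<dots> \<le> \<bar>B2\<bar>"
        using B2 s by (auto intro: order_trans[OF _ abs_ge_self])
      finally have "norm (of_real s * iter_partial is ?v \<omega>) \<le> \<bar>B2\<bar>"
        using s by (simp add: norm_mult)
      moreover have "norm (iter_partial is ?u \<omega>) \<le> B1"
        using B1 s by blast
      ultimately show ?thesis
        by (intro norm_triangle_mono)
    qed
    finally show "norm (iter_partial (is @ [i]) (\<lambda>\<omega>. H \<omega> * k (a + s *\<^sub>R \<omega>)) \<omega>) \<le> B1 + \<bar>B2\<bar>" .
  qed
qed

text \<open>
  The decay of Fourier integrals of test functions, uniformly over a one-parameter family. Both the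
  high-frequency translates (\<open>s = 1 / t\<close>, \<open>a\<close> a unit vector) and the low-frequency shells
  (\<open>s = 2\<^sup>-\<^sup>J\<close>, \<open>a = 0\<close>) become members of such a family after rescaling.
\<close>

lemma osc_int_scaled_product_decay:
  fixes H k :: "real ^ 'd \<Rightarrow> complex"
  assumes H: "H \<in> test_fun" and k: "k \<in> test_fun"
  obtains C where "C \<ge> 0"
    "\<And>s x. s \<in> {0..1} \<Longrightarrow> norm (osc_int (\<lambda>\<omega>. H \<omega> * k (a + s *\<^sub>R \<omega>)) x) * (1 + norm x) ^ K \<le> C"
proof -
  obtain R where R: "\<And>\<omega>. norm \<omega> > R \<Longrightarrow> H \<omega> = 0"
    using H by (auto simp: test_fun_def)
  let ?h = "\<lambda>s \<omega>. H \<omega> * k (a + s *\<^sub>R \<omega>)"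
  have test: "?h s \<in> test_fun" for s
    by (intro test_fun_mult H smooth_on_affine_compose test_fun_smooth k)
  define V where "V = measure lborel (cball (0 :: real ^ 'd) R)"
  have bound: "\<exists>M. \<forall>s\<in>{0..1}. \<forall>x. norm (osc_int (iter_partial is (?h s)) x) \<le> M"
    if "\<And>s. iter_partial is (?h s) \<in> test_fun" for "is"
  proof -
    obtain B where B: "\<forall>s\<in>{0..1}. \<forall>\<omega>. norm (iter_partial is (?h s) \<omega>) \<le> B"
      using iter_partial_scaled_product_bounded[OF H k] by blast
    have "norm (osc_int (iter_partial is (?h s)) x) \<le> B * V" if s: "s \<in> {0..1}" for s x
    proof -
      have int: "integrable lborel (iter_partial is (?h s))"
        using Cc_space_integrable test_fun_imp_Cc \<open>iter_partial is (?h s) \<in> test_fun\<close> by blast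
      have "norm (osc_int (iter_partial is (?h s)) x) \<le> (LINT \<omega>|lborel. norm (iter_partial is (?h s) \<omega>))"
        by (rule norm_osc_int_le[OF int])
      also have "\<dots> \<le> (LINT \<omega>|lborel. B * indicator (cball (0 :: real ^ 'd) R) \<omega>)"
      proof (rule Bochner_Integration.integral_mono)
        show "integrable lborel (\<lambda>\<omega>::real^'d. B * indicator (cball 0 R) \<omega>)"
          using emeasure_bounded_finite[of "cball (0::real^'d) R"] by auto
        fix \<omega> :: "real ^ 'd"
        show "norm (iter_partial is (?h s) \<omega>) \<le> B * indicator (cball 0 R) \<omega>"
        proof (cases "norm \<omega> \<le> R")
          case False
          have "iter_partial is (?h s) \<omega> = iter_partial is (\<lambda>x. 0) \<omega>"
            by (rule iter_partial_cong_open[of "{\<omega>. R < norm \<omega>}"])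
              (use False R in \<open>auto intro: open_Collect_less continuous_intros\<close>)
          also have "\<dots> = 0"
          proof -
            have "partial_deriv i (\<lambda>x :: real ^ 'd. 0) = (\<lambda>x. 0)" for i
              by (intro ext partial_deriv_eqI) (auto intro: derivative_eq_intros)
            then show ?thesis
              by (induction "is" rule: rev_induct) (auto simp: iter_partial_snoc)
          qed
          finally show ?thesis using False by simp
        qed (use B s in auto)
      qed (use int in auto)
      also have "\<dots> = B * V" by (simp add: V_def)
      finally show ?thesis .
    qed
    then show ?thesis by blast
  qed
  obtain M0 where M0: "\<forall>s\<in>{0..1}. \<forall>x. norm (osc_int (?h s) x) \<le> M0"
    using bound[of "[]"] test by auto
  have "\<exists>M. \<forall>s\<in>{0..1}. \<forall>x. norm (osc_int (iter_partial (replicate K j) (?h s)) x) \<le> M" for j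
    by (rule bound) (rule osc_int_iter_partial[OF test, THEN conjunct1])
  then have "\<forall>j. \<exists>M. \<forall>s\<in>{0..1}. \<forall>x. norm (osc_int (iter_partial (replicate K j) (?h s)) x) \<le> M"
    by (rule allI)
  from choice[OF this] obtain M
    where M: "\<And>j s x. s \<in> {0..1} \<Longrightarrow> norm (osc_int (iter_partial (replicate K j) (?h s)) x) \<le> M j"
    by blast
  define M' where "M' = max M0 0 + (\<Sum>j\<in>UNIV. max (M j) 0)"
  have M'0: "M' \<ge> 0" unfolding M'_def by (intro add_nonneg_nonneg sum_nonneg) auto
  show thesis
  proof (rule that)
    show "0 \<le> (2 * real CARD('d)) ^ K * M'" using M'0 by simp
    fix s x assume s: "s \<in> {0..1::real}"
    show "norm (osc_int (?h s) x) * (1 + norm x) ^ K \<le> (2 * real CARD('d)) ^ K * M'"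
    proof (rule one_plus_norm_power_le)
      have "0 \<le> (\<Sum>j\<in>UNIV. max (M j) 0)" by (intro sum_nonneg) auto
      then have "M0 \<le> M'" unfolding M'_def by linarith
      with M0 s show "norm (osc_int (?h s) x) \<le> M'"
        by (meson order_trans)
      fix j
      have "\<bar>x $ j\<bar> ^ K * norm (osc_int (?h s) x) = norm (osc_int (iter_partial (replicate K j) (?h s)) x)"
        using osc_int_iter_partial[OF test, of K j s x] by (simp add: norm_mult norm_power)
      also have "\<dots> \<le> M j" by (rule M[OF s])
      also have "\<dots> \<le> (\<Sum>j\<in>UNIV. max (M j) 0)"
        using member_le_sum[of j UNIV "\<lambda>j. max (M j) 0"] by auto
      also have "\<dots> \<le> M'" by (simp add: M'_def)
      finally show "\<bar>x $ j\<bar> ^ K * norm (osc_int (?h s) x) \<le> M'" .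
    qed auto
  qed
qed

text \<open>
  The special case \<open>s = 0\<close>, where the second factor is the constant \<open>cutoff 0 = 1\<close>.
\<close>

lemma osc_int_decay:
  fixes h :: "real ^ 'd \<Rightarrow> complex"
  assumes "h \<in> test_fun"
  obtains C where "C \<ge> 0" "\<And>x. norm (osc_int h x) * (1 + norm x) ^ K \<le> C"
proof -
  obtain C where "C \<ge> 0"
    "\<And>s x. s \<in> {0..1} \<Longrightarrow> norm (osc_int (\<lambda>\<omega>. h \<omega> * cutoff (0 + s *\<^sub>R \<omega>)) x) * (1 + norm x) ^ K \<le> C"
    using osc_int_scaled_product_decay[OF assms cutoff_test_fun] by blast
  from this(1) this(2)[of 0] show thesis
    by (intro that[of C]) (simp_all add: cutoff_eq_1)
qed

lemma schwartz_space_osc_int: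
  fixes h :: "real ^ 'd \<Rightarrow> complex"
  assumes "h \<in> test_fun"
  shows "osc_int h \<in> schwartz_space"
proof -
  have "bounded (range (\<lambda>x. norm x ^ k *\<^sub>R iter_partial is (osc_int h) x))" for "is" k
  proof -
    obtain h' where h': "h' \<in> test_fun" "iter_partial is (osc_int h) = osc_int h'"
      using iter_partial_osc_int[OF assms] by blast
    obtain C where C: "\<And>x. norm (osc_int h' x) * (1 + norm x) ^ k \<le> C"
      using osc_int_decay[OF h'(1)] by metis
    have "norm (norm x ^ k *\<^sub>R osc_int h' x) \<le> C" for x
    proof -
      have "norm (norm x ^ k *\<^sub>R osc_int h' x) \<le> norm (osc_int h' x) * (1 + norm x) ^ k"
        using mult_left_mono[OF power_mono[of "norm x" "1 + norm x" k], of "norm (osc_int h' x)"]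
        by (simp add: mult.commute)
      then show ?thesis using C[of x] by linarith
    qed
    then show ?thesis
      unfolding h'(2) bounded_iff by blast
  qed
  then show ?thesis
    using smooth_on_osc_int[OF test_fun_imp_Cc[OF assms]] by (simp add: schwartz_space_def)
qed

text \<open>
  The exponent \<open>2 d\<close> is convenient rather than optimal: the function is dominated by the product of
  the one-dimensional functions \<open>1 / (1 + x\<^sub>b\<^sup>2)\<close>.
\<close>

lemma integrable_inverse_one_plus_norm_power:
  "integrable lborel (\<lambda>x :: real ^ 'd. 1 / (1 + norm x) ^ (2 * CARD('d)))"
proof (rule integrableI_bounded)
  have le: "1 / (1 + norm x) ^ (2 * CARD('d)) \<le> (\<Prod>b\<in>Basis. inverse (1 + (x \<bullet> b)\<^sup>2))" for x :: "real ^ 'd"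
  proof -
    have "(\<Prod>b\<in>Basis. 1 + (x \<bullet> b)\<^sup>2) \<le> (\<Prod>b\<in>(Basis :: (real ^ 'd) set). (1 + norm x) ^ 2)"
    proof (rule prod_mono, safe)
      fix b :: "real ^ 'd" assume b: "b \<in> Basis"
      have "(x \<bullet> b)\<^sup>2 \<le> (norm x)\<^sup>2"
        using power_mono[OF Basis_le_norm[OF b, of x], of 2] by simp
      also have "1 + (norm x)\<^sup>2 \<le> (1 + norm x) ^ 2"
        by (simp add: power2_eq_square algebra_simps)
      finally show "1 + (x \<bullet> b)\<^sup>2 \<le> (1 + norm x) ^ 2" by simp
    qed (simp add: add_nonneg_nonneg)
    also have "\<dots> = (1 + norm x) ^ (2 * CARD('d))"
      by (simp add: power_mult)
    finally have "inverse ((1 + norm x) ^ (2 * CARD('d))) \<le> inverse (\<Prod>b\<in>Basis. 1 + (x \<bullet> b)\<^sup>2)"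
      by (intro le_imp_inverse_le) (auto intro!: prod_pos add_pos_nonneg)
    then show ?thesis
      by (simp add: divide_inverse prod_inversef[symmetric] o_def)
  qed
  have fin: "(\<integral>\<^sup>+t. ennreal (inverse (1 + t\<^sup>2)) \<partial>(lborel :: real measure)) < \<infinity>"
  proof -
    have "integrable lborel (\<lambda>t::real. inverse (1 + t\<^sup>2))"
      using integrable_inverse_1_plus_square by (simp add: set_integrable_def einterval_eq)
    then show ?thesis
      by (simp add: integrable_iff_bounded)
  qed
  have "(\<integral>\<^sup>+x. ennreal (norm (1 / (1 + norm x) ^ (2 * CARD('d)))) \<partial>(lborel :: (real ^ 'd) measure))
     \<le> (\<integral>\<^sup>+x. (\<Prod>b\<in>Basis. ennreal (inverse (1 + (x \<bullet> b)\<^sup>2))) \<partial>(lborel :: (real ^ 'd) measure))"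
    using le by (intro nn_integral_mono) (simp add: prod_ennreal ennreal_leI)
  also have "\<dots> = (\<Prod>b\<in>(Basis :: (real ^ 'd) set). (\<integral>\<^sup>+t. ennreal (inverse (1 + t\<^sup>2)) \<partial>lborel))"
    by (rule nn_integral_lborel_prod) auto
  also have "\<dots> < \<infinity>"
    using fin by (simp add: power_less_top_ennreal)
  finally show "(\<integral>\<^sup>+x. ennreal (norm (1 / (1 + norm x) ^ (2 * CARD('d)))) \<partial>(lborel :: (real ^ 'd) measure)) < \<infinity>" .
qed auto

lemma integrable_if_decay:
  fixes u :: "real ^ 'd \<Rightarrow> 'b::{banach, second_countable_topology}"
  assumes "u \<in> borel_measurable borel" and u: "\<And>x. norm (u x) * (1 + norm x) ^ (2 * CARD('d)) \<le> C"
  shows "integrable lborel u"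
proof (rule Bochner_Integration.integrable_bound)
  show "integrable lborel (\<lambda>x :: real ^ 'd. C * (1 / (1 + norm x) ^ (2 * CARD('d))))"
    by (intro integrable_mult_right integrable_inverse_one_plus_norm_power)
  have "norm (u x) \<le> C * (1 / (1 + norm x) ^ (2 * CARD('d)))" for x
    using u[of x] by (simp add: field_simps add_pos_nonneg)
  then show "AE x in lborel. norm (u x) \<le> norm (C * (1 / (1 + norm x) ^ (2 * CARD('d))))"
    unfolding real_norm_def by (intro AE_I2) (rule order_trans[OF _ abs_ge_self])
qed (use assms in simp)

lemma powr_decay:
  fixes x :: "real ^ 'd"
  assumes p: "p > 0" "2 * real CARD('d) \<le> real k * p" and a: "a \<ge> 0" "a * (1 + norm x) ^ k \<le> C"
  shows "a powr p * (1 + norm x) ^ (2 * CARD('d)) \<le> C powr p"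
proof -
  have "a powr p * (1 + norm x) ^ (2 * CARD('d)) = a powr p * (1 + norm x) powr (2 * real CARD('d))"
    by (simp add: powr_realpow[symmetric] add_pos_nonneg)
  also have "\<dots> \<le> a powr p * (1 + norm x) powr (real k * p)"
    using p by (intro mult_left_mono powr_mono) auto
  also have "\<dots> = (a * (1 + norm x) ^ k) powr p"
    using a by (simp add: powr_mult powr_powr[symmetric] powr_realpow add_pos_nonneg)
  also have "\<dots> \<le> C powr p"
    using p a by (intro powr_mono2) auto
  finally show ?thesis .
qed

abbreviation nn_mass :: "'a measure \<Rightarrow> real \<Rightarrow> ('a \<Rightarrow> complex) \<Rightarrow> ennreal" where
  "nn_mass M p u \<equiv> \<integral>\<^sup>+x. ennreal (norm (u x) powr p) \<partial>M"

definition decay_const :: "'d::finite itself \<Rightarrow> real" where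
  "decay_const _ = (LINT x|(lborel :: (real ^ 'd) measure). 1 / (1 + norm x) ^ (2 * CARD('d)))"

lemma decay_const_nonneg: "decay_const TYPE('d::finite) \<ge> 0"
  unfolding decay_const_def by (intro Bochner_Integration.integral_nonneg) auto

text \<open>
  This turns weighted uniform bounds into bounds for \<open>p\<close>-th powers, for all exponents \<open>p > 0\<close> at
  once.
\<close>

lemma nn_integral_powr_le_decay_const:
  fixes u :: "real ^ 'd \<Rightarrow> complex"
  assumes p: "p > 0" "2 * real CARD('d) \<le> real k * p" and u: "\<And>x. norm (u x) * (1 + norm x) ^ k \<le> C"
  shows "nn_mass lborel p u \<le> ennreal (C powr p * decay_const TYPE('d))"
proof -
  have "norm (u x) powr p \<le> C powr p * (1 / (1 + norm x) ^ (2 * CARD('d)))" for x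
    using powr_decay[OF p _ u[of x]] by (simp add: field_simps add_pos_nonneg)
  then have "nn_mass lborel p u
      \<le> (\<integral>\<^sup>+x. ennreal (C powr p * (1 / (1 + norm x) ^ (2 * CARD('d)))) \<partial>(lborel :: (real ^ 'd) measure))"
    by (intro nn_integral_mono ennreal_leI)
  also have "\<dots> = ennreal (LINT x|(lborel :: (real ^ 'd) measure). C powr p * (1 / (1 + norm x) ^ (2 * CARD('d))))"
    by (intro nn_integral_eq_integral integrable_mult_right integrable_inverse_one_plus_norm_power) auto
  also have "\<dots> = ennreal (C powr p * decay_const TYPE('d))"
    unfolding decay_const_def by (subst integral_mult_right_zero) simp
  finally show ?thesis .
qed

lemma integrable_osc_int:
  fixes h :: "real ^ 'd \<Rightarrow> complex"
  assumes "h \<in> test_fun"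
  shows "integrable lborel (osc_int h)"
proof -
  obtain C where "\<And>x. norm (osc_int h x) * (1 + norm x) ^ (2 * CARD('d)) \<le> C"
    using osc_int_decay[OF assms] by metis
  then show ?thesis
    by (rule integrable_if_decay[rotated])
      (intro borel_measurable_continuous_onI smooth_on_imp_continuous_on smooth_on_osc_int test_fun_imp_Cc assms)
qed

section \<open>Gaussian integrals and Fourier inversion\<close>

definition gauss :: "real ^ 'd \<Rightarrow> complex" where
  "gauss x = of_real (exp (- (x \<bullet> x) / 2))"

lemma gauss_integral_1d:
  "integrable lborel (\<lambda>t::real. complex_of_real (exp (- t\<^sup>2 / 2)) * cis (s * t))"
  "(LINT t|lborel. complex_of_real (exp (- t\<^sup>2 / 2)) * cis (s * t)) = of_real (sqrt (2 * pi) * exp (- s\<^sup>2 / 2))"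
proof -
  have eq: "complex_of_real (exp (- t\<^sup>2 / 2)) * cis (s * t) = of_real (sqrt (2 * pi)) * (std_normal_density t *\<^sub>R iexp (s * t))" for t
    by (simp add: std_normal_density_def scaleR_conv_of_real cis_conv_exp)
  have "integrable lborel (\<lambda>t. std_normal_density t)" by simp
  then have "integrable lborel (\<lambda>t. std_normal_density t *\<^sub>R iexp (s * t))"
    by (rule Bochner_Integration.integrable_bound) auto
  then show "integrable lborel (\<lambda>t::real. complex_of_real (exp (- t\<^sup>2 / 2)) * cis (s * t))"
    unfolding eq by (rule integrable_mult_right)
  have "(LINT t|lborel. std_normal_density t *\<^sub>R iexp (s * t)) = char std_normal_distribution s"
    unfolding char_def by (subst integral_density) auto
  then have "(LINT t|lborel. std_normal_density t *\<^sub>R iexp (s * t)) = of_real (exp (- s\<^sup>2 / 2))"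
    by (simp add: char_std_normal_distribution)
  then show "(LINT t|lborel. complex_of_real (exp (- t\<^sup>2 / 2)) * cis (s * t)) = of_real (sqrt (2 * pi) * exp (- s\<^sup>2 / 2))"
    unfolding eq by (subst integral_mult_right_zero) simp
qed

lemma gauss_prod:
  fixes x \<omega> :: "real ^ 'd"
  shows "gauss x * cis (\<omega> \<bullet> x) = (\<Prod>b\<in>Basis. complex_of_real (exp (- (x \<bullet> b)\<^sup>2 / 2)) * cis ((\<omega> \<bullet> b) * (x \<bullet> b)))"
proof -
  have "gauss x * cis (\<omega> \<bullet> x) = exp (of_real (- (x \<bullet> x) / 2) + \<i> * of_real (\<omega> \<bullet> x))"
    unfolding gauss_def cis_conv_exp exp_add exp_of_real ..
  also have "of_real (- (x \<bullet> x) / 2) + \<i> * of_real (\<omega> \<bullet> x) =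
      (\<Sum>b\<in>Basis. complex_of_real (- (x \<bullet> b)\<^sup>2 / 2) + \<i> * of_real ((\<omega> \<bullet> b) * (x \<bullet> b)))"
    unfolding euclidean_inner[of x x] euclidean_inner[of \<omega> x]
    by (simp add: sum.distrib sum_subtractf sum_distrib_left sum_negf sum_divide_distrib power2_eq_square)
  also have "exp \<dots> = (\<Prod>b\<in>Basis. exp (complex_of_real (- (x \<bullet> b)\<^sup>2 / 2) + \<i> * of_real ((\<omega> \<bullet> b) * (x \<bullet> b))))"
    by (rule exp_sum) simp
  also have "\<dots> = (\<Prod>b\<in>Basis. complex_of_real (exp (- (x \<bullet> b)\<^sup>2 / 2)) * cis ((\<omega> \<bullet> b) * (x \<bullet> b)))"
    unfolding cis_conv_exp exp_add exp_of_real ..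
  finally show ?thesis .
qed

lemma integral_lborel_prod:
  fixes f :: "'a::euclidean_space \<Rightarrow> real \<Rightarrow> complex"
  assumes "\<And>b. b \<in> Basis \<Longrightarrow> integrable lborel (f b)"
  shows "integrable lborel (\<lambda>x. \<Prod>b\<in>Basis. f b (x \<bullet> b))"
    and "(LINT x|lborel. (\<Prod>b\<in>Basis. f b (x \<bullet> b))) = (\<Prod>b\<in>Basis. LINT t|lborel. f b t)"
proof -
  interpret product_sigma_finite "\<lambda>_::'a. lborel :: real measure" ..
  have [measurable]: "f b \<in> borel_measurable borel" if "b \<in> Basis" for b
    using assms[OF that] by auto
  have eq: "(\<Prod>b\<in>Basis. f b ((\<Sum>c\<in>Basis. g c *\<^sub>R c) \<bullet> b)) = (\<Prod>b\<in>Basis. f b (g b))" for g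
    by (intro prod.cong) auto
  show "(LINT x|lborel. (\<Prod>b\<in>Basis. f b (x \<bullet> b))) = (\<Prod>b\<in>Basis. LINT t|lborel. f b t)"
    by (subst lborel_eq, subst integral_distr) (simp_all add: eq product_integral_prod assms)
  have "integrable (\<Pi>\<^sub>M b\<in>Basis. lborel) (\<lambda>g. \<Prod>b\<in>Basis. f b (g b))"
    by (intro product_integrable_prod assms) auto
  then show "integrable lborel (\<lambda>x. \<Prod>b\<in>Basis. f b (x \<bullet> b))"
    by (subst lborel_eq, subst integrable_distr_eq) (simp_all add: eq)
qed

lemma integrable_gauss: "integrable lborel (gauss :: real ^ 'd \<Rightarrow> complex)"
proof -
  have "integrable lborel (\<lambda>x :: real ^ 'd. \<Prod>b\<in>Basis. complex_of_real (exp (- (x \<bullet> b)\<^sup>2 / 2)) * cis ((0 \<bullet> b) * (x \<bullet> b)))"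
    by (intro integral_lborel_prod gauss_integral_1d)
  then show ?thesis
    unfolding gauss_prod[symmetric] by simp
qed

lemma osc_int_gauss:
  fixes \<omega> :: "real ^ 'd"
  shows "osc_int gauss \<omega> = of_real ((2 * pi) powr (real CARD('d) / 2)) * gauss \<omega>"
proof -
  have "osc_int gauss \<omega> = (\<Prod>b\<in>Basis. LINT t|lborel. complex_of_real (exp (- t\<^sup>2 / 2)) * cis ((\<omega> \<bullet> b) * t))"
    unfolding osc_int_def gauss_prod by (intro integral_lborel_prod gauss_integral_1d)
  also have "\<dots> = (\<Prod>b\<in>Basis. complex_of_real (sqrt (2 * pi)) * of_real (exp (- (\<omega> \<bullet> b)\<^sup>2 / 2)))"
    unfolding gauss_integral_1d by simp
  also have "\<dots> = of_real (sqrt (2 * pi) ^ CARD('d)) * (gauss \<omega> * cis (0 \<bullet> \<omega>))"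
    unfolding gauss_prod prod.distrib by simp
  also have "sqrt (2 * pi) ^ CARD('d) = (2 * pi) powr (real CARD('d) / 2)"
    by (simp add: powr_half_sqrt[symmetric] powr_realpow[symmetric] powr_powr)
  finally show ?thesis by simp
qed

text \<open>
  The Fourier integral can be moved from one factor to the other, by Fubini.
\<close>

lemma osc_int_multiplication_formula:
  fixes f g :: "real ^ 'd \<Rightarrow> complex"
  assumes f: "integrable lborel f" and g: "integrable lborel g"
  shows "(LINT x|lborel. osc_int f x * g x) = (LINT y|lborel. f y * osc_int g y)"
proof -
  have [measurable]: "f \<in> borel_measurable borel" "g \<in> borel_measurable borel"
    using f g by auto
  let ?F = "\<lambda>(x, y). f y * cis (x \<bullet> y) * g x"
  have int: "integrable (lborel \<Otimes>\<^sub>M lborel) ?F"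
  proof (rule lborel_pair.Fubini_integrable)
    show "integrable lborel (\<lambda>x. LINT y|lborel. norm (?F (x, y)))"
      using f g by (simp add: norm_mult)
    show "AE x in lborel. integrable lborel (\<lambda>y. ?F (x, y))"
      using f by (auto intro!: AE_I2 integrable_mult_left integrable_mult_cis)
  qed measurable
  have "(LINT x|lborel. osc_int f x * g x) = (LINT x|lborel. LINT y|lborel. f y * cis (x \<bullet> y) * g x)"
    by (simp add: osc_int_def)
  also have "\<dots> = (LINT y|lborel. LINT x|lborel. f y * cis (x \<bullet> y) * g x)"
    using lborel_pair.Fubini_integral[of "\<lambda>x y. f y * cis (x \<bullet> y) * g x"] int by simp
  also have "\<dots> = (LINT y|lborel. f y * osc_int g y)"
    by (simp add: osc_int_def inner_commute mult_ac flip: integral_mult_right_zero)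
  finally show ?thesis .
qed

lemma osc_int_modulate: "osc_int (\<lambda>\<xi>. h \<xi> * cis (a \<bullet> \<xi>)) x = osc_int h (x + a)"
  by (simp add: osc_int_def inner_add_left cis_mult[symmetric] mult_ac)

text \<open>
  Fourier inversion, by Gaussian regularisation: inserting \<open>gauss (x / n)\<close> into the outer integral and
  moving the transform onto the Gaussian turns the double integral into an average of \<open>h\<close> over a
  neighbourhood of \<open>\<xi>\<close> of size \<open>1 / n\<close>.
\<close>

lemma osc_int_inversion:
  fixes h :: "real ^ 'd \<Rightarrow> complex"
  assumes h: "h \<in> test_fun"
  shows "osc_int (osc_int h) (- \<xi>) = of_real ((2 * pi) powr real CARD('d)) * h \<xi>"
proof -
  let ?g = "\<lambda>n x. gauss (inverse (real (Suc n)) *\<^sub>R x) :: complex"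
  have int_h: "integrable lborel h" and int_osc: "integrable lborel (osc_int h)"
    using Cc_space_integrable test_fun_imp_Cc integrable_osc_int h by blast+
  have [measurable]: "h \<in> borel_measurable borel" "osc_int h \<in> borel_measurable borel"
      "(gauss :: real ^ 'd \<Rightarrow> complex) \<in> borel_measurable borel"
    using borel_measurable_integrable[OF int_h] borel_measurable_integrable[OF int_osc]
      borel_measurable_integrable[OF integrable_gauss] by simp_all
  have inv_Suc: "(\<lambda>n. inverse (real (Suc n))) \<longlonglongrightarrow> 0"
    by (rule LIMSEQ_inverse_real_of_nat)
  have cont_gauss: "isCont (gauss :: real ^ 'd \<Rightarrow> complex) x" for x
    unfolding gauss_def by (intro continuous_intros) auto
  have gauss_le: "norm (gauss x) \<le> 1" for x :: "real ^ 'd"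
    by (simp add: gauss_def)
  have int_g: "integrable lborel (?g n)" for n
    using integrable_lborel_affine[OF integrable_gauss, of "inverse (real (Suc n))" 0] by simp
  have lim1: "(\<lambda>n. LINT x|lborel. osc_int h x * (?g n x * cis ((- \<xi>) \<bullet> x)))
      \<longlonglongrightarrow> (LINT x|lborel. osc_int h x * cis ((- \<xi>) \<bullet> x))"
  proof (rule integral_dominated_convergence[where w = "\<lambda>x. norm (osc_int h x)"])
    show "AE x in lborel. (\<lambda>n. osc_int h x * (?g n x * cis ((- \<xi>) \<bullet> x))) \<longlonglongrightarrow> osc_int h x * cis ((- \<xi>) \<bullet> x)"
    proof (rule AE_I2)
      fix x :: "real ^ 'd"
      have "(\<lambda>n. inverse (real (Suc n)) *\<^sub>R x) \<longlonglongrightarrow> 0 *\<^sub>R x"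
        by (intro tendsto_scaleR inv_Suc tendsto_const)
      from isCont_tendsto_compose[OF cont_gauss this] have "(\<lambda>n. ?g n x) \<longlonglongrightarrow> 1"
        by (simp add: gauss_def)
      then have "(\<lambda>n. osc_int h x * (?g n x * cis ((- \<xi>) \<bullet> x))) \<longlonglongrightarrow> osc_int h x * (1 * cis ((- \<xi>) \<bullet> x))"
        by (intro tendsto_mult tendsto_const)
      then show "(\<lambda>n. osc_int h x * (?g n x * cis ((- \<xi>) \<bullet> x))) \<longlonglongrightarrow> osc_int h x * cis ((- \<xi>) \<bullet> x)"
        by simp
    qed
    show "AE x in lborel. norm (osc_int h x * (?g n x * cis ((- \<xi>) \<bullet> x))) \<le> norm (osc_int h x)" for n
      by (intro AE_I2) (simp add: norm_mult mult_left_le gauss_le)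
  qed (use int_osc in auto)
  let ?c = "of_real ((2 * pi) powr (real CARD('d) / 2)) :: complex"
  \<comment> \<open>Move the transform onto the modulated Gaussian, then rescale by \<open>1 / (n + 1)\<close> around \<open>\<xi>\<close>.\<close>
  have eq: "(LINT x|lborel. osc_int h x * (?g n x * cis ((- \<xi>) \<bullet> x)))
      = ?c * (LINT y|lborel. h (\<xi> + inverse (real (Suc n)) *\<^sub>R y) * gauss y)" for n
  proof -
    let ?s = "inverse (real (Suc n))"
    have "(LINT x|lborel. osc_int h x * (?g n x * cis ((- \<xi>) \<bullet> x)))
        = (LINT y|lborel. h y * osc_int (\<lambda>x. ?g n x * cis ((- \<xi>) \<bullet> x)) y)"
      by (intro osc_int_multiplication_formula int_h integrable_mult_cis int_g)
    also have "\<dots> = (LINT y|lborel. h y * (of_real (inverse ?s ^ CARD('d)) * (?c * gauss ((y - \<xi>) /\<^sub>R ?s))))"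
      by (simp only: osc_int_modulate) (subst osc_int_dilate; simp add: osc_int_gauss)
    also have "\<dots> = ?s ^ CARD('d) *\<^sub>R (LINT y|lborel. h (\<xi> + ?s *\<^sub>R y) *
        (of_real (inverse ?s ^ CARD('d)) * (?c * gauss ((\<xi> + ?s *\<^sub>R y - \<xi>) /\<^sub>R ?s))))"
      by (subst integral_lborel_affine[where c = ?s and t = \<xi>]) auto
    also have "\<dots> = ?s ^ CARD('d) *\<^sub>R (LINT y|lborel. (of_real (inverse ?s ^ CARD('d)) * ?c) * (h (\<xi> + ?s *\<^sub>R y) * gauss y))"
      by (simp add: mult_ac)
    also have "\<dots> = ?c * (LINT y|lborel. h (\<xi> + ?s *\<^sub>R y) * gauss y)"
      unfolding integral_mult_right_zero by (simp add: scaleR_conv_of_real power_inverse del: of_nat_Suc)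
    finally show ?thesis .
  qed
  obtain B where B: "B \<ge> 0" "\<And>x. norm (h x) \<le> B"
    using Cc_space_bounded[OF test_fun_imp_Cc[OF h]] by metis
  have lim2: "(\<lambda>n. LINT y|lborel. h (\<xi> + inverse (real (Suc n)) *\<^sub>R y) * gauss y) \<longlonglongrightarrow> (LINT y|(lborel :: (real ^ 'd) measure). h \<xi> * gauss y)"
  proof (rule integral_dominated_convergence[where w = "\<lambda>x. B * norm (gauss (x :: real ^ 'd) :: complex)"])
    show "AE y in lborel. (\<lambda>n. h (\<xi> + inverse (real (Suc n)) *\<^sub>R y) * gauss y) \<longlonglongrightarrow> h \<xi> * gauss y"
    proof (rule AE_I2)
      fix y :: "real ^ 'd"
      have "(\<lambda>n. \<xi> + inverse (real (Suc n)) *\<^sub>R y) \<longlonglongrightarrow> \<xi> + 0 *\<^sub>R y"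
        by (intro tendsto_add tendsto_scaleR inv_Suc tendsto_const)
      then have "(\<lambda>n. h (\<xi> + inverse (real (Suc n)) *\<^sub>R y)) \<longlonglongrightarrow> h \<xi>"
        using isCont_tendsto_compose[of \<xi> h] smooth_on_imp_continuous_on[OF test_fun_smooth[OF h]]
        by (simp add: continuous_on_eq_continuous_at)
      then show "(\<lambda>n. h (\<xi> + inverse (real (Suc n)) *\<^sub>R y) * gauss y) \<longlonglongrightarrow> h \<xi> * gauss y"
        by (intro tendsto_mult tendsto_const)
    qed
    show "AE y in lborel. norm (h (\<xi> + inverse (real (Suc n)) *\<^sub>R y) * gauss y) \<le> B * norm (gauss y :: complex)" for n
      using B by (intro AE_I2) (simp add: norm_mult mult_right_mono)
    show "integrable lborel (\<lambda>x :: real ^ 'd. B * norm (gauss x :: complex))"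
      using integrable_gauss by (intro integrable_mult_right integrable_norm)
  qed auto
  have "(LINT y|(lborel :: (real ^ 'd) measure). h \<xi> * gauss y) = h \<xi> * osc_int (gauss :: real ^ 'd \<Rightarrow> complex) 0"
    by (simp add: osc_int_def)
  also have "\<dots> = h \<xi> * ?c"
    by (simp add: osc_int_gauss gauss_def)
  finally have "osc_int (osc_int h) (- \<xi>) = ?c * (h \<xi> * ?c)"
    using LIMSEQ_unique[OF lim1[unfolded eq] tendsto_mult[OF tendsto_const lim2, of ?c]]
    by (simp add: osc_int_def)
  also have "\<dots> = of_real ((2 * pi) powr real CARD('d)) * h \<xi>"
    by (simp add: powr_add[symmetric] mult_ac flip: of_real_mult)
  finally show ?thesis .
qed

lemma fourier_inv_fourier:
  fixes h :: "real ^ 'd \<Rightarrow> complex"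
  assumes h: "h \<in> test_fun"
  shows "fourier (inv_fourier h) = h"
proof
  fix \<xi>
  have [measurable]: "h \<in> borel_measurable borel" "osc_int h \<in> borel_measurable borel"
    using Cc_space_borel[OF test_fun_imp_Cc[OF h]] integrable_osc_int[OF h] by auto
  have "inv_fourier h = (\<lambda>x. of_real (fourier_const TYPE('d)) * osc_int h x)"
    by (intro ext inv_fourier_eq_osc_int) measurable
  then have "fourier (inv_fourier h) \<xi>
      = of_real (fourier_const TYPE('d)) * (of_real (fourier_const TYPE('d)) * osc_int (osc_int h) (- \<xi>))"
    by (simp add: fourier_eq_osc_int osc_int_cmult)
  also have "\<dots> = of_real (fourier_const TYPE('d) * fourier_const TYPE('d) * (2 * pi) powr real CARD('d)) * h \<xi>"
    by (simp add: osc_int_inversion[OF h])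
  also have "fourier_const TYPE('d) * fourier_const TYPE('d) * (2 * pi) powr real CARD('d) = 1"
    by (simp add: fourier_const_def flip: powr_add)
  finally show "fourier (inv_fourier h) \<xi> = h \<xi>" by simp
qed

section \<open>Modulation decreases the p-mass\<close>

text \<open>
  Strict concavity of the power \<open>p < 1\<close> in quantitative form. The quadratic term is what makes the mean
  of \<open>(1 + cos)\<^sup>p\<close> smaller than one.
\<close>

lemma powr_one_plus_le:
  fixes p s :: real
  assumes p: "0 < p" "p < 1" and s: "- 1 \<le> s" "s \<le> 1"
  shows "(1 + s) powr p \<le> 1 + p * s - p * (1 - p) / 18 * s\<^sup>2"
proof (cases "s = - 1")
  case True
  have "0 \<le> (1 - p) * (1 - p / 18)" using p by (intro mult_nonneg_nonneg) auto
  then show ?thesis using True by (simp add: algebra_simps)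
next
  case False
  define c where "c = p * (1 - p) / 18"
  let ?k = "\<lambda>s. 1 + p * s - c * s\<^sup>2 - (1 + s) powr p"
  let ?k' = "\<lambda>s. p - 2 * c * s - p * (1 + s) powr (p - 1)"
  \<comment> \<open>The interval \<open>(- 1, 2)\<close> used below keeps \<open>1 + x < 3\<close>, hence \<open>(1 + x)\<^sup>p\<^sup>-\<^sup>2 \<ge> 1 / 9\<close>; so \<open>c\<close> makes \<open>k\<close> convex.\<close>
  let ?k'' = "\<lambda>s. p * (1 - p) * (1 + s) powr (p - 2) - 2 * c"
  have k': "(?k has_real_derivative ?k' s) (at s)" if "s > - 1" for s
    using that by (auto intro!: derivative_eq_intros simp: power2_eq_square)
  have k'': "(?k' has_real_derivative ?k'' s) (at s)" if "s > - 1" for s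
    using that by (auto intro!: derivative_eq_intros simp: algebra_simps)
  have "?k' 0 * (s - 0) \<le> ?k s - ?k 0"
  proof (rule f''_imp_f'[where C = "{-1<..<2}" and f = ?k and f' = ?k' and f'' = ?k''])
    show "(?k has_real_derivative ?k' x) (at x)" if "x \<in> {-1<..<2}" for x
      using k' that by auto
    show "(?k' has_real_derivative ?k'' x) (at x)" if "x \<in> {-1<..<2}" for x
      using k'' that by auto
    fix x :: real assume x: "x \<in> {-1<..<2}"
    have "1 / 9 = 3 powr (- 2 :: real)"
      by (simp add: powr_minus powr_numeral)
    also have "\<dots> \<le> 3 powr (p - 2)"
      using p by (intro powr_mono) auto
    also have "\<dots> \<le> (1 + x) powr (p - 2)"
      using x p by (intro powr_mono2') auto
    finally have "p * (1 - p) * (1 / 9) \<le> p * (1 - p) * (1 + x) powr (p - 2)"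
      using p by (intro mult_left_mono) auto
    then show "?k'' x \<ge> 0" by (simp add: c_def)
  qed (use s False in auto)
  then show ?thesis by (simp add: c_def)
qed

lemma one_plus_norm_shift: "1 + norm x \<le> (1 + norm (x + t)) * (1 + norm t)"
proof -
  have "norm x \<le> norm (x + t) + norm t"
    using norm_triangle_ineq4[of "x + t" t] by simp
  moreover have "0 \<le> norm (x + t) * norm t" by simp
  moreover have "(1 + norm (x + t)) * (1 + norm t) = 1 + norm (x + t) + norm t + norm (x + t) * norm t"
    by (simp add: algebra_simps)
  ultimately show ?thesis by linarith
qed

text \<open>
  The Riemann-Lebesgue lemma in one direction: translating by half a period \<open>\<pi> / n\<close> changes the sign of
  the cosine, so twice the integral is at most the \<open>L\<^sub>1\<close> distance of \<open>F\<close> from its translate.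
\<close>

lemma riemann_lebesgue_axis:
  fixes F :: "real ^ 'd \<Rightarrow> real"
  assumes cont: "continuous_on UNIV F"
    and decay: "\<And>x. \<bar>F x\<bar> * (1 + norm x) ^ (2 * CARD('d)) \<le> C"
  shows "(\<lambda>n. LINT x|lborel. F x * cos (real (Suc n) * x $ j)) \<longlonglongrightarrow> 0"
proof -
  let ?t = "\<lambda>n. (pi / real (Suc n)) *\<^sub>R axis j (1::real) :: real ^ 'd"
  let ?m = "2 * CARD('d)"
  have [measurable]: "F \<in> borel_measurable borel"
    using cont by (rule borel_measurable_continuous_onI)
  have [measurable]: "(\<lambda>x::real^'d. x $ j) \<in> borel_measurable borel"
    by (intro borel_measurable_continuous_onI continuous_intros)
  have C: "C \<ge> 0" using decay[of 0] abs_ge_zero[of "F 0"] by simp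
  have t_le: "norm (?t n) \<le> pi" for n
    by (simp add: field_simps)
  let ?w = "\<lambda>x::real^'d. C * (1 / (1 + norm x) ^ ?m)"
  have int_w: "integrable lborel ?w"
    by (intro integrable_mult_right integrable_inverse_one_plus_norm_power)
  have F_le: "\<bar>F x\<bar> \<le> ?w x" for x
    using decay[of x] by (simp add: field_simps add_pos_nonneg)
  have F_shift_le: "\<bar>F (x + ?t n)\<bar> \<le> (1 + pi) ^ ?m * ?w x" for n x
  proof -
    have "\<bar>F (x + ?t n)\<bar> * (1 + norm x) ^ ?m \<le> \<bar>F (x + ?t n)\<bar> * ((1 + norm (x + ?t n)) * (1 + pi)) ^ ?m"
      using one_plus_norm_shift[of x "?t n"] t_le[of n]
      by (intro mult_left_mono power_mono) (auto elim!: order_trans intro!: mult_left_mono)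
    also have "\<dots> = (1 + pi) ^ ?m * (\<bar>F (x + ?t n)\<bar> * (1 + norm (x + ?t n)) ^ ?m)"
      by (simp only: power_mult_distrib mult_ac)
    also have "\<dots> \<le> (1 + pi) ^ ?m * C"
      by (intro mult_left_mono decay) auto
    finally show ?thesis by (simp add: field_simps add_pos_nonneg)
  qed
  have int_F: "integrable lborel F"
    using decay by (intro integrable_if_decay[where C = C]) auto
  have int_Ft: "integrable lborel (\<lambda>x. F (x + ?t n))" for n
    using integrable_lborel_affine[OF int_F, of 1 "?t n"] by (simp add: add.commute)
  have int_cos: "integrable lborel (\<lambda>x. G x * cos (real (Suc n) * x $ j))"
    if "integrable lborel G" for n and G :: "real ^ 'd \<Rightarrow> real"
  proof -
    have [measurable]: "G \<in> borel_measurable borel" using that by auto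
    show ?thesis
      by (rule Bochner_Integration.integrable_bound[OF that]) (auto simp: abs_mult mult_left_le)
  qed
  have "(\<lambda>n. LINT x|lborel. \<bar>F x - F (x + ?t n)\<bar>) \<longlonglongrightarrow> (LINT x|(lborel :: (real ^ 'd) measure). 0)"
  proof (rule integral_dominated_convergence[where w = "\<lambda>x. ?w x + (1 + pi) ^ ?m * ?w x"])
    show "integrable lborel (\<lambda>x::real^'d. ?w x + (1 + pi) ^ ?m * ?w x)"
      by (intro Bochner_Integration.integrable_add integrable_mult_right[OF int_w] int_w)
    show "AE x in lborel. norm \<bar>F x - F (x + ?t n)\<bar> \<le> ?w x + (1 + pi) ^ ?m * ?w x" for n
    proof (rule AE_I2)
      fix x
      show "norm \<bar>F x - F (x + ?t n)\<bar> \<le> ?w x + (1 + pi) ^ ?m * ?w x"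
        using add_mono[OF F_le[of x] F_shift_le[of x n]]
        by (simp only: real_norm_def abs_abs)
    qed
    show "AE x in lborel. (\<lambda>n. \<bar>F x - F (x + ?t n)\<bar>) \<longlonglongrightarrow> 0"
    proof (rule AE_I2)
      fix x
      have "(\<lambda>n. pi / real (Suc n)) \<longlonglongrightarrow> 0"
        using tendsto_mult[OF tendsto_const[of pi] LIMSEQ_inverse_real_of_nat] by (simp add: divide_inverse)
      then have "(\<lambda>n. x + ?t n) \<longlonglongrightarrow> x + 0 *\<^sub>R axis j 1"
        by (intro tendsto_intros)
      then have "(\<lambda>n. F (x + ?t n)) \<longlonglongrightarrow> F x"
        using isCont_tendsto_compose[of x F] cont by (simp add: continuous_on_eq_continuous_at)
      then have "(\<lambda>n. \<bar>F x - F (x + ?t n)\<bar>) \<longlonglongrightarrow> \<bar>F x - F x\<bar>"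
        by (intro tendsto_intros)
      then show "(\<lambda>n. \<bar>F x - F (x + ?t n)\<bar>) \<longlonglongrightarrow> 0" by simp
    qed
  qed auto
  then have lim: "(\<lambda>n. LINT x|lborel. \<bar>F x - F (x + ?t n)\<bar>) \<longlonglongrightarrow> 0" by simp
  show ?thesis
  proof (rule Lim_null_comparison[OF _ lim], rule always_eventually, rule allI)
    fix n
    let ?I = "LINT x|lborel. F x * cos (real (Suc n) * x $ j)"
    \<comment> \<open>The translation by \<open>?t n\<close> adds \<open>\<pi>\<close> to the argument of the cosine.\<close>
    have "(LINT x|lborel. F (x + ?t n) * cos (real (Suc n) * (x + ?t n) $ j)) = ?I"
      using integral_lborel_affine[of "\<lambda>x. F x * cos (real (Suc n) * x $ j)" 1 "?t n"] by (simp add: add.commute)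
    moreover have "cos (real (Suc n) * (x + ?t n) $ j) = - cos (real (Suc n) * x $ j)" for x
      by (simp add: distrib_left del: of_nat_Suc)
    ultimately have "?I = - (LINT x|lborel. F (x + ?t n) * cos (real (Suc n) * x $ j))"
      by simp
    then have "2 * ?I = (LINT x|lborel. (F x - F (x + ?t n)) * cos (real (Suc n) * x $ j))"
      by (simp add: left_diff_distrib int_cos[OF int_F] int_cos[OF int_Ft] del: of_nat_Suc)
    also have "\<bar>\<dots>\<bar> \<le> (LINT x|lborel. \<bar>F x - F (x + ?t n)\<bar>)"
    proof -
      have int: "integrable lborel (\<lambda>x. F x - F (x + ?t n))"
        by (intro Bochner_Integration.integrable_diff int_F int_Ft)
      have "\<bar>LINT x|lborel. (F x - F (x + ?t n)) * cos (real (Suc n) * x $ j)\<bar>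
          \<le> (LINT x|lborel. \<bar>(F x - F (x + ?t n)) * cos (real (Suc n) * x $ j)\<bar>)"
        by (rule integral_abs_bound)
      also have "\<dots> \<le> (LINT x|lborel. \<bar>F x - F (x + ?t n)\<bar>)"
        by (intro Bochner_Integration.integral_mono integrable_abs int int_cos[OF int])
          (simp add: abs_mult mult_left_le)
      finally show ?thesis .
    qed
    finally show "norm ?I \<le> (LINT x|lborel. \<bar>F x - F (x + ?t n)\<bar>)"
      by simp
  qed
qed

lemma osc_int_powr_decay:
  fixes h :: "real ^ 'd \<Rightarrow> complex"
  assumes h: "h \<in> test_fun" and p: "p > 0"
  obtains C where "\<And>x. norm (osc_int h x) powr p * (1 + norm x) ^ (2 * CARD('d)) \<le> C"
proof -
  obtain k :: nat where k: "2 * real CARD('d) / p \<le> real k"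
    using real_arch_simple by blast
  obtain C where C: "\<And>x. norm (osc_int h x) * (1 + norm x) ^ k \<le> C"
    using osc_int_decay[OF h] by metis
  have "norm (osc_int h x) powr p * (1 + norm x) ^ (2 * CARD('d)) \<le> C powr p" for x
    by (rule powr_decay[OF p _ norm_ge_zero C]) (use k p in \<open>simp add: field_simps\<close>)
  then show thesis by (rule that)
qed


text \<open>
  The \<open>p\<close>-th power of the \<open>L\<^sub>p\<close> quasi-norm, which for \<open>p \<le> 1\<close> is subadditive.
\<close>

definition mass :: "real \<Rightarrow> (real ^ 'd \<Rightarrow> complex) \<Rightarrow> real" where
  "mass p u = (LINT x|lborel. norm (u x) powr p)"

lemma continuous_on_osc_int: "h \<in> test_fun \<Longrightarrow> continuous_on UNIV (osc_int h)"
  by (intro smooth_on_imp_continuous_on smooth_on_osc_int test_fun_imp_Cc)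

lemma continuous_on_norm_powr: "continuous_on A u \<Longrightarrow> p > 0 \<Longrightarrow> continuous_on A (\<lambda>x. norm (u x) powr p)"
  by (intro continuous_on_powr') (auto intro!: continuous_intros)

lemma integrable_osc_int_powr:
  fixes h :: "real ^ 'd \<Rightarrow> complex"
  assumes h: "h \<in> test_fun" and p: "p > 0"
  shows "integrable lborel (\<lambda>x. norm (osc_int h x) powr p)"
proof -
  have [measurable]: "osc_int h \<in> borel_measurable borel"
    by (intro borel_measurable_continuous_onI continuous_on_osc_int h)
  obtain C where "\<And>x. norm (osc_int h x) powr p * (1 + norm x) ^ (2 * CARD('d)) \<le> C"
    using osc_int_powr_decay[OF h p] by metis
  then show ?thesis
    by (intro integrable_if_decay[where C = C]) auto
qed

text \<open>
  Modulating by \<open>1 + cos (n x\<^sub>j)\<close>, a function of mean value one, asymptotically multiplies the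
  \<open>p\<close>-mass by the mean value of \<open>(1 + cos)\<^sup>p\<close>, which is less than one since \<open>p < 1\<close>.
\<close>

lemma mass_modulated:
  fixes h :: "real ^ 'd \<Rightarrow> complex"
  assumes h: "h \<in> test_fun" and p: "0 < p" "p < 1" and "\<epsilon> > 0"
  shows "\<forall>\<^sub>F n in sequentially. mass p (\<lambda>x. osc_int h x * of_real (1 + cos (real (Suc n) * x $ j)))
      \<le> (1 - p * (1 - p) / 36) * mass p (osc_int h) + \<epsilon>"
proof -
  let ?F = "\<lambda>x. norm (osc_int h x) powr p"
  let ?I = "\<lambda>n. LINT x|lborel. ?F x * cos (real (Suc n) * x $ j)"
  define c where "c = p * (1 - p) / 18"
  have [measurable]: "osc_int h \<in> borel_measurable borel"
    by (intro borel_measurable_continuous_onI continuous_on_osc_int h)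
  have [measurable]: "(\<lambda>x::real^'d. x $ j) \<in> borel_measurable borel"
    by (intro borel_measurable_continuous_onI continuous_intros)
  have int_F: "integrable lborel ?F"
    by (rule integrable_osc_int_powr[OF h p(1)])
  have int_cos: "integrable lborel (\<lambda>x. ?F x * cos (t * x $ j))" for t
    by (rule Bochner_Integration.integrable_bound[OF int_F]) (auto simp: abs_mult mult_left_le)
  obtain C where "\<And>x. \<bar>?F x\<bar> * (1 + norm x) ^ (2 * CARD('d)) \<le> C"
    using osc_int_powr_decay[OF h p(1)] by (metis abs_of_nonneg powr_ge_zero)
  then have lim: "?I \<longlonglongrightarrow> 0"
    by (intro riemann_lebesgue_axis continuous_on_norm_powr continuous_on_osc_int h p)
  have lim2: "(\<lambda>n. ?I (2 * n + 1)) \<longlonglongrightarrow> 0"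
    by (rule filterlim_compose[OF lim]) (auto intro!: filterlim_subseq strict_monoI)
  have "(\<lambda>n. p * ?I n - c / 2 * ?I (2 * n + 1)) \<longlonglongrightarrow> p * 0 - c / 2 * 0"
    by (intro tendsto_intros lim lim2)
  then have "\<forall>\<^sub>F n in sequentially. p * ?I n - c / 2 * ?I (2 * n + 1) < \<epsilon>"
    using \<open>\<epsilon> > 0\<close> by (intro order_tendstoD(2)[of _ "p * 0 - c / 2 * 0"]) auto
  then show ?thesis
  proof eventually_elim
    fix n
    assume small: "p * ?I n - c / 2 * ?I (2 * n + 1) < \<epsilon>"
    let ?\<theta> = "\<lambda>x :: real ^ 'd. real (Suc n) * x $ j"
    let ?rhs = "\<lambda>x. (1 - c / 2) * ?F x + p * (?F x * cos (?\<theta> x)) - c / 2 * (?F x * cos (real (Suc (2 * n + 1)) * x $ j))"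
    have int_rhs: "integrable lborel ?rhs"
      by (intro Bochner_Integration.integrable_diff Bochner_Integration.integrable_add
          integrable_mult_right int_F int_cos)
    have pw: "norm (osc_int h x * of_real (1 + cos (?\<theta> x))) powr p \<le> ?rhs x" for x
    proof -
      have "norm (osc_int h x * of_real (1 + cos (?\<theta> x))) powr p = ?F x * (1 + cos (?\<theta> x)) powr p"
      proof -
        have "0 \<le> 1 + cos (?\<theta> x)" using cos_ge_minus_one[of "?\<theta> x"] by linarith
        then show ?thesis
          unfolding norm_mult norm_of_real by (simp only: abs_of_nonneg powr_mult norm_ge_zero)
      qed
      also have "\<dots> \<le> ?F x * (1 + p * cos (?\<theta> x) - c * (cos (?\<theta> x))\<^sup>2)"
        unfolding c_def by (intro mult_left_mono powr_one_plus_le p) auto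
      \<comment> \<open>The doubled frequency \<open>2 (n + 1)\<close> is \<open>Suc (2 n + 1)\<close>, so the same limit applies to it.\<close>
      also have "(cos (?\<theta> x))\<^sup>2 = (1 + cos (real (Suc (2 * n + 1)) * x $ j)) / 2"
      proof -
        have "real (Suc (2 * n + 1)) * x $ j = 2 * ?\<theta> x" by (simp add: algebra_simps)
        then show ?thesis by (simp only: cos_double_cos) simp
      qed
      also have "?F x * (1 + p * cos (?\<theta> x) - c * ((1 + cos (real (Suc (2 * n + 1)) * x $ j)) / 2)) = ?rhs x"
        by (simp add: algebra_simps del: of_nat_Suc)
      finally show ?thesis .
    qed
    have "mass p (\<lambda>x. osc_int h x * of_real (1 + cos (?\<theta> x))) \<le> (LINT x|lborel. ?rhs x)"
      unfolding mass_def
    proof (rule Bochner_Integration.integral_mono)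
      show "integrable lborel (\<lambda>x. norm (osc_int h x * of_real (1 + cos (?\<theta> x))) powr p)"
        by (rule Bochner_Integration.integrable_bound[OF int_rhs])
          (use pw in \<open>auto intro: order_trans[OF _ abs_ge_self] simp del: of_nat_Suc\<close>)
    qed (use pw int_rhs in auto)
    also have "\<dots> = (1 - c / 2) * mass p (osc_int h) + (p * ?I n - c / 2 * ?I (2 * n + 1))"
      unfolding mass_def using int_F int_cos by (simp del: of_nat_Suc)
    also have "\<dots> \<le> (1 - c / 2) * mass p (osc_int h) + \<epsilon>"
      using small by simp
    finally show "mass p (\<lambda>x. osc_int h x * of_real (1 + cos (?\<theta> x)))
      \<le> (1 - p * (1 - p) / 36) * mass p (osc_int h) + \<epsilon>"
      by (simp add: c_def)
  qed
qed

section \<open>Approximation on the frequencies away from the origin\<close>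

text \<open>
  Closeness in a weighted uniform norm. For \<open>K\<close> large enough, depending on \<open>q\<close>, it implies closeness
  in \<open>L\<^sub>q\<close>; so the exponent \<open>q\<close> enters only at the very end.
\<close>

definition weighted_close :: "nat \<Rightarrow> real \<Rightarrow> (real ^ 'd \<Rightarrow> complex) \<Rightarrow> (real ^ 'd \<Rightarrow> complex) \<Rightarrow> bool" where
  "weighted_close K \<epsilon> u v \<longleftrightarrow> (\<forall>x. norm (u x - v x) * (1 + norm x) ^ K \<le> \<epsilon>)"

lemma weighted_closeI: "(\<And>x. norm (u x - v x) * (1 + norm x) ^ K \<le> \<epsilon>) \<Longrightarrow> weighted_close K \<epsilon> u v"
  by (simp add: weighted_close_def)

lemma weighted_closeD: "weighted_close K \<epsilon> u v \<Longrightarrow> norm (u x - v x) * (1 + norm x) ^ K \<le> \<epsilon>"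
  by (simp add: weighted_close_def)

lemma weighted_close_mono: "weighted_close K \<epsilon> u v \<Longrightarrow> \<epsilon> \<le> \<epsilon>' \<Longrightarrow> weighted_close K \<epsilon>' u v"
  by (meson order_trans weighted_close_def)

lemma weighted_close_commute: "weighted_close K \<epsilon> u v \<longleftrightarrow> weighted_close K \<epsilon> v u"
  by (simp add: weighted_close_def norm_minus_commute)

lemma weighted_close_triangle:
  assumes "weighted_close K \<epsilon> u v" "weighted_close K \<epsilon>' v w"
  shows "weighted_close K (\<epsilon> + \<epsilon>') u w"
proof (rule weighted_closeI)
  fix x
  have "norm (u x - w x) \<le> norm (u x - v x) + norm (v x - w x)"
    using norm_triangle_ineq[of "u x - v x" "v x - w x"] by simp
  then have "norm (u x - w x) * (1 + norm x) ^ K \<le> (norm (u x - v x) + norm (v x - w x)) * (1 + norm x) ^ K"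
    by (intro mult_right_mono) auto
  also have "\<dots> \<le> \<epsilon> + \<epsilon>'"
    unfolding distrib_right by (intro add_mono weighted_closeD[OF assms(1)] weighted_closeD[OF assms(2)])
  finally show "norm (u x - w x) * (1 + norm x) ^ K \<le> \<epsilon> + \<epsilon>'" .
qed

text \<open>
  The functions that may be both multiplied and divided by a symbol.
\<close>

definition test_fun0 :: "(real ^ 'd \<Rightarrow> complex) set" where
  "test_fun0 = {H \<in> test_fun. \<exists>r>0. \<forall>\<xi>. norm \<xi> < r \<longrightarrow> H \<xi> = 0}"

lemma test_fun0_imp_test_fun: "H \<in> test_fun0 \<Longrightarrow> H \<in> test_fun"
  by (simp add: test_fun0_def)

lemma test_fun0_at_0: "H \<in> test_fun0 \<Longrightarrow> H 0 = 0"
  by (auto simp: test_fun0_def)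

lemma test_fun0I: "H \<in> test_fun \<Longrightarrow> r > 0 \<Longrightarrow> (\<And>\<xi>. norm \<xi> < r \<Longrightarrow> H \<xi> = 0) \<Longrightarrow> H \<in> test_fun0"
  by (auto simp: test_fun0_def)

lemma test_fun0_add:
  assumes "H \<in> test_fun0" "G \<in> test_fun0"
  shows "(\<lambda>\<xi>. H \<xi> + G \<xi>) \<in> test_fun0"
proof -
  obtain r s where "r > 0" "s > 0" "\<And>\<xi>. norm \<xi> < r \<Longrightarrow> H \<xi> = 0" "\<And>\<xi>. norm \<xi> < s \<Longrightarrow> G \<xi> = 0"
    using assms by (auto simp: test_fun0_def)
  with test_fun_add[OF assms[THEN test_fun0_imp_test_fun]] show ?thesis
    by (intro test_fun0I[where r = "min r s"]) simp_all
qed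

lemma test_fun0_scale: "H \<in> test_fun0 \<Longrightarrow> (\<lambda>\<xi>. c * H \<xi>) \<in> test_fun0"
  unfolding test_fun0_def by (auto intro: test_fun_scale)

lemma test_fun0_mult:
  assumes "H \<in> test_fun0" "smooth_on (UNIV - {0}) k"
  shows "(\<lambda>\<xi>. H \<xi> * k \<xi>) \<in> test_fun0"
proof -
  obtain r where "r > 0" "\<And>\<xi>. norm \<xi> < r \<Longrightarrow> H \<xi> = 0"
    using assms by (auto simp: test_fun0_def)
  with test_fun_mult_vanishing_near_0[OF test_fun0_imp_test_fun[OF assms(1)] this assms(2)] show ?thesis
    by (intro test_fun0I[where r = r]) simp_all
qed

lemma homogeneous_class_smooth:
  "\<psi> \<in> homogeneous_class \<alpha> \<Longrightarrow> smooth_on (UNIV - {0}) \<psi>"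
  "\<psi> \<in> homogeneous_class \<alpha> \<Longrightarrow> smooth_on (UNIV - {0}) (\<lambda>\<xi>. inverse (\<psi> \<xi>))"
  by (auto simp: homogeneous_class_def intro: smooth_on_inverse)

lemma homogeneous_class_scaleR:
  "\<psi> \<in> homogeneous_class \<alpha> \<Longrightarrow> \<tau> > 0 \<Longrightarrow> \<xi> \<noteq> 0 \<Longrightarrow> \<psi> (\<tau> *\<^sub>R \<xi>) = of_real (\<tau> powr \<alpha>) * \<psi> \<xi>"
  by (simp add: homogeneous_class_def)

lemma homogeneous_class_nonzero: "\<psi> \<in> homogeneous_class \<alpha> \<Longrightarrow> \<xi> \<noteq> 0 \<Longrightarrow> \<psi> \<xi> \<noteq> 0"
  by (simp add: homogeneous_class_def)

lemma integrable_test_fun: "h \<in> test_fun \<Longrightarrow> integrable lborel h"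
  by (intro Cc_space_integrable test_fun_imp_Cc)

text \<open>
  On the support of the translate, \<open>\<xi> = t (e + \<omega> / t)\<close> with bounded \<open>\<omega>\<close>, so homogeneity gives
  \<open>\<psi> \<xi> = t\<^sup>\<alpha> \<psi> (e + \<omega> / t)\<close>, where the argument stays close to the unit vector \<open>e\<close>. Division by \<open>\<psi>\<close>
  therefore gains the factor \<open>t\<^sup>-\<^sup>\<alpha>\<close> and leaves a bounded family of test functions.
\<close>

lemma osc_int_shifted_symbol_decay:
  fixes H :: "real ^ 'd \<Rightarrow> complex" and e :: "real ^ 'd"
  assumes \<psi>: "\<psi> \<in> homogeneous_class \<alpha>" and H: "H \<in> test_fun" and e: "norm e = 1"
  obtains C N where "C \<ge> 0"
    "\<And>t x. t \<ge> N \<Longrightarrow> norm (osc_int (\<lambda>\<xi>. H (\<xi> - t *\<^sub>R e) * inverse (\<psi> \<xi>)) x) * (1 + norm x) ^ K \<le> C * t powr (- \<alpha>)"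
proof -
  obtain R where R: "R \<ge> 0" "\<And>\<omega>. norm \<omega> > R \<Longrightarrow> H \<omega> = 0"
    using Cc_space_bounded[OF test_fun_imp_Cc[OF H]] by metis
  \<comment> \<open>A globally smooth function that agrees with \<open>1 / \<psi>\<close> on the ball of radius \<open>1 / 4\<close> around \<open>e\<close>.\<close>
  define k where "k = (\<lambda>\<zeta>. cutoff (- 4 *\<^sub>R e + 4 *\<^sub>R \<zeta>) * inverse (\<psi> \<zeta>))"
  have k: "k \<in> test_fun"
    unfolding k_def
  proof (rule test_fun_mult_vanishing_near_0)
    show "(\<lambda>\<zeta>. cutoff (- 4 *\<^sub>R e + 4 *\<^sub>R \<zeta>)) \<in> test_fun"
      by (intro test_fun_affine cutoff_test_fun) auto
    show "smooth_on (UNIV - {0}) (\<lambda>\<zeta>. inverse (\<psi> \<zeta>))"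
      by (rule homogeneous_class_smooth[OF \<psi>])
    fix \<zeta> :: "real ^ 'd" assume "norm \<zeta> < 1 / 2"
    moreover have "norm (- 4 *\<^sub>R e) \<le> norm (- 4 *\<^sub>R e + 4 *\<^sub>R \<zeta>) + norm (4 *\<^sub>R \<zeta>)"
      using norm_triangle_ineq4[of "- 4 *\<^sub>R e + 4 *\<^sub>R \<zeta>" "4 *\<^sub>R \<zeta>"] by (simp only: add_diff_cancel_right')
    ultimately have "norm (- 4 *\<^sub>R e + 4 *\<^sub>R \<zeta>) \<ge> 2"
      using e by simp
    then show "cutoff (- 4 *\<^sub>R e + 4 *\<^sub>R \<zeta>) = 0"
      by (rule cutoff_eq_0)
  qed simp
  obtain C where C: "C \<ge> 0"
    "\<And>s x. s \<in> {0..1} \<Longrightarrow> norm (osc_int (\<lambda>\<omega>. H \<omega> * k (e + s *\<^sub>R \<omega>)) x) * (1 + norm x) ^ K \<le> C"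
    using osc_int_scaled_product_decay[OF H k] by blast
  show thesis
  proof (rule that[OF C(1)])
    \<comment> \<open>For these \<open>t\<close> the point \<open>e + \<omega> / t\<close> lies in that ball whenever \<open>H \<omega> \<noteq> 0\<close>.\<close>
    fix t :: real and x :: "real ^ 'd" assume t: "t \<ge> 4 * R + 1"
    have t0: "t > 0" using t R by linarith
    let ?G = "\<lambda>\<omega>. H \<omega> * k (e + (1 / t) *\<^sub>R \<omega>)"
    have G: "?G \<in> test_fun"
      by (intro test_fun_mult H smooth_on_affine_compose test_fun_smooth k)
    have eq: "H (\<xi> - t *\<^sub>R e) * inverse (\<psi> \<xi>) = of_real (t powr (- \<alpha>)) * ?G (\<xi> - t *\<^sub>R e)" for \<xi>
    proof (cases "norm (\<xi> - t *\<^sub>R e) \<le> R")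
      case True
      define \<zeta> where "\<zeta> = e + (1 / t) *\<^sub>R (\<xi> - t *\<^sub>R e)"
      have \<xi>: "\<xi> = t *\<^sub>R \<zeta>"
        using t0 by (simp add: \<zeta>_def algebra_simps)
      have small: "norm ((1 / t) *\<^sub>R (\<xi> - t *\<^sub>R e)) \<le> 1 / 4"
      proof -
        have "norm ((1 / t) *\<^sub>R (\<xi> - t *\<^sub>R e)) = norm (\<xi> - t *\<^sub>R e) / t"
          using t0 by (subst norm_scaleR) simp
        also have "\<dots> \<le> R / t"
          using True t0 by (intro divide_right_mono) auto
        also have "\<dots> \<le> 1 / 4"
          using t t0 R by (simp add: field_simps)
        finally show ?thesis .
      qed
      have "\<zeta> \<noteq> 0"
      proof
        assume "\<zeta> = 0"
        then have "(1 / t) *\<^sub>R (\<xi> - t *\<^sub>R e) = - e"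
          by (simp add: \<zeta>_def eq_neg_iff_add_eq_0 add.commute)
        then show False using small e by simp
      qed
      have "cutoff (- 4 *\<^sub>R e + 4 *\<^sub>R \<zeta>) = 1"
      proof (rule cutoff_eq_1)
        have "- 4 *\<^sub>R e + 4 *\<^sub>R \<zeta> = 4 *\<^sub>R ((1 / t) *\<^sub>R (\<xi> - t *\<^sub>R e))"
          by (simp add: \<zeta>_def scaleR_add_right)
        then show "norm (- 4 *\<^sub>R e + 4 *\<^sub>R \<zeta>) \<le> 1"
          using small by (simp only: norm_scaleR[of 4])
      qed
      then have "?G (\<xi> - t *\<^sub>R e) = H (\<xi> - t *\<^sub>R e) * inverse (\<psi> \<zeta>)"
        by (simp add: k_def flip: \<zeta>_def)
      moreover have "\<psi> \<xi> = of_real (t powr \<alpha>) * \<psi> \<zeta>"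
        unfolding \<xi> using \<psi> t0 \<open>\<zeta> \<noteq> 0\<close> by (intro homogeneous_class_scaleR)
      ultimately show ?thesis
        using t0 by (auto simp: powr_minus)
    qed (simp add: R)
    have "osc_int (\<lambda>\<xi>. H (\<xi> - t *\<^sub>R e) * inverse (\<psi> \<xi>)) x = of_real (t powr (- \<alpha>)) * (cis (x \<bullet> (t *\<^sub>R e)) * osc_int ?G x)"
      unfolding eq osc_int_cmult
      by (subst osc_int_shift[where h = ?G]) (auto intro: Cc_space_borel test_fun_imp_Cc G)
    then have "norm (osc_int (\<lambda>\<xi>. H (\<xi> - t *\<^sub>R e) * inverse (\<psi> \<xi>)) x) * (1 + norm x) ^ K
        = t powr (- \<alpha>) * (norm (osc_int ?G x) * (1 + norm x) ^ K)"
      by (simp add: norm_mult)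
    also have "\<dots> \<le> t powr (- \<alpha>) * C"
      using t R by (intro mult_left_mono C(2)) (auto simp: field_simps)
    finally show "norm (osc_int (\<lambda>\<xi>. H (\<xi> - t *\<^sub>R e) * inverse (\<psi> \<xi>)) x) * (1 + norm x) ^ K \<le> C * t powr (- \<alpha>)"
      by (simp add: mult.commute)
  qed
qed

text \<open>
  The central step. Passing from \<open>H\<close> to \<open>H + (H (\<cdot> - t e) + H (\<cdot> + t e)) / 2\<close> multiplies the function
  \<open>osc_int H\<close>, which plays the role of \<open>\<psi>(D) g\<close>, by \<open>1 + cos (t x\<^sub>j)\<close> and so decreases its \<open>p\<close>-mass by a
  fixed factor. The function \<open>osc_int (H / \<psi>)\<close>, which plays the role of \<open>g\<close>, changes by
  \<open>O(t\<^sup>-\<^sup>\<alpha>)\<close> only.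
\<close>

lemma contraction_step:
  fixes H :: "real ^ 'd \<Rightarrow> complex"
  assumes \<psi>: "\<psi> \<in> homogeneous_class \<alpha>" and \<alpha>: "\<alpha> > 0" and p: "0 < p" "p < 1"
    and H: "H \<in> test_fun0" and \<epsilon>: "\<epsilon> > 0"
  shows "\<exists>H'\<in>test_fun0.
    weighted_close K \<epsilon> (osc_quot \<psi> H') (osc_quot \<psi> H) \<and>
    mass p (osc_int H') \<le> (1 - p * (1 - p) / 36) * mass p (osc_int H) + \<epsilon>"
proof -
  note Ht = test_fun0_imp_test_fun[OF H]
  \<comment> \<open>Any coordinate direction will do.\<close>
  define j :: 'd where "j = undefined"
  define e :: "real ^ 'd" where "e = axis j 1"
  have e: "norm e = 1" "norm (- e) = 1" by (simp_all add: e_def)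
  obtain R where R: "R \<ge> 0" "\<And>\<omega>. norm \<omega> > R \<Longrightarrow> H \<omega> = 0"
    using Cc_space_bounded[OF test_fun_imp_Cc[OF Ht]] by metis
  obtain C1 N1 where C1: "C1 \<ge> 0" "\<And>t x. t \<ge> N1 \<Longrightarrow>
      norm (osc_int (\<lambda>\<xi>. H (\<xi> - t *\<^sub>R e) * inverse (\<psi> \<xi>)) x) * (1 + norm x) ^ K \<le> C1 * t powr (- \<alpha>)"
    by (rule osc_int_shifted_symbol_decay[OF \<psi> Ht e(1), where K = K]) (rule that; assumption)
  obtain C2 N2 where C2: "C2 \<ge> 0" "\<And>t x. t \<ge> N2 \<Longrightarrow>
      norm (osc_int (\<lambda>\<xi>. H (\<xi> - t *\<^sub>R (- e)) * inverse (\<psi> \<xi>)) x) * (1 + norm x) ^ K \<le> C2 * t powr (- \<alpha>)"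
    by (rule osc_int_shifted_symbol_decay[OF \<psi> Ht e(2), where K = K]) (rule that; assumption)
  let ?t = "\<lambda>n. real (Suc n)"
  have t_top: "filterlim ?t at_top sequentially"
    by (rule filterlim_compose[OF filterlim_real_sequentially filterlim_Suc])
  have "((\<lambda>t. (C1 + C2) * t powr (- \<alpha>)) \<longlongrightarrow> (C1 + C2) * 0) at_top"
    using \<alpha> by (intro tendsto_mult tendsto_const tendsto_neg_powr filterlim_ident) auto
  from filterlim_compose[OF this t_top] have "\<forall>\<^sub>F n in sequentially. (C1 + C2) * ?t n powr (- \<alpha>) < \<epsilon>"
    using \<epsilon> by (intro order_tendstoD(2)[of _ "(C1 + C2) * 0"]) auto
  moreover have "\<forall>\<^sub>F n in sequentially. ?t n \<ge> max N1 (max N2 (R + 1))"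
    using t_top unfolding filterlim_at_top by (rule spec)
  moreover note mass_modulated[OF Ht p \<epsilon>, of j]
  ultimately have "\<forall>\<^sub>F n in sequentially. (C1 + C2) * ?t n powr (- \<alpha>) < \<epsilon> \<and> ?t n \<ge> max N1 (max N2 (R + 1)) \<and>
      mass p (\<lambda>x. osc_int H x * of_real (1 + cos (?t n * x $ j))) \<le> (1 - p * (1 - p) / 36) * mass p (osc_int H) + \<epsilon>"
    by (intro eventually_conj)
  then have "\<exists>n. (C1 + C2) * ?t n powr (- \<alpha>) < \<epsilon> \<and> ?t n \<ge> max N1 (max N2 (R + 1)) \<and>
      mass p (\<lambda>x. osc_int H x * of_real (1 + cos (?t n * x $ j))) \<le> (1 - p * (1 - p) / 36) * mass p (osc_int H) + \<epsilon>"
    by (rule eventually_happens'[OF sequentially_bot])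
  then obtain n where n: "(C1 + C2) * ?t n powr (- \<alpha>) < \<epsilon>" "?t n \<ge> N1" "?t n \<ge> N2" "?t n \<ge> R + 1"
      "mass p (\<lambda>x. osc_int H x * of_real (1 + cos (?t n * x $ j))) \<le> (1 - p * (1 - p) / 36) * mass p (osc_int H) + \<epsilon>"
    unfolding max.bounded_iff by (elim exE conjE) (rule that)
  define t where "t = ?t n"
  \<comment> \<open>For \<open>t \<ge> R + 1\<close> the translates stay away from the origin.\<close>
  have far: "(\<lambda>\<xi>. H (\<xi> - t *\<^sub>R d)) \<in> test_fun0" if "norm d = 1" for d :: "real ^ 'd"
  proof (rule test_fun0I[of _ 1])
    show "(\<lambda>\<xi>. H (\<xi> - t *\<^sub>R d)) \<in> test_fun"
      by (rule test_fun_shift[OF Ht])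
    fix \<xi> :: "real ^ 'd" assume "norm \<xi> < 1"
    moreover have "norm (t *\<^sub>R d) \<le> norm \<xi> + norm (\<xi> - t *\<^sub>R d)"
      using norm_triangle_ineq4[of \<xi> "\<xi> - t *\<^sub>R d"] by simp
    moreover have "norm (t *\<^sub>R d) = t" using that by (simp add: t_def)
    ultimately show "H (\<xi> - t *\<^sub>R d) = 0"
      using n(4) by (intro R) (simp add: t_def)
  qed simp
  let ?Hp = "\<lambda>\<xi>. H (\<xi> - t *\<^sub>R e)" and ?Hm = "\<lambda>\<xi>. H (\<xi> - t *\<^sub>R (- e))"
  define H' where "H' = (\<lambda>\<xi>. H \<xi> + ((1/2) * ?Hp \<xi> + (1/2) * ?Hm \<xi>))"
  have H'0: "H' \<in> test_fun0"
    unfolding H'_def by (intro test_fun0_add test_fun0_scale far e H)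
  have int: "integrable lborel G" if "G \<in> test_fun0" for G :: "real ^ 'd \<Rightarrow> complex"
    by (rule integrable_test_fun[OF test_fun0_imp_test_fun[OF that]])
  have H_borel: "H \<in> borel_measurable borel"
    by (intro Cc_space_borel test_fun_imp_Cc Ht)
  have inv: "(\<lambda>\<xi>. G \<xi> * inverse (\<psi> \<xi>)) \<in> test_fun0" if "G \<in> test_fun0" for G
    by (intro test_fun0_mult that homogeneous_class_smooth[OF \<psi>])
  show ?thesis
  proof (intro bexI conjI weighted_closeI)
    fix x
    have "osc_quot \<psi> H' x
        = osc_int (\<lambda>\<xi>. H \<xi> * inverse (\<psi> \<xi>) + ((1/2) * (?Hp \<xi> * inverse (\<psi> \<xi>)) + (1/2) * (?Hm \<xi> * inverse (\<psi> \<xi>)))) x"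
      by (simp add: H'_def algebra_simps)
    also have "\<dots> = osc_quot \<psi> H x
        + ((1/2) * osc_quot \<psi> ?Hp x + (1/2) * osc_quot \<psi> ?Hm x)"
      by (simp only: osc_int_add osc_int_cmult int inv test_fun0_add test_fun0_scale far e H)
    finally have "norm (osc_quot \<psi> H' x - osc_quot \<psi> H x)
        \<le> norm (osc_quot \<psi> ?Hp x) + norm (osc_quot \<psi> ?Hm x)"
      by (simp add: norm_triangle_mono norm_mult order_trans[OF norm_triangle_ineq])
    then have "norm (osc_quot \<psi> H' x - osc_quot \<psi> H x) * (1 + norm x) ^ K
        \<le> (norm (osc_quot \<psi> ?Hp x) + norm (osc_quot \<psi> ?Hm x)) * (1 + norm x) ^ K"
      by (intro mult_right_mono) auto
    also have "\<dots> \<le> C1 * t powr (- \<alpha>) + C2 * t powr (- \<alpha>)"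
      unfolding distrib_right using n(2,3) by (intro add_mono C1 C2) (auto simp: t_def)
    also have "\<dots> \<le> \<epsilon>"
      using n(1) by (simp add: t_def distrib_right)
    finally show "norm (osc_quot \<psi> H' x - osc_quot \<psi> H x) * (1 + norm x) ^ K \<le> \<epsilon>" .
  next
    have "osc_int H' x = osc_int H x * of_real (1 + cos (?t n * x $ j))" for x
    proof -
      have "osc_int H' x = osc_int H x + ((1/2) * osc_int ?Hp x + (1/2) * osc_int ?Hm x)"
        unfolding H'_def
        by (simp only: osc_int_add osc_int_cmult int test_fun0_add test_fun0_scale far e H)
      also have "\<dots> = osc_int H x * (1 + (cis (t * x $ j) + cis (- (t * x $ j))) / 2)"
        unfolding osc_int_shift[OF H_borel] by (simp add: e_def inner_axis algebra_simps)
      also have "cis (t * x $ j) + cis (- (t * x $ j)) = of_real (2 * cos (t * x $ j))"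
        by (simp add: complex_eq_iff)
      finally show ?thesis by (simp add: t_def)
    qed
    then have "osc_int H' = (\<lambda>x. osc_int H x * of_real (1 + cos (?t n * x $ j)))" by (rule ext)
    with n(5) show "mass p (osc_int H') \<le> (1 - p * (1 - p) / 36) * mass p (osc_int H) + \<epsilon>"
      by simp
  qed (rule H'0)
qed

lemma contraction_iterate:
  fixes H :: "real ^ 'd \<Rightarrow> complex"
  assumes \<psi>: "\<psi> \<in> homogeneous_class \<alpha>" and \<alpha>: "\<alpha> > 0" and p: "0 < p" "p < 1"
    and H: "H \<in> test_fun0" and \<epsilon>: "\<epsilon> > 0"
  shows "\<exists>H'\<in>test_fun0.
    weighted_close K \<epsilon> (osc_quot \<psi> H') (osc_quot \<psi> H) \<and>
    mass p (osc_int H') \<le> (1 - p * (1 - p) / 36) ^ m * mass p (osc_int H) + \<epsilon>"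
  using H \<epsilon>
proof (induction m arbitrary: H \<epsilon>)
  case 0
  then show ?case by (intro bexI[of _ H]) (auto simp: weighted_close_def)
next
  case (Suc m)
  let ?q = "1 - p * (1 - p) / 36"
  have q: "0 \<le> ?q" "?q \<le> 1"
    using p mult_mono[of p 1 "1 - p" 1] by auto
  obtain H1 where H1: "H1 \<in> test_fun0" "weighted_close K (\<epsilon> / 2) (osc_quot \<psi> H1) (osc_quot \<psi> H)"
      "mass p (osc_int H1) \<le> ?q * mass p (osc_int H) + \<epsilon> / 2"
    using contraction_step[OF \<psi> \<alpha> p Suc.prems(1), of "\<epsilon> / 2" K] Suc.prems(2) by auto
  obtain H2 where H2: "H2 \<in> test_fun0" "weighted_close K (\<epsilon> / 2) (osc_quot \<psi> H2) (osc_quot \<psi> H1)"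
      "mass p (osc_int H2) \<le> ?q ^ m * mass p (osc_int H1) + \<epsilon> / 2"
    using Suc.IH[OF H1(1), of "\<epsilon> / 2"] Suc.prems(2) by auto
  show ?case
  proof (intro bexI[OF _ H2(1)] conjI)
    show "weighted_close K \<epsilon> (osc_quot \<psi> H2) (osc_quot \<psi> H)"
      using weighted_close_triangle[OF H2(2) H1(2)] by simp
  next
    have "mass p (osc_int H2) \<le> ?q ^ m * (?q * mass p (osc_int H) + \<epsilon> / 2) + \<epsilon> / 2"
      using H2(3) mult_left_mono[OF H1(3), of "?q ^ m"] q by simp
    also have "\<dots> = ?q ^ Suc m * mass p (osc_int H) + (?q ^ m * (\<epsilon> / 2) + \<epsilon> / 2)"
      by (simp add: algebra_simps)
    also have "?q ^ m * (\<epsilon> / 2) \<le> 1 * (\<epsilon> / 2)"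
      using q Suc.prems(2) by (intro mult_right_mono power_le_one) auto
    finally show "mass p (osc_int H2) \<le> ?q ^ Suc m * mass p (osc_int H) + \<epsilon>" by simp
  qed
qed

lemma small_mass_approximation:
  fixes H :: "real ^ 'd \<Rightarrow> complex"
  assumes \<psi>: "\<psi> \<in> homogeneous_class \<alpha>" and \<alpha>: "\<alpha> > 0" and p: "0 < p" "p < 1"
    and H: "H \<in> test_fun0" and \<epsilon>: "\<epsilon> > 0"
  obtains H' where "H' \<in> test_fun0"
    "weighted_close K \<epsilon> (osc_quot \<psi> H') (osc_quot \<psi> H)"
    "mass p (osc_int H') \<le> \<epsilon>"
proof -
  let ?q = "1 - p * (1 - p) / 36"
  have pos: "0 < p * (1 - p)" using p by simp
  moreover have "p * (1 - p) \<le> 1" using p mult_mono[of p 1 "1 - p" 1] by auto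
  ultimately have "(\<lambda>m. ?q ^ m) \<longlonglongrightarrow> 0" by (intro LIMSEQ_power_zero) auto
  then have "(\<lambda>m. ?q ^ m * mass p (osc_int H)) \<longlonglongrightarrow> 0 * mass p (osc_int H)"
    by (intro tendsto_mult tendsto_const)
  then have "\<forall>\<^sub>F m in sequentially. ?q ^ m * mass p (osc_int H) < \<epsilon> / 2"
    using \<epsilon> by (intro order_tendstoD(2)[of _ "0 * mass p (osc_int H)"]) auto
  then obtain m where m: "?q ^ m * mass p (osc_int H) < \<epsilon> / 2"
    using eventually_happens'[OF sequentially_bot] by blast
  obtain H' where H': "H' \<in> test_fun0"
    "weighted_close K (\<epsilon> / 2) (osc_quot \<psi> H') (osc_quot \<psi> H)"
    "mass p (osc_int H') \<le> ?q ^ m * mass p (osc_int H) + \<epsilon> / 2"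
    using contraction_iterate[OF \<psi> \<alpha> p H, of "\<epsilon> / 2" K m] \<epsilon> by auto
  show thesis
  proof (rule that[OF H'(1)])
    show "weighted_close K \<epsilon> (osc_quot \<psi> H') (osc_quot \<psi> H)"
      by (rule weighted_close_mono[OF H'(2)]) (use \<epsilon> in simp)
    show "mass p (osc_int H') \<le> \<epsilon>"
      using H'(3) m by linarith
  qed
qed

section \<open>Low frequencies\<close>

text \<open>
  Both fractions \<open>c = a / (a + b)\<close> and \<open>c = b / (a + b)\<close> satisfy \<open>c \<le> c\<^sup>p\<close>, and they add up to one.
\<close>

lemma powr_add_le:
  fixes a b p :: real
  assumes "a \<ge> 0" "b \<ge> 0" "0 < p" "p \<le> 1"
  shows "(a + b) powr p \<le> a powr p + b powr p"
proof (cases "a + b = 0")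
  case False
  then have s: "a + b > 0" using assms by linarith
  have *: "c / (a + b) * (a + b) powr p \<le> c powr p" if "0 \<le> c" "c \<le> a + b" for c
  proof -
    have "c / (a + b) \<le> (c / (a + b)) powr p"
    proof (cases "c = 0")
      case False
      then have "c > 0" using that by simp
      then show ?thesis
        using powr_mono'[of p 1 "c / (a + b)"] that s assms by simp
    qed simp
    then have "c / (a + b) * (a + b) powr p \<le> (c / (a + b)) powr p * (a + b) powr p"
      by (intro mult_right_mono) auto
    also have "\<dots> = c powr p"
      using that s by (simp add: powr_divide)
    finally show ?thesis .
  qed
  have "(a + b) powr p = a / (a + b) * (a + b) powr p + b / (a + b) * (a + b) powr p"
    using s by (simp add: add_divide_distrib[symmetric] distrib_right[symmetric])
  also have "\<dots> \<le> a powr p + b powr p"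
    using assms by (intro add_mono *) auto
  finally show ?thesis .
qed (use assms in auto)

lemma norm_add_powr_le:
  fixes x y :: "'a::real_normed_vector"
  assumes "0 < p" "p \<le> 1"
  shows "norm (x + y) powr p \<le> norm x powr p + norm y powr p"
proof -
  have "norm (x + y) powr p \<le> (norm x + norm y) powr p"
    using assms by (intro powr_mono2 norm_triangle_ineq) auto
  also have "\<dots> \<le> norm x powr p + norm y powr p"
    using assms by (intro powr_add_le) auto
  finally show ?thesis .
qed

lemma ennreal_norm_add_powr_le:
  fixes x y :: "'a::real_normed_vector"
  assumes "0 < p" "p \<le> 1"
  shows "ennreal (norm (x + y) powr p) \<le> ennreal (norm x powr p) + ennreal (norm y powr p)"
  using norm_add_powr_le[OF assms, of x y] by (simp flip: ennreal_plus add: ennreal_leI)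

lemma homogeneous_class_borel:
  fixes \<psi> :: "real ^ 'd \<Rightarrow> complex"
  assumes \<psi>: "\<psi> \<in> homogeneous_class \<alpha>"
  shows "\<psi> \<in> borel_measurable borel"
proof -
  have "(\<lambda>\<xi>. indicator (UNIV - {0}) \<xi> *\<^sub>R \<psi> \<xi>) \<in> borel_measurable borel"
    by (intro borel_measurable_continuous_on_indicator smooth_on_imp_continuous_on homogeneous_class_smooth[OF \<psi>]) auto
  then have "(\<lambda>\<xi>. indicator (UNIV - {0}) \<xi> *\<^sub>R \<psi> \<xi> + indicator {0} \<xi> *\<^sub>R \<psi> 0) \<in> borel_measurable borel"
    by (intro borel_measurable_add) auto
  moreover have "(\<lambda>\<xi>. indicator (UNIV - {0}) \<xi> *\<^sub>R \<psi> \<xi> + indicator {0} \<xi> *\<^sub>R \<psi> 0) = \<psi>"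
    by (auto simp: fun_eq_iff indicator_def)
  ultimately show ?thesis by simp
qed

lemma homogeneous_class_bound:
  fixes \<psi> :: "real ^ 'd \<Rightarrow> complex"
  assumes \<psi>: "\<psi> \<in> homogeneous_class \<alpha>"
  obtains B where "B \<ge> 0" "\<And>\<xi>. \<xi> \<noteq> 0 \<Longrightarrow> norm (\<psi> \<xi>) \<le> B * norm \<xi> powr \<alpha>"
proof -
  have "bounded (\<psi> ` sphere 0 1)"
    by (intro compact_imp_bounded compact_continuous_image compact_sphere
        continuous_on_subset[OF smooth_on_imp_continuous_on[OF homogeneous_class_smooth(1)[OF \<psi>]]]) auto
  then obtain B where "\<forall>\<zeta>\<in>sphere 0 1. norm (\<psi> \<zeta>) \<le> B"
    by (auto simp: bounded_iff)
  then have B: "norm (\<psi> \<zeta>) \<le> B" if "norm \<zeta> = 1" for \<zeta>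
    using that by simp
  have "norm (\<psi> \<xi>) \<le> max B 0 * norm \<xi> powr \<alpha>" if "\<xi> \<noteq> 0" for \<xi>
  proof -
    have "\<psi> \<xi> = \<psi> (norm \<xi> *\<^sub>R (\<xi> /\<^sub>R norm \<xi>))" using that by simp
    also have "\<dots> = of_real (norm \<xi> powr \<alpha>) * \<psi> (\<xi> /\<^sub>R norm \<xi>)"
      using that by (intro homogeneous_class_scaleR[OF \<psi>]) auto
    finally have "norm (\<psi> \<xi>) = norm \<xi> powr \<alpha> * norm (\<psi> (\<xi> /\<^sub>R norm \<xi>))"
      by (simp add: norm_mult)
    also have "\<dots> \<le> norm \<xi> powr \<alpha> * max B 0"
      using B[of "\<xi> /\<^sub>R norm \<xi>"] that by (intro mult_left_mono) auto
    finally show ?thesis by (simp add: mult.commute)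
  qed
  then show thesis by (intro that[of "max B 0"]) auto
qed

lemma integrable_symbol_mult:
  fixes \<psi> :: "real ^ 'd \<Rightarrow> complex"
  assumes \<psi>: "\<psi> \<in> homogeneous_class \<alpha>" and \<alpha>: "\<alpha> > 0" and h: "h \<in> test_fun"
  shows "integrable lborel (\<lambda>\<xi>. \<psi> \<xi> * h \<xi>)"
proof -
  have [measurable]: "\<psi> \<in> borel_measurable borel" "h \<in> borel_measurable borel"
    by (intro homogeneous_class_borel[OF \<psi>] Cc_space_borel test_fun_imp_Cc h)+
  obtain B where B: "B \<ge> 0" "\<And>\<xi>. \<xi> \<noteq> 0 \<Longrightarrow> norm (\<psi> \<xi>) \<le> B * norm \<xi> powr \<alpha>"
    using homogeneous_class_bound[OF \<psi>] by blast
  obtain R where R: "R \<ge> 0" "\<And>\<xi>. norm \<xi> > R \<Longrightarrow> h \<xi> = 0"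
    using Cc_space_bounded[OF test_fun_imp_Cc[OF h]] by metis
  have "integrable lborel (\<lambda>\<xi>. of_real (B * R powr \<alpha>) * h \<xi>)"
    by (intro integrable_mult_right integrable_test_fun h)
  then show ?thesis
  proof (rule Bochner_Integration.integrable_bound)
    have le: "norm (\<psi> \<xi> * h \<xi>) \<le> norm (of_real (B * R powr \<alpha>) * h \<xi>)" if "\<xi> \<noteq> 0" for \<xi>
    proof (cases "norm \<xi> \<le> R")
      case True
      have "norm (\<psi> \<xi>) \<le> B * norm \<xi> powr \<alpha>" by (rule B(2)[OF that])
      also have "\<dots> \<le> B * R powr \<alpha>"
        using True \<alpha> B(1) by (intro mult_left_mono powr_mono2) auto
      finally have "norm (\<psi> \<xi>) \<le> norm (complex_of_real (B * R powr \<alpha>))"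
        using B(1) by (simp add: norm_mult)
      then show ?thesis unfolding norm_mult by (rule mult_right_mono) simp
    qed (simp add: R)
    show "AE \<xi> in lborel. norm (\<psi> \<xi> * h \<xi>) \<le> norm (of_real (B * R powr \<alpha>) * h \<xi>)"
      using AE_lborel_singleton[of "0 :: real ^ 'd"] by eventually_elim (rule le)
  qed measurable
qed

lemma osc_int_borel:
  assumes [measurable]: "f \<in> borel_measurable borel"
  shows "osc_int f \<in> borel_measurable borel"
  unfolding osc_int_def by measurable

definition low_freq :: "(real ^ 'd \<Rightarrow> complex) \<Rightarrow> nat \<Rightarrow> real ^ 'd \<Rightarrow> complex" where
  "low_freq h J \<xi> = cutoff (2 ^ J *\<^sub>R \<xi>) * h \<xi>"

lemma low_freq_test_fun:
  assumes "h \<in> test_fun"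
  shows "low_freq h J \<in> test_fun"
proof -
  have "(\<lambda>\<xi>. cutoff (0 + 2 ^ J *\<^sub>R \<xi>) * h \<xi>) \<in> test_fun"
    by (rule test_fun_mult_left[OF assms smooth_on_affine_compose[OF test_fun_smooth[OF cutoff_test_fun]]])
  then show ?thesis
    by (simp add: low_freq_def[abs_def])
qed

lemma osc_int_low_freq_tendsto_0:
  fixes \<psi> :: "real ^ 'd \<Rightarrow> complex"
  assumes \<psi>: "\<psi> \<in> homogeneous_class \<alpha>" and \<alpha>: "\<alpha> > 0" and h: "h \<in> test_fun"
  shows "(\<lambda>J. osc_mult \<psi> (low_freq h J) x) \<longlonglongrightarrow> 0"
proof -
  have "(\<lambda>J. LINT \<xi>|lborel. \<psi> \<xi> * low_freq h J \<xi> * cis (x \<bullet> \<xi>)) \<longlonglongrightarrow> (LINT \<xi>|(lborel :: (real ^ 'd) measure). 0)"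
  proof (rule integral_dominated_convergence[where w = "\<lambda>\<xi>. norm (\<psi> \<xi> * h \<xi>)"])
    show "integrable lborel (\<lambda>\<xi>. norm (\<psi> \<xi> * h \<xi>))"
      by (intro integrable_norm integrable_symbol_mult[OF \<psi> \<alpha> h])
    show "(\<lambda>\<xi>. \<psi> \<xi> * low_freq h J \<xi> * cis (x \<bullet> \<xi>)) \<in> borel_measurable lborel" for J
      using integrable_mult_cis[OF integrable_symbol_mult[OF \<psi> \<alpha> low_freq_test_fun[OF h]]] by (rule borel_measurable_integrable)
    show "AE \<xi> in lborel. norm (\<psi> \<xi> * low_freq h J \<xi> * cis (x \<bullet> \<xi>)) \<le> norm (\<psi> \<xi> * h \<xi>)" for J
    proof (rule AE_I2)
      fix \<xi>
      show "norm (\<psi> \<xi> * low_freq h J \<xi> * cis (x \<bullet> \<xi>)) \<le> norm (\<psi> \<xi> * h \<xi>)"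
        using mult_right_mono[OF norm_cutoff_le_1[of "2 ^ J *\<^sub>R \<xi>"], of "norm (h \<xi>)"]
        by (simp add: low_freq_def norm_mult mult_left_mono)
    qed
    have lim: "(\<lambda>J. \<psi> \<xi> * low_freq h J \<xi> * cis (x \<bullet> \<xi>)) \<longlonglongrightarrow> 0" if "\<xi> \<noteq> 0" for \<xi>
    proof (rule tendsto_eventually)
      obtain N :: nat where N: "2 / norm \<xi> < 2 ^ N"
        using real_arch_pow[of 2 "2 / norm \<xi>"] by auto
      show "\<forall>\<^sub>F J in sequentially. \<psi> \<xi> * low_freq h J \<xi> * cis (x \<bullet> \<xi>) = 0"
        using eventually_ge_at_top[of N]
      proof eventually_elim
        fix J assume "J \<ge> N"
        have "2 \<le> 2 ^ N * norm \<xi>"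
          using N that by (simp add: field_simps)
        also have "\<dots> \<le> 2 ^ J * norm \<xi>"
          using \<open>J \<ge> N\<close> by (intro mult_right_mono power_increasing) auto
        finally have "cutoff (2 ^ J *\<^sub>R \<xi>) = 0"
          by (intro cutoff_eq_0) simp
        then show "\<psi> \<xi> * low_freq h J \<xi> * cis (x \<bullet> \<xi>) = 0"
          by (simp add: low_freq_def)
      qed
    qed
    show "AE \<xi> in lborel. (\<lambda>J. \<psi> \<xi> * low_freq h J \<xi> * cis (x \<bullet> \<xi>)) \<longlonglongrightarrow> 0"
      using AE_lborel_singleton[of "0 :: real ^ 'd"] by eventually_elim (rule lim)
  qed auto
  then show ?thesis by (simp add: osc_int_def)
qed

text \<open>
  On the shell \<open>norm \<xi> \<approx> 2\<^sup>-\<^sup>J\<close> homogeneity gives, with \<open>s = 2\<^sup>-\<^sup>J\<close>, the integrand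
  \<open>s\<^sup>\<alpha> A (\<xi> / s) h \<xi>\<close>, whose Fourier integral is \<open>s\<^sup>\<alpha> s\<^sup>d G (s x)\<close> for rapidly decreasing \<open>G\<close> from a
  bounded family. Its \<open>p\<close>-th power has an integral of order \<open>s\<close> to the power \<open>(\<alpha> + d) p - d\<close>.
\<close>

lemma nn_integral_dyadic_shell:
  fixes \<psi> :: "real ^ 'd \<Rightarrow> complex"
  assumes \<psi>: "\<psi> \<in> homogeneous_class \<alpha>" and \<alpha>: "\<alpha> > 0" and h: "h \<in> test_fun" and p: "p > 0"
  obtains M where "M \<ge> 0" "\<And>J. (\<integral>\<^sup>+x. ennreal (norm (osc_mult \<psi> (low_freq h J) x
        - osc_mult \<psi> (low_freq h (Suc J)) x) powr p) \<partial>lborel)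
      \<le> ennreal (M * (2 powr (real CARD('d) - (\<alpha> + real CARD('d)) * p)) ^ J)"
proof -
  \<comment> \<open>The shell at \<open>J = 0\<close>; the two cut-off functions cancel near the origin.\<close>
  define A where "A = (\<lambda>\<omega>. (cutoff \<omega> - cutoff (2 *\<^sub>R \<omega>)) * \<psi> \<omega>)"
  have A: "A \<in> test_fun"
    unfolding A_def
  proof (rule test_fun_mult_vanishing_near_0[OF _ _ _ homogeneous_class_smooth(1)[OF \<psi>]])
    have "(\<lambda>\<omega>. cutoff \<omega> + (-1) * cutoff (0 + 2 *\<^sub>R \<omega>)) \<in> test_fun"
      by (intro test_fun_add test_fun_scale test_fun_affine cutoff_test_fun) auto
    then show "(\<lambda>\<omega>. cutoff \<omega> - cutoff (2 *\<^sub>R \<omega>)) \<in> test_fun" by simp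
    show "cutoff \<omega> - cutoff (2 *\<^sub>R \<omega>) = 0" if "norm \<omega> < 1 / 2" for \<omega> :: "real ^ 'd"
      using that by (simp add: cutoff_eq_1)
  qed simp
  obtain k :: nat where k: "2 * real CARD('d) / p \<le> real k"
    using real_arch_simple by blast
  obtain C where C: "C \<ge> 0"
    "\<And>s x. s \<in> {0..1} \<Longrightarrow> norm (osc_int (\<lambda>\<omega>. A \<omega> * h (0 + s *\<^sub>R \<omega>)) x) * (1 + norm x) ^ k \<le> C"
    using osc_int_scaled_product_decay[OF A h] by blast
  define M where "M = C powr p * decay_const TYPE('d)"
  show thesis
  proof (rule that[of M])
    show "M \<ge> 0" unfolding M_def by (intro mult_nonneg_nonneg decay_const_nonneg) auto
    fix J
    define s where "s = inverse (2 ^ J :: real)"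
    have s: "0 < s" "s \<in> {0..1}" "inverse s = 2 ^ J"
      by (auto simp: s_def inverse_le_1_iff)
    have s_2J: "s * 2 ^ J = 1" by (simp add: s_def)
    let ?G = "\<lambda>\<omega>. A \<omega> * h (0 + s *\<^sub>R \<omega>)"
    have G: "?G \<in> test_fun"
      by (rule test_fun_mult[OF A smooth_on_affine_compose[OF test_fun_smooth[OF h]]])
    have G_borel: "?G \<in> borel_measurable borel"
      by (rule Cc_space_borel[OF test_fun_imp_Cc[OF G]])
    have [measurable]: "osc_int ?G \<in> borel_measurable borel"
      by (rule osc_int_borel[OF G_borel])
    have AE_eq: "AE \<xi> in lborel. (\<psi> \<xi> * low_freq h J \<xi> - \<psi> \<xi> * low_freq h (Suc J) \<xi>) * cis (x \<bullet> \<xi>)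
        = of_real (s powr \<alpha>) * ?G (inverse s *\<^sub>R \<xi>) * cis (x \<bullet> \<xi>)" for x
    proof -
      have shell: "\<psi> \<xi> * low_freq h J \<xi> - \<psi> \<xi> * low_freq h (Suc J) \<xi> = of_real (s powr \<alpha>) * ?G (inverse s *\<^sub>R \<xi>)"
        if "\<xi> \<noteq> 0" for \<xi>
      proof -
        have "\<psi> (inverse s *\<^sub>R \<xi>) = of_real (inverse s powr \<alpha>) * \<psi> \<xi>"
          using s that by (intro homogeneous_class_scaleR[OF \<psi>]) auto
        moreover have "s powr \<alpha> * inverse s powr \<alpha> = 1"
          by (simp add: powr_mult[symmetric] s_def)
        ultimately have "\<psi> \<xi> = of_real (s powr \<alpha>) * \<psi> (inverse s *\<^sub>R \<xi>)"
          by (simp add: mult.assoc[symmetric] flip: of_real_mult)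
        then show ?thesis
          using s s_2J by (simp add: A_def low_freq_def algebra_simps)
      qed
      show ?thesis
        using AE_lborel_singleton[of "0 :: real ^ 'd"] by eventually_elim (rule arg_cong2[where f = "(*)", OF shell refl])
    qed
    have eq: "osc_mult \<psi> (low_freq h J) x - osc_mult \<psi> (low_freq h (Suc J)) x
        = of_real (s powr \<alpha> * s ^ CARD('d)) * osc_int ?G (0 + s *\<^sub>R x)" for x
    proof -
      note int = integrable_symbol_mult[OF \<psi> \<alpha> low_freq_test_fun[OF h]]
      have "osc_mult \<psi> (low_freq h J) x - osc_mult \<psi> (low_freq h (Suc J)) x
          = (LINT \<xi>|lborel. (\<psi> \<xi> * low_freq h J \<xi> - \<psi> \<xi> * low_freq h (Suc J) \<xi>) * cis (x \<bullet> \<xi>))"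
        by (simp add: osc_int_diff[symmetric] int) (simp add: osc_int_def)
      also have "\<dots> = osc_int (\<lambda>\<xi>. of_real (s powr \<alpha>) * ?G (inverse s *\<^sub>R \<xi>)) x"
        unfolding osc_int_def
      proof (rule integral_cong_AE[OF _ _ AE_eq])
        show "(\<lambda>\<xi>. (\<psi> \<xi> * low_freq h J \<xi> - \<psi> \<xi> * low_freq h (Suc J) \<xi>) * cis (x \<bullet> \<xi>)) \<in> borel_measurable lborel"
          by (intro borel_measurable_integrable integrable_mult_cis Bochner_Integration.integrable_diff int)
        show "(\<lambda>\<xi>. of_real (s powr \<alpha>) * ?G (inverse s *\<^sub>R \<xi>) * cis (x \<bullet> \<xi>)) \<in> borel_measurable lborel"
          using G_borel by measurable
      qed
      also have "\<dots> = of_real (s powr \<alpha>) * (of_real (inverse (inverse s) ^ CARD('d)) * osc_int ?G (x /\<^sub>R inverse s))"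
        using s by (simp only: osc_int_cmult) (subst osc_int_dilate[OF G_borel]; simp)
      finally show ?thesis by (simp add: mult.assoc)
    qed
    have "(\<integral>\<^sup>+x. ennreal (norm (osc_int ?G (0 + s *\<^sub>R x)) powr p) \<partial>lborel) = ennreal ((2 ^ J) ^ CARD('d)) * nn_mass lborel p (osc_int ?G)"
    proof -
      have "nn_mass lborel p (osc_int ?G)
          = ennreal (s ^ CARD('d)) * (\<integral>\<^sup>+x. ennreal (norm (osc_int ?G (0 + s *\<^sub>R x)) powr p) \<partial>lborel)"
      proof -
        have "(\<lambda>x. ennreal (norm (osc_int ?G x) powr p)) \<in> borel_measurable borel" by measurable
        from nn_integral_lborel_affine[OF this, of s 0] show ?thesis using s by simp
      qed
      moreover have "ennreal ((2 ^ J) ^ CARD('d)) * ennreal (s ^ CARD('d)) = 1"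
        using s by (simp add: ennreal_mult[symmetric] power_mult_distrib[symmetric] s_def)
      ultimately show ?thesis by (simp add: mult.assoc[symmetric])
    qed
    also have "nn_mass lborel p (osc_int ?G) \<le> ennreal M"
      unfolding M_def using p k s by (intro nn_integral_powr_le_decay_const[where k = k] C) (auto simp: field_simps)
    finally have main: "(\<integral>\<^sup>+x. ennreal (norm (osc_int ?G (0 + s *\<^sub>R x)) powr p) \<partial>lborel) \<le> ennreal ((2 ^ J) ^ CARD('d)) * ennreal M"
      by (simp add: mult_left_mono)
    have "(\<integral>\<^sup>+x. ennreal (norm (osc_mult \<psi> (low_freq h J) x
        - osc_mult \<psi> (low_freq h (Suc J)) x) powr p) \<partial>lborel)
      = (\<integral>\<^sup>+x. ennreal ((s powr \<alpha> * s ^ CARD('d)) powr p) * ennreal (norm (osc_int ?G (0 + s *\<^sub>R x)) powr p) \<partial>lborel)"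
      unfolding eq norm_mult norm_of_real using s
      by (intro nn_integral_cong) (simp add: powr_mult ennreal_mult)
    also have "\<dots> = ennreal ((s powr \<alpha> * s ^ CARD('d)) powr p) * (\<integral>\<^sup>+x. ennreal (norm (osc_int ?G (0 + s *\<^sub>R x)) powr p) \<partial>lborel)"
      by (intro nn_integral_cmult) measurable
    also have "\<dots> \<le> ennreal ((s powr \<alpha> * s ^ CARD('d)) powr p) * (ennreal ((2 ^ J) ^ CARD('d)) * ennreal M)"
      by (intro mult_left_mono main) auto
    also have "\<dots> = ennreal (M * ((s powr \<alpha> * s ^ CARD('d)) powr p * (2 ^ J) ^ CARD('d)))"
      using \<open>M \<ge> 0\<close> by (simp add: ennreal_mult[symmetric] mult_ac)
    also have "(s powr \<alpha> * s ^ CARD('d)) powr p * (2 ^ J) ^ CARD('d) = (2 powr (real CARD('d) - (\<alpha> + real CARD('d)) * p)) ^ J"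
    proof -
      let ?d = "real CARD('d)"
      have s_eq: "s = 2 powr (- real J)" by (simp add: s_def powr_minus powr_realpow)
      have "(s powr \<alpha> * s ^ CARD('d)) powr p = s powr ((\<alpha> + ?d) * p)"
        using s by (simp add: powr_add powr_realpow flip: powr_powr)
      also have "\<dots> = 2 powr (- real J * ((\<alpha> + ?d) * p))"
        by (simp only: s_eq powr_powr)
      finally have 1: "(s powr \<alpha> * s ^ CARD('d)) powr p = 2 powr (- real J * ((\<alpha> + ?d) * p))" .
      have "((2::real) ^ J) ^ CARD('d) = 2 ^ (J * CARD('d))"
        by (simp only: power_mult)
      also have "\<dots> = 2 powr (real (J * CARD('d)))"
        by (subst powr_realpow) auto
      finally have 2: "((2::real) ^ J) ^ CARD('d) = 2 powr (real J * ?d)"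
        by simp
      have "(2 powr (?d - (\<alpha> + ?d) * p)) ^ J = (2 powr (?d - (\<alpha> + ?d) * p)) powr real J"
        by (subst powr_realpow) auto
      then show ?thesis
        unfolding 1 2 by (simp add: powr_powr powr_add[symmetric] algebra_simps)
    qed
    finally show "(\<integral>\<^sup>+x. ennreal (norm (osc_mult \<psi> (low_freq h J) x
        - osc_mult \<psi> (low_freq h (Suc J)) x) powr p) \<partial>lborel)
      \<le> ennreal (M * (2 powr (real CARD('d) - (\<alpha> + real CARD('d)) * p)) ^ J)" .
  qed
qed

lemma critical_order_pos:
  assumes "p < 1" "0 < p" "\<alpha> > real d * (1 / p - 1)"
  shows "\<alpha> > 0"
proof -
  have "real d * (1 / p - 1) \<ge> 0"
    using assms by (intro mult_nonneg_nonneg) auto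
  with assms show ?thesis by linarith
qed

text \<open>
  Since \<open>p \<le> 1\<close>, the contributions of the dyadic shells may be added. They form a convergent
  geometric series exactly when \<open>(\<alpha> + d) p > d\<close>, that is \<open>\<alpha> > d (1 / p - 1)\<close>.
\<close>

lemma nn_integral_low_freq_small:
  fixes \<psi> :: "real ^ 'd \<Rightarrow> complex"
  assumes \<psi>: "\<psi> \<in> homogeneous_class \<alpha>" and p: "0 < p" "p < 1"
    and \<alpha>: "\<alpha> > real CARD('d) * (1 / p - 1)" and h: "h \<in> test_fun" and \<epsilon>: "\<epsilon> > 0"
  obtains J where "nn_mass lborel p (osc_mult \<psi> (low_freq h J)) \<le> ennreal \<epsilon>"
proof -
  let ?f = "\<lambda>J. osc_mult \<psi> (low_freq h J)"
  let ?D = "\<lambda>J x. ?f J x - ?f (Suc J) x"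
  have \<alpha>0: "\<alpha> > 0" by (rule critical_order_pos[OF p(2,1) \<alpha>])
  define r where "r = 2 powr (real CARD('d) - (\<alpha> + real CARD('d)) * p)"
  have "real CARD('d) < (\<alpha> + real CARD('d)) * p"
  proof -
    have "real CARD('d) * (1 / p - 1) * p < \<alpha> * p"
      using \<alpha> p by (intro mult_strict_right_mono) auto
    then show ?thesis using p by (simp add: algebra_simps)
  qed
  then have r: "0 < r" "r < 1"
    by (auto simp: r_def powr_less_one)
  obtain M where M: "M \<ge> 0" "\<And>J. nn_mass lborel p (?D J) \<le> ennreal (M * r ^ J)"
    using nn_integral_dyadic_shell[OF \<psi> \<alpha>0 h p(1)] unfolding r_def by blast
  have f_borel [measurable]: "?f J \<in> borel_measurable borel" for J
    using integrable_symbol_mult[OF \<psi> \<alpha>0 low_freq_test_fun[OF h]]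
    by (intro osc_int_borel) auto
  \<comment> \<open>Cut into \<open>N\<close> shells and a remainder, which tends to \<open>0\<close> pointwise as \<open>N\<close> grows.\<close>
  have telescope: "ennreal (norm (?f J x) powr p) \<le> (\<Sum>i<N. ennreal (norm (?D (J + i) x) powr p)) + ennreal (norm (?f (J + N) x) powr p)"
    for J N x
  proof (induction N)
    case (Suc N)
    have "ennreal (norm (?f (J + N) x) powr p) \<le> ennreal (norm (?D (J + N) x) powr p) + ennreal (norm (?f (J + Suc N) x) powr p)"
      using ennreal_norm_add_powr_le[of p "?D (J + N) x" "?f (J + Suc N) x"] p by simp
    with Suc show ?case
      by (simp add: add.assoc) (meson add_left_mono order_trans)
  qed simp
  have pointwise: "ennreal (norm (?f J x) powr p) \<le> (\<Sum>i. ennreal (norm (?D (J + i) x) powr p))" for J x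
  proof -
    let ?S = "\<Sum>i. ennreal (norm (?D (J + i) x) powr p)"
    have "(\<lambda>N. ?f (J + N) x) \<longlonglongrightarrow> 0"
      using LIMSEQ_ignore_initial_segment[OF osc_int_low_freq_tendsto_0[OF \<psi> \<alpha>0 h, of x], of J] by (simp add: add.commute)
    then have "(\<lambda>N. norm (?f (J + N) x) powr p) \<longlonglongrightarrow> norm (0 :: complex) powr p"
      using p by (intro tendsto_powr' tendsto_norm tendsto_const) auto
    then have "(\<lambda>N. ennreal (norm (?f (J + N) x) powr p)) \<longlonglongrightarrow> ennreal 0"
      by (intro tendsto_ennrealI) simp
    then have "(\<lambda>N. ?S + ennreal (norm (?f (J + N) x) powr p)) \<longlonglongrightarrow> ?S + ennreal 0"
      by (intro tendsto_add tendsto_const)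
    moreover have "ennreal (norm (?f J x) powr p) \<le> ?S + ennreal (norm (?f (J + N) x) powr p)" for N
      by (rule order_trans[OF telescope add_right_mono]) (intro sum_le_suminf, auto)
    ultimately have "ennreal (norm (?f J x) powr p) \<le> ?S + ennreal 0"
      by (intro LIMSEQ_le_const) auto
    then show ?thesis by simp
  qed
  have bound: "nn_mass lborel p (?f J) \<le> ennreal (M / (1 - r) * r ^ J)" for J
  proof -
    have "nn_mass lborel p (?f J) \<le> (\<integral>\<^sup>+x. (\<Sum>i. ennreal (norm (?D (J + i) x) powr p)) \<partial>lborel)"
      by (intro nn_integral_mono pointwise)
    also have "\<dots> = (\<Sum>i. \<integral>\<^sup>+x. ennreal (norm (?D (J + i) x) powr p) \<partial>lborel)"
      by (intro nn_integral_suminf) measurable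
    also have "\<dots> \<le> (\<Sum>i. ennreal (M * r ^ (J + i)))"
      by (intro suminf_le M) auto
    also have "\<dots> = (\<Sum>i. ennreal (M * r ^ J * r ^ i))"
      by (simp add: power_add mult_ac)
    also have "\<dots> = ennreal (\<Sum>i. M * r ^ J * r ^ i)"
      using r M by (intro suminf_ennreal2 summable_mult summable_geometric) auto
    also have "(\<Sum>i. M * r ^ J * r ^ i) = M / (1 - r) * r ^ J"
      using r by (subst suminf_mult) (auto simp: suminf_geometric)
    finally show ?thesis .
  qed
  have "(\<lambda>J. M / (1 - r) * r ^ J) \<longlonglongrightarrow> M / (1 - r) * 0"
    using r by (intro tendsto_mult tendsto_const LIMSEQ_power_zero) auto
  then have "\<forall>\<^sub>F J in sequentially. M / (1 - r) * r ^ J < \<epsilon>"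
    using \<epsilon> by (intro order_tendstoD(2)[of _ "M / (1 - r) * 0"]) auto
  then obtain J where "M / (1 - r) * r ^ J < \<epsilon>"
    using eventually_happens'[OF sequentially_bot] by blast
  then have "ennreal (M / (1 - r) * r ^ J) \<le> ennreal \<epsilon>"
    by (intro ennreal_leI) simp
  from order_trans[OF bound this] show thesis by (rule that)
qed

text \<open>
  Only the frequencies above \<open>2\<^sup>-\<^sup>J\<close> are modified; the rest is kept, and its image under the multiplier
  is small by itself.
\<close>

lemma band_limited_approximation:
  fixes \<psi> :: "real ^ 'd \<Rightarrow> complex"
  assumes \<psi>: "\<psi> \<in> homogeneous_class \<alpha>" and p: "0 < p" "p < 1"
    and \<alpha>: "\<alpha> > real CARD('d) * (1 / p - 1)" and h: "h \<in> test_fun" and \<epsilon>: "\<epsilon> > 0"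
  obtains h' where "h' \<in> test_fun" "weighted_close K \<epsilon> (osc_int h') (osc_int h)"
    "nn_mass lborel p (osc_mult \<psi> h') \<le> ennreal \<epsilon>"
proof -
  have \<alpha>0: "\<alpha> > 0" by (rule critical_order_pos[OF p(2,1) \<alpha>])
  have \<epsilon>2: "\<epsilon> / 2 > 0" using \<epsilon> by simp
  obtain J where J: "nn_mass lborel p (osc_mult \<psi> (low_freq h J)) \<le> ennreal (\<epsilon> / 2)"
    using nn_integral_low_freq_small[OF \<psi> p \<alpha> h \<epsilon>2] by blast
  let ?L = "low_freq h J"
  have L: "?L \<in> test_fun" by (rule low_freq_test_fun[OF h])
  have high: "(\<lambda>\<xi>. h \<xi> + (-1) * ?L \<xi>) \<in> test_fun0"
  proof (rule test_fun0I)
    show "(\<lambda>\<xi>. h \<xi> + (-1) * ?L \<xi>) \<in> test_fun"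
      by (rule test_fun_add[OF h test_fun_scale[OF L]])
    show "inverse (2 ^ J :: real) > 0" by simp
    fix \<xi> :: "real ^ 'd" assume "norm \<xi> < inverse (2 ^ J)"
    then have "cutoff (2 ^ J *\<^sub>R \<xi>) = 1"
      by (intro cutoff_eq_1) (simp add: field_simps)
    then show "h \<xi> + (-1) * ?L \<xi> = 0" by (simp add: low_freq_def)
  qed
  define H where "H = (\<lambda>\<xi>. (h \<xi> + (-1) * ?L \<xi>) * \<psi> \<xi>)"
  have H: "H \<in> test_fun0"
    unfolding H_def by (rule test_fun0_mult[OF high homogeneous_class_smooth(1)[OF \<psi>]])
  \<comment> \<open>At the origin both sides are zero, whatever the value of the symbol there.\<close>
  have H_div: "H \<xi> * inverse (\<psi> \<xi>) = h \<xi> - ?L \<xi>" for \<xi>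
    using homogeneous_class_nonzero[OF \<psi>, of \<xi>] test_fun0_at_0[OF high]
    by (cases "\<xi> = 0") (auto simp: H_def)
  obtain H' where H': "H' \<in> test_fun0"
    "weighted_close K (\<epsilon> / 2) (osc_quot \<psi> H') (osc_quot \<psi> H)"
    "mass p (osc_int H') \<le> \<epsilon> / 2"
    by (rule small_mass_approximation[OF \<psi> \<alpha>0 p H \<epsilon>2, where K = K]) (rule that; assumption)
  have H'_div: "(\<lambda>\<xi>. H' \<xi> * inverse (\<psi> \<xi>)) \<in> test_fun"
    by (rule test_fun0_imp_test_fun[OF test_fun0_mult[OF H'(1) homogeneous_class_smooth(2)[OF \<psi>]]])
  define h' where "h' = (\<lambda>\<xi>. H' \<xi> * inverse (\<psi> \<xi>) + ?L \<xi>)"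
  show thesis
  proof (rule that)
    show "h' \<in> test_fun"
      unfolding h'_def by (rule test_fun_add[OF H'_div L])
    have "osc_int h' x - osc_int h x = osc_quot \<psi> H' x - osc_quot \<psi> H x" for x
      unfolding h'_def H_div
      by (simp add: osc_int_add osc_int_diff integrable_test_fun H'_div L h)
    with H'(2) have "weighted_close K (\<epsilon> / 2) (osc_int h') (osc_int h)"
      by (simp add: weighted_close_def)
    then show "weighted_close K \<epsilon> (osc_int h') (osc_int h)"
      by (rule weighted_close_mono) (use \<epsilon> in simp)
  next
    have H't: "H' \<in> test_fun" by (rule test_fun0_imp_test_fun[OF H'(1)])
    have int_L: "integrable lborel (\<lambda>\<xi>. \<psi> \<xi> * ?L \<xi>)"
      by (rule integrable_symbol_mult[OF \<psi> \<alpha>0 L])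
    have "\<psi> \<xi> * h' \<xi> = H' \<xi> + \<psi> \<xi> * ?L \<xi>" for \<xi>
      using homogeneous_class_nonzero[OF \<psi>, of \<xi>] test_fun0_at_0[OF H'(1)]
      by (cases "\<xi> = 0") (auto simp: h'_def algebra_simps)
    then have eq: "osc_mult \<psi> h' x = osc_int H' x + osc_mult \<psi> ?L x" for x
      by (simp add: osc_int_add[OF integrable_test_fun[OF H't] int_L])
    have [measurable]: "osc_int H' \<in> borel_measurable borel" "osc_mult \<psi> ?L \<in> borel_measurable borel"
      using borel_measurable_integrable[OF integrable_test_fun[OF H't]] borel_measurable_integrable[OF int_L]
      by (intro osc_int_borel; simp)+
    have "nn_mass lborel p (osc_mult \<psi> h')
        \<le> (\<integral>\<^sup>+x. ennreal (norm (osc_int H' x) powr p) + ennreal (norm (osc_mult \<psi> ?L x) powr p) \<partial>lborel)"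
      unfolding eq using p by (intro nn_integral_mono ennreal_norm_add_powr_le) auto
    also have "\<dots> = nn_mass lborel p (osc_int H')
        + nn_mass lborel p (osc_mult \<psi> ?L)"
      by (intro nn_integral_add) measurable
    also have "nn_mass lborel p (osc_int H') = ennreal (mass p (osc_int H'))"
      unfolding mass_def by (intro nn_integral_eq_integral integrable_osc_int_powr[OF H't p(1)]) auto
    also have "\<dots> + nn_mass lborel p (osc_mult \<psi> ?L) \<le> ennreal (\<epsilon> / 2) + ennreal (\<epsilon> / 2)"
      by (intro add_mono ennreal_leI H'(3) J)
    also have "\<dots> = ennreal \<epsilon>"
      using \<epsilon> by (simp flip: ennreal_plus)
    finally show "nn_mass lborel p (osc_mult \<psi> h') \<le> ennreal \<epsilon>" .
  qed
qed

section \<open>Approximation of continuous functions with compact support\<close>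

lemma Cc_space_uniformly_continuous:
  fixes f :: "real ^ 'd \<Rightarrow> complex"
  assumes f: "f \<in> Cc_space" and \<epsilon>: "\<epsilon> > 0"
  obtains \<delta> where "\<delta> > 0" "\<And>x y. norm (x - y) < \<delta> \<Longrightarrow> norm (f x - f y) \<le> \<epsilon>"
proof -
  obtain R where R: "R \<ge> 0" "\<And>x. norm x > R \<Longrightarrow> f x = 0"
    using Cc_space_bounded[OF f] by metis
  have "uniformly_continuous_on (cball 0 (R + 1)) f"
    using f by (intro compact_uniformly_continuous) (auto simp: Cc_space_def intro: continuous_on_subset)
  then obtain \<delta> where \<delta>: "\<delta> > 0"
    "\<And>x y. norm x \<le> R + 1 \<Longrightarrow> norm y \<le> R + 1 \<Longrightarrow> norm (x - y) < \<delta> \<Longrightarrow> norm (f x - f y) < \<epsilon>"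
    using \<epsilon> unfolding uniformly_continuous_on_def dist_norm by (metis mem_cball_0 norm_minus_commute)
  show thesis
  proof (rule that[of "min \<delta> 1"])
    fix x y :: "real ^ 'd" assume xy: "norm (x - y) < min \<delta> 1"
    show "norm (f x - f y) \<le> \<epsilon>"
    proof (cases "norm x \<le> R + 1 \<and> norm y \<le> R + 1")
      case True
      then show ?thesis using \<delta>(2)[of x y] xy by auto
    next
      case False
      have "norm x \<le> norm y + norm (x - y)" "norm y \<le> norm x + norm (x - y)"
        using norm_triangle_ineq[of y "x - y"] norm_triangle_ineq4[of x "x - y"] by simp_all
      then have "norm x > R" "norm y > R" using False xy by auto
      then show ?thesis using R \<epsilon> by simp
    qed
  qed (use \<delta> in auto)
qed

text \<open>
  Multiplication of the transform by a dilated cut-off is convolution with an approximate identity.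
\<close>

lemma osc_int_cutoff_mollifier:
  fixes f :: "real ^ 'd \<Rightarrow> complex"
  assumes f: "f \<in> Cc_space" and s: "s > 0"
  shows "osc_int (\<lambda>\<xi>. osc_int f (- \<xi>) * cutoff (s *\<^sub>R \<xi>)) x
    = (LINT z|lborel. f (x + s *\<^sub>R z) * osc_int (\<lambda>\<xi>. cutoff (- \<xi>)) z)"
proof -
  have [measurable]: "f \<in> borel_measurable borel" by (rule Cc_space_borel[OF f])
  have cut: "(\<lambda>\<xi> :: real ^ 'd. cutoff (- \<xi>)) \<in> test_fun"
    using test_fun_affine[OF cutoff_test_fun, of "-1" 0] by simp
  have [measurable]: "osc_int f \<in> borel_measurable borel" "cutoff \<in> borel_measurable (borel :: (real ^ 'd) measure)"
      "osc_int (\<lambda>\<xi> :: real ^ 'd. cutoff (- \<xi>)) \<in> borel_measurable borel"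
    by (intro osc_int_borel Cc_space_borel f test_fun_imp_Cc cutoff_test_fun cut)+
  have cut_s: "(\<lambda>\<xi> :: real ^ 'd. cutoff (- (s *\<^sub>R \<xi>))) \<in> test_fun"
    using test_fun_affine[OF cutoff_test_fun, of "- s" 0] s by simp
  have "osc_int (\<lambda>\<xi>. osc_int f (- \<xi>) * cutoff (s *\<^sub>R \<xi>)) x
      = (LINT \<xi>|lborel. osc_int f \<xi> * cutoff (- (s *\<^sub>R \<xi>)) * cis ((- x) \<bullet> \<xi>))"
    unfolding osc_int_def[of "\<lambda>\<xi>. osc_int f (- \<xi>) * cutoff (s *\<^sub>R \<xi>)"]
    by (subst integral_lborel_affine[where c = "-1" and t = 0]) auto
  also have "\<dots> = (LINT y|lborel. f y * osc_int (\<lambda>\<xi>. cutoff (- (s *\<^sub>R \<xi>)) * cis ((- x) \<bullet> \<xi>)) y)"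
    unfolding mult.assoc
    by (intro osc_int_multiplication_formula Cc_space_integrable f integrable_mult_cis test_fun_imp_Cc cut_s)
  also have "\<dots> = (LINT y|lborel. f y * (of_real (inverse s ^ CARD('d)) * osc_int (\<lambda>\<xi>. cutoff (- \<xi>)) ((y + - x) /\<^sub>R s)))"
    unfolding osc_int_modulate using s
    by (subst osc_int_dilate[where h = "\<lambda>\<xi>. cutoff (- \<xi>)"]) auto
  also have "\<dots> = s ^ CARD('d) *\<^sub>R (LINT z|lborel. f (x + s *\<^sub>R z) * (of_real (inverse s ^ CARD('d)) *
      osc_int (\<lambda>\<xi>. cutoff (- \<xi>)) ((x + s *\<^sub>R z + - x) /\<^sub>R s)))"
    using s by (subst integral_lborel_affine[where c = s and t = x]) auto
  also have "\<dots> = s ^ CARD('d) *\<^sub>R (LINT z|lborel. of_real (inverse s ^ CARD('d)) * (f (x + s *\<^sub>R z) *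
      osc_int (\<lambda>\<xi>. cutoff (- \<xi>)) z))"
    using s by (simp add: mult_ac)
  also have "\<dots> = (LINT z|lborel. f (x + s *\<^sub>R z) * osc_int (\<lambda>\<xi>. cutoff (- \<xi>)) z)"
    unfolding integral_mult_right_zero using s by (simp add: scaleR_conv_of_real power_inverse)
  finally show ?thesis .
qed

lemma inv_fourier_test_fun:
  fixes h :: "real ^ 'd \<Rightarrow> complex"
  assumes "h \<in> test_fun"
  shows "inv_fourier h x = of_real (fourier_const TYPE('d)) * osc_int h x"
  by (intro inv_fourier_eq_osc_int Cc_space_borel test_fun_imp_Cc assms)

text \<open>
  The usual estimate for an approximate identity, with weights: the difference
  \<open>f (x + t z) - f x\<close> is zero unless \<open>norm x \<le> R + norm z\<close>, so the weight in \<open>x\<close> can be absorbed by the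
  rapid decay of the mollifier in \<open>z\<close>.
\<close>

lemma Cc_band_limited_approximation:
  fixes f :: "real ^ 'd \<Rightarrow> complex"
  assumes f: "f \<in> Cc_space" and \<epsilon>: "\<epsilon> > 0"
  obtains h where "h \<in> test_fun" "weighted_close K \<epsilon> (inv_fourier h) f"
proof -
  let ?c = "fourier_const TYPE('d)"
  have f_borel [measurable]: "f \<in> borel_measurable borel" by (rule Cc_space_borel[OF f])
  obtain B R where BR: "B \<ge> 0" "R \<ge> 0" "\<And>x. norm (f x) \<le> B" "\<And>x. norm x > R \<Longrightarrow> f x = 0"
    using Cc_space_bounded[OF f] by blast
  have cut: "(\<lambda>\<xi> :: real ^ 'd. cutoff (- \<xi>)) \<in> test_fun"
    using test_fun_affine[OF cutoff_test_fun, of "-1" 0] by simp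
  define \<Phi> :: "real ^ 'd \<Rightarrow> complex" where "\<Phi> = osc_int (\<lambda>\<xi>. cutoff (- \<xi>))"
  have int_\<Phi>: "integrable lborel \<Phi>"
    unfolding \<Phi>_def by (rule integrable_osc_int[OF cut])
  then have [measurable]: "\<Phi> \<in> borel_measurable borel" by auto
  have "(LINT z|lborel. \<Phi> z) = osc_int \<Phi> (- 0)"
    by (simp add: osc_int_def)
  also have "\<dots> = of_real ((2 * pi) powr real CARD('d))"
    unfolding \<Phi>_def osc_int_inversion[OF cut] by (simp add: cutoff_eq_1)
  finally have \<Phi>_1: "of_real (?c * ?c) * (LINT z|lborel. \<Phi> z) = 1"
    by (simp add: fourier_const_def flip: powr_add of_real_mult)
  define V where "V = (\<lambda>z. norm (\<Phi> z) * (1 + norm z) ^ (K + 1))"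
  have int_V: "integrable lborel V"
  proof -
    obtain C where C: "\<And>z. norm (\<Phi> z) * (1 + norm z) ^ (K + 1 + 2 * CARD('d)) \<le> C"
      using osc_int_decay[OF cut] unfolding \<Phi>_def by metis
    show ?thesis
    proof (rule integrable_if_decay)
      show "V \<in> borel_measurable borel" unfolding V_def by measurable
      show "norm (V z) * (1 + norm z) ^ (2 * CARD('d)) \<le> C" for z
        using C[of z] by (simp add: V_def power_add mult_ac)
    qed
  qed
  have V0: "V z \<ge> 0" for z by (simp add: V_def)
  define Q where "Q = ?c * ?c * (1 + R) ^ K * (LINT z|lborel. V z) + 1"
  have Q: "Q > 0"
    unfolding Q_def using BR fourier_const_pos[where 'd = 'd] V0
    by (intro add_nonneg_pos mult_nonneg_nonneg Bochner_Integration.integral_nonneg) (auto simp: less_imp_le)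
  obtain \<delta> where \<delta>: "\<delta> > 0" "\<And>x y. norm (x - y) < \<delta> \<Longrightarrow> norm (f x - f y) \<le> \<epsilon> / (2 * Q)"
    using Cc_space_uniformly_continuous[OF f, of "\<epsilon> / (2 * Q)"] \<epsilon> Q by auto
  define b where "b = B + 1"
  have b: "b > 0" "B \<le> b" using BR by (auto simp: b_def)
  \<comment> \<open>Beyond the distance \<open>\<delta>\<close> only \<open>2 B \<le> 2 B t norm z / \<delta>\<close> is available; for \<open>t \<le> s\<close> this is small too.\<close>
  define s where "s = \<epsilon> * \<delta> / (4 * b * Q)"
  define t where "t = min 1 s"
  have t: "0 < t" "t \<le> 1" "t \<le> s"
    using \<epsilon> \<delta> Q b by (auto simp: t_def s_def)
  define \<eta> where "\<eta> = \<epsilon> / (2 * Q) + 2 * B * t / \<delta>"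
  have \<eta>: "\<eta> \<ge> 0" "\<eta> * Q \<le> \<epsilon>"
  proof -
    show "\<eta> \<ge> 0" unfolding \<eta>_def using \<epsilon> Q BR t \<delta> by (intro add_nonneg_nonneg) auto
    have "2 * B * t / \<delta> \<le> 2 * b * s / \<delta>"
      using t BR b \<delta> by (intro divide_right_mono mult_mono) auto
    also have "\<dots> = \<epsilon> / (2 * Q)"
      using \<delta>(1) b Q by (simp add: s_def field_simps)
    finally have "\<eta> \<le> \<epsilon> / (2 * Q) + \<epsilon> / (2 * Q)" by (simp add: \<eta>_def)
    also have "\<dots> = \<epsilon> / Q" using Q by (simp add: field_simps)
    finally show "\<eta> * Q \<le> \<epsilon>" using Q by (simp add: field_simps)
  qed
  define h where "h = (\<lambda>\<xi>. of_real ?c * (osc_int f (- \<xi>) * cutoff (t *\<^sub>R \<xi>)))"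
  have h: "h \<in> test_fun"
  proof -
    have "(\<lambda>\<xi>. of_real ?c * (osc_int f (0 + (-1) *\<^sub>R \<xi>) * cutoff (0 + t *\<^sub>R \<xi>))) \<in> test_fun"
      using t by (intro test_fun_scale test_fun_mult_left test_fun_affine cutoff_test_fun
          smooth_on_affine_compose smooth_on_osc_int f) auto
    then show ?thesis by (simp add: h_def)
  qed
  show thesis
  proof (rule that[OF h weighted_closeI])
    fix x
    have int1: "integrable lborel (\<lambda>z. f (x + t *\<^sub>R z) * \<Phi> z)"
      by (rule Bochner_Integration.integrable_bound[of lborel "\<lambda>z. of_real B * \<Phi> z"])
        (use int_\<Phi> BR in \<open>auto simp: norm_mult intro!: mult_right_mono integrable_mult_right\<close>)
    have int2: "integrable lborel (\<lambda>z. f x * \<Phi> z)"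
      by (rule integrable_mult_right[OF int_\<Phi>])
    have "inv_fourier h x = of_real (?c * ?c) * (LINT z|lborel. f (x + t *\<^sub>R z) * \<Phi> z)"
      unfolding inv_fourier_test_fun[OF h] unfolding h_def osc_int_cmult osc_int_cutoff_mollifier[OF f t(1)] \<Phi>_def
      by simp
    moreover have "f x = of_real (?c * ?c) * (LINT z|lborel. f x * \<Phi> z)"
      using \<Phi>_1 by (simp add: mult_ac)
    ultimately have "inv_fourier h x - f x = of_real (?c * ?c) * (LINT z|lborel. f (x + t *\<^sub>R z) * \<Phi> z - f x * \<Phi> z)"
      using int1 int2 by (simp add: right_diff_distrib)
    then have "norm (inv_fourier h x - f x) = ?c * ?c * norm (LINT z|lborel. f (x + t *\<^sub>R z) * \<Phi> z - f x * \<Phi> z)"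
      using fourier_const_pos[where 'd = 'd] by (simp add: norm_mult)
    also have "\<dots> \<le> ?c * ?c * (LINT z|lborel. norm (f (x + t *\<^sub>R z) * \<Phi> z - f x * \<Phi> z))"
      using fourier_const_pos[where 'd = 'd] by (intro mult_left_mono integral_norm_bound) auto
    finally have "norm (inv_fourier h x - f x) * (1 + norm x) ^ K
        \<le> ?c * ?c * (LINT z|lborel. norm (f (x + t *\<^sub>R z) * \<Phi> z - f x * \<Phi> z)) * (1 + norm x) ^ K"
      by (intro mult_right_mono) auto
    also have "\<dots> = ?c * ?c * (LINT z|lborel. norm (f (x + t *\<^sub>R z) * \<Phi> z - f x * \<Phi> z) * (1 + norm x) ^ K)"
      by simp
    also have "\<dots> \<le> ?c * ?c * (LINT z|lborel. \<eta> * (1 + R) ^ K * V z)"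
    proof (intro mult_left_mono Bochner_Integration.integral_mono)
      show "integrable lborel (\<lambda>z. norm (f (x + t *\<^sub>R z) * \<Phi> z - f x * \<Phi> z) * (1 + norm x) ^ K)"
        using int1 int2 by (intro integrable_mult_left integrable_norm Bochner_Integration.integrable_diff)
      show "integrable lborel (\<lambda>z. \<eta> * (1 + R) ^ K * V z)"
        by (intro integrable_mult_right int_V)
      fix z
      show "norm (f (x + t *\<^sub>R z) * \<Phi> z - f x * \<Phi> z) * (1 + norm x) ^ K \<le> \<eta> * (1 + R) ^ K * V z"
      proof (cases "norm x \<le> R \<or> norm (x + t *\<^sub>R z) \<le> R")
        case False
        then show ?thesis
          using BR(2,4) \<eta>(1) V0[of z] by (auto intro!: mult_nonneg_nonneg)
      next
        case True
        have tz: "norm (t *\<^sub>R z) \<le> norm z"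
          using t by (simp add: mult_left_le_one_le)
        have "norm x \<le> norm (x + t *\<^sub>R z) + norm (t *\<^sub>R z)"
          using norm_triangle_ineq4[of "x + t *\<^sub>R z" "t *\<^sub>R z"] by simp
        then have "norm x \<le> R + norm z" using True tz norm_ge_zero[of z] by linarith
        then have "1 + norm x \<le> (1 + R) * (1 + norm z)"
          using mult_nonneg_nonneg[OF BR(2) norm_ge_zero[of z]] by (simp add: algebra_simps)
        then have w: "(1 + norm x) ^ K \<le> (1 + R) ^ K * (1 + norm z) ^ K"
          using power_mono[of "1 + norm x" _ K] by (simp flip: power_mult_distrib)
        have "norm (f (x + t *\<^sub>R z) - f x) \<le> \<eta> * (1 + norm z)"
        proof (cases "norm (t *\<^sub>R z) < \<delta>")
          case True
          then have "norm (f (x + t *\<^sub>R z) - f x) \<le> \<epsilon> / (2 * Q)"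
            by (intro \<delta>) simp
          also have "\<dots> \<le> \<eta>" using BR t \<delta> by (simp add: \<eta>_def)
          also have "\<dots> \<le> \<eta> * (1 + norm z)" using \<eta>(1) by (simp add: mult_left_mono distrib_left)
          finally show ?thesis .
        next
          case False
          have "norm (f (x + t *\<^sub>R z) - f x) \<le> B + B"
            using norm_triangle_ineq4[of "f (x + t *\<^sub>R z)" "f x"] BR(3)[of x] BR(3)[of "x + t *\<^sub>R z"] by linarith
          also have "\<dots> = 2 * B * 1" by simp
          also have "\<dots> \<le> 2 * B * (t * norm z / \<delta>)"
            using False t \<delta> BR by (intro mult_left_mono) (auto simp: field_simps)
          also have "\<dots> = 2 * B * t / \<delta> * norm z" by simp
          also have "\<dots> \<le> \<eta> * (1 + norm z)"
            using \<epsilon> Q \<eta>(1) by (intro mult_mono) (auto simp: \<eta>_def)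
          finally show ?thesis .
        qed
        then have "norm (f (x + t *\<^sub>R z) - f x) * norm (\<Phi> z) * (1 + norm x) ^ K
            \<le> \<eta> * (1 + norm z) * norm (\<Phi> z) * ((1 + R) ^ K * (1 + norm z) ^ K)"
          using w \<eta>(1) by (intro mult_mono) auto
        also have "\<dots> = \<eta> * (1 + R) ^ K * V z"
          by (simp add: V_def mult_ac)
        finally show ?thesis
          by (simp add: norm_mult flip: left_diff_distrib)
      qed
    qed (use fourier_const_pos[where 'd = 'd] in auto)
    also have "\<dots> = \<eta> * (?c * ?c * (1 + R) ^ K * (LINT z|lborel. V z))"
      by simp
    also have "\<dots> \<le> \<eta> * Q"
      using \<eta>(1) by (intro mult_left_mono) (auto simp: Q_def)
    also have "\<dots> \<le> \<epsilon>" by (rule \<eta>(2))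
    finally show "norm (inv_fourier h x - f x) * (1 + norm x) ^ K \<le> \<epsilon>" .
  qed
qed

lemma Lp_norm_leI:
  fixes u :: "real ^ 'd \<Rightarrow> complex"
  assumes p: "0 < p" "p \<noteq> \<infinity>" and a: "a \<ge> 0"
    and le: "(\<integral>\<^sup>+x. ennreal (norm (u x) powr enn2real p) \<partial>lebesgue) \<le> ennreal a"
  shows "Lp_norm p u \<le> ennreal (a powr (1 / enn2real p))"
proof -
  let ?I = "\<integral>\<^sup>+x. ennreal (norm (u x) powr enn2real p) \<partial>lebesgue"
  have "?I \<noteq> \<infinity>" using le by (auto simp: top_unique)
  moreover have "enn2real ?I \<le> a"
    using enn2real_mono[OF le] a by simp
  moreover have "enn2real p > 0" using p by (simp add: enn2real_positive_iff top.not_eq_extremum)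
  ultimately show ?thesis
    using p(2) by (auto simp: Lp_norm_def ennreal_power_def intro!: ennreal_leI powr_mono2)
qed

lemma inv_fourier_in_schwartz_space:
  fixes h :: "real ^ 'd \<Rightarrow> complex"
  assumes h: "h \<in> test_fun"
  shows "inv_fourier h \<in> schwartz_space"
proof -
  have "inv_fourier h = osc_int (\<lambda>\<xi>. of_real (fourier_const TYPE('d)) * h \<xi>)"
    by (simp add: fun_eq_iff inv_fourier_test_fun[OF h] osc_int_cmult)
  then show ?thesis
    using schwartz_space_osc_int[OF test_fun_scale[OF h]] by simp
qed

text \<open>
  One \<open>g\<close> is close to \<open>f\<close> in a weighted uniform norm, hence in all \<open>L\<^sub>q\<close> at the same time, while its
  seminorm is small.
\<close>

lemma Cc_W_approximation:
  fixes f :: "real ^ 'd \<Rightarrow> complex"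
  assumes \<psi>: "\<psi> \<in> homogeneous_class \<alpha>" and p: "0 < p" "p < 1"
    and \<alpha>: "\<alpha> > real CARD('d) * (1 / p - 1)" and f: "f \<in> Cc_space" and \<epsilon>: "\<epsilon> > 0"
  obtains g where "g \<in> W_space (ennreal p) \<psi>" "continuous_on UNIV g"
    "weighted_close K \<epsilon> f g" "W_seminorm (ennreal p) \<psi> g \<le> ennreal \<epsilon>"
proof -
  let ?c = "fourier_const TYPE('d)"
  have c: "?c > 0" by (rule fourier_const_pos)
  have \<alpha>0: "\<alpha> > 0" by (rule critical_order_pos[OF p(2,1) \<alpha>])
  obtain h where h: "h \<in> test_fun" "weighted_close K (\<epsilon> / 2) (inv_fourier h) f"
    using Cc_band_limited_approximation[OF f, of "\<epsilon> / 2"] \<epsilon> by auto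
  \<comment> \<open>The first bound is for the distance, the second one for the \<open>p\<close>-th power of the seminorm.\<close>
  define \<epsilon>' where "\<epsilon>' = min (\<epsilon> / (2 * ?c)) ((\<epsilon> / ?c) powr p)"
  have \<epsilon>': "\<epsilon>' > 0" using \<epsilon> c by (simp add: \<epsilon>'_def)
  obtain h' where h': "h' \<in> test_fun" "weighted_close K \<epsilon>' (osc_int h') (osc_int h)"
    "nn_mass lborel p (osc_mult \<psi> h') \<le> ennreal \<epsilon>'"
    by (rule band_limited_approximation[OF \<psi> p \<alpha> h(1) \<epsilon>', where K = K]) (rule that; assumption)
  define g where "g = inv_fourier h'"
  have int: "integrable lborel (\<lambda>\<xi>. \<psi> \<xi> * h' \<xi>)"
    by (rule integrable_symbol_mult[OF \<psi> \<alpha>0 h'(1)])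
  then have borel: "(\<lambda>\<xi>. \<psi> \<xi> * h' \<xi>) \<in> borel_measurable borel" by auto
  have mult_eq: "multiplier_op \<psi> g = (\<lambda>x. of_real ?c * osc_mult \<psi> h' x)"
    unfolding multiplier_op_def g_def fourier_inv_fourier[OF h'(1)]
    by (intro ext inv_fourier_eq_osc_int borel)
  have [measurable]: "osc_mult \<psi> h' \<in> borel_measurable borel"
    by (rule osc_int_borel[OF borel])
  have meas: "multiplier_op \<psi> g \<in> borel_measurable lebesgue"
    unfolding mult_eq by (rule measurable_completion) measurable
  have norm_le: "Lp_norm (ennreal p) (multiplier_op \<psi> g) \<le> ennreal \<epsilon>"
  proof -
    have "nn_mass lebesgue p (multiplier_op \<psi> g)
        = (\<integral>\<^sup>+x. ennreal (?c powr p) * ennreal (norm (osc_mult \<psi> h' x) powr p) \<partial>lborel)"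
      unfolding nn_integral_completion mult_eq norm_mult using c
      by (intro nn_integral_cong) (simp add: powr_mult ennreal_mult)
    also have "\<dots> = ennreal (?c powr p) * nn_mass lborel p (osc_mult \<psi> h')"
      by (intro nn_integral_cmult) measurable
    also have "\<dots> \<le> ennreal (?c powr p) * ennreal \<epsilon>'"
      by (intro mult_left_mono h'(3)) auto
    also have "\<dots> = ennreal (?c powr p * \<epsilon>')"
      using \<epsilon>' by (simp add: ennreal_mult)
    also have "\<dots> \<le> ennreal (?c powr p * (\<epsilon> / ?c) powr p)"
      by (intro ennreal_leI mult_left_mono) (auto simp: \<epsilon>'_def)
    also have "?c powr p * (\<epsilon> / ?c) powr p = \<epsilon> powr p"
      using c \<epsilon> by (simp flip: powr_mult)
    finally have "Lp_norm (ennreal p) (multiplier_op \<psi> g) \<le> ennreal ((\<epsilon> powr p) powr (1 / enn2real (ennreal p)))"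
      using p by (intro Lp_norm_leI) auto
    then show ?thesis using p \<epsilon> by (simp add: powr_powr)
  qed
  show thesis
  proof (rule that[of g])
    have g_schwartz: "g \<in> schwartz_space"
      unfolding g_def by (rule inv_fourier_in_schwartz_space[OF h'(1)])
    then show "continuous_on UNIV g"
      by (auto simp: schwartz_space_def intro: smooth_on_imp_continuous_on)
    show "g \<in> W_space (ennreal p) \<psi>"
      using g_schwartz meas norm_le by (auto simp: W_space_def Lp_space_def intro: le_less_trans)
    show "W_seminorm (ennreal p) \<psi> g \<le> ennreal \<epsilon>"
      using norm_le by (simp add: W_seminorm_def)
    have "weighted_close K (\<epsilon> / 2) (inv_fourier h) g"
    proof (rule weighted_closeI)
      fix x
      have "inv_fourier h x - g x = of_real ?c * (osc_int h x - osc_int h' x)"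
        by (simp add: g_def inv_fourier_test_fun h(1) h'(1) algebra_simps)
      then have "norm (inv_fourier h x - g x) * (1 + norm x) ^ K = ?c * (norm (osc_int h' x - osc_int h x) * (1 + norm x) ^ K)"
        using c by (simp add: norm_mult norm_minus_commute)
      also have "\<dots> \<le> ?c * (\<epsilon> / (2 * ?c))"
        using c order_trans[OF weighted_closeD[OF h'(2), of x], of "\<epsilon> / (2 * ?c)"]
        by (intro mult_left_mono) (auto simp: \<epsilon>'_def)
      finally show "norm (inv_fourier h x - g x) * (1 + norm x) ^ K \<le> \<epsilon> / 2"
        using c by simp
    qed
    with h(2) have "weighted_close K (\<epsilon> / 2 + \<epsilon> / 2) f g"
      by (subst (asm) weighted_close_commute) (rule weighted_close_triangle)
    then show "weighted_close K \<epsilon> f g" by simp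
  qed
qed

section \<open>Density of compactly supported continuous functions and the K-functional\<close>

lemma norm_add_powr_le_two:
  fixes x y :: "'a::real_normed_vector"
  assumes "q > 0"
  shows "norm (x + y) powr q \<le> 2 powr q * (norm x powr q + norm y powr q)"
proof -
  have "norm (x + y) powr q \<le> (2 * max (norm x) (norm y)) powr q"
    using assms norm_triangle_ineq[of x y] by (intro powr_mono2) auto
  also have "\<dots> = 2 powr q * max (norm x) (norm y) powr q"
    by (simp add: powr_mult)
  also have "max (norm x) (norm y) powr q \<le> norm x powr q + norm y powr q"
    by (simp add: max_def)
  finally show ?thesis by simp
qed

lemma nn_integral_norm_add_powr_le:
  fixes u v :: "'a \<Rightarrow> complex"
  assumes q: "q > 0" and [measurable]: "u \<in> borel_measurable M" "v \<in> borel_measurable M"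
    and uv: "nn_mass M q u \<le> ennreal a" "nn_mass M q v \<le> ennreal b"
    and ab: "a \<ge> 0" "b \<ge> 0"
  shows "(\<integral>\<^sup>+x. ennreal (norm (u x + v x) powr q) \<partial>M) \<le> ennreal (2 powr q * (a + b))"
proof -
  have "(\<integral>\<^sup>+x. ennreal (norm (u x + v x) powr q) \<partial>M)
      \<le> (\<integral>\<^sup>+x. ennreal (2 powr q) * (ennreal (norm (u x) powr q) + ennreal (norm (v x) powr q)) \<partial>M)"
    using norm_add_powr_le_two[OF q]
    by (intro nn_integral_mono) (simp flip: ennreal_plus ennreal_mult add: ennreal_leI)
  also have "\<dots> = ennreal (2 powr q) * (nn_mass M q u + nn_mass M q v)"
    by (subst nn_integral_cmult) (auto simp: nn_integral_add)
  also have "\<dots> \<le> ennreal (2 powr q) * (ennreal a + ennreal b)"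
    by (intro mult_left_mono add_mono uv) auto
  also have "\<dots> = ennreal (2 powr q * (a + b))"
    using ab by (simp add: ennreal_mult flip: ennreal_plus)
  finally show ?thesis .
qed

lemma eventually_small_imp_ex:
  fixes I :: "nat \<Rightarrow> ennreal"
  assumes "I \<longlonglongrightarrow> 0" "\<epsilon> > 0"
  obtains n where "I n \<le> ennreal \<epsilon>" "n \<ge> (1::nat)"
proof -
  have "\<forall>\<^sub>F n in sequentially. I n < ennreal \<epsilon>"
    using assms by (intro order_tendstoD(2)[OF assms(1)]) simp
  then have "\<forall>\<^sub>F n in sequentially. I n < ennreal \<epsilon> \<and> n \<ge> 1"
    by (intro eventually_conj eventually_ge_at_top)
  then obtain n where "I n < ennreal \<epsilon> \<and> n \<ge> 1"
    using eventually_happens'[OF sequentially_bot] by blast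
  then show thesis by (intro that[of n]) auto
qed

lemma Lq_truncation:
  fixes f :: "real ^ 'd \<Rightarrow> complex"
  assumes f [measurable]: "f \<in> borel_measurable lebesgue" and q: "q > 0"
    and fin: "nn_mass lebesgue q f < \<infinity>" and \<epsilon>: "\<epsilon> > 0"
  obtains n :: nat where "n \<ge> 1"
    "(\<integral>\<^sup>+x. ennreal (norm (f x - (if norm x \<le> n \<and> norm (f x) \<le> n then f x else 0)) powr q) \<partial>lebesgue) \<le> ennreal \<epsilon>"
proof -
  let ?F = "\<lambda>(n::nat) x. if norm x \<le> n \<and> norm (f x) \<le> n then f x else 0"
  have [measurable]: "(\<lambda>x. x) \<in> lebesgue \<rightarrow>\<^sub>M (borel :: (real ^ 'd) measure)"
    by (rule measurable_completion) simp
  have "(\<lambda>n. \<integral>\<^sup>+x. ennreal (norm (f x - ?F n x) powr q) \<partial>lebesgue) \<longlonglongrightarrow> (\<integral>\<^sup>+x. 0 \<partial>(lebesgue :: (real ^ 'd) measure))"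
  proof (rule nn_integral_dominated_convergence[where w = "\<lambda>x. ennreal (norm (f x) powr q)"])
    show "AE x in lebesgue. (\<lambda>n. ennreal (norm (f x - ?F n x) powr q)) \<longlonglongrightarrow> 0"
    proof (rule AE_I2, rule tendsto_eventually)
      fix x :: "real ^ 'd"
      obtain N :: nat where N: "max (norm x) (norm (f x)) \<le> N"
        using real_arch_simple by blast
      show "\<forall>\<^sub>F n in sequentially. ennreal (norm (f x - ?F n x) powr q) = 0"
        using eventually_ge_at_top[of N]
      proof eventually_elim
        fix n assume "n \<ge> N"
        then have "norm x \<le> n" "norm (f x) \<le> n" using N by auto
        then show "ennreal (norm (f x - ?F n x) powr q) = 0" by simp
      qed
    qed
  qed (use fin q in \<open>auto intro!: AE_I2 ennreal_leI\<close>)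
  then have "(\<lambda>n. \<integral>\<^sup>+x. ennreal (norm (f x - ?F n x) powr q) \<partial>lebesgue) \<longlonglongrightarrow> 0" by simp
  from eventually_small_imp_ex[OF this \<epsilon>] obtain n :: nat where
      "(\<integral>\<^sup>+x. ennreal (norm (f x - ?F n x) powr q) \<partial>lebesgue) \<le> ennreal \<epsilon>" "n \<ge> 1"
    by blast
  then show thesis by (rule that[rotated])
qed

text \<open>
  The radial projection onto the disc of radius \<open>b\<close>.
\<close>

definition clip :: "real \<Rightarrow> complex \<Rightarrow> complex" where
  "clip b z = z /\<^sub>R max 1 (norm z / b)"

lemma continuous_on_clip: "b > 0 \<Longrightarrow> continuous_on UNIV (clip b)"
  unfolding clip_def by (intro continuous_intros) (auto simp: max_def)

lemma clip_id: "b > 0 \<Longrightarrow> norm z \<le> b \<Longrightarrow> clip b z = z"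
  by (simp add: clip_def max_def)

lemma norm_clip_le: "b > 0 \<Longrightarrow> norm (clip b z) \<le> b"
  by (auto simp: clip_def max_def divide_simps)

text \<open>
  A Lebesgue measurable function is almost everywhere a limit of continuous functions. Clipping
  them at the bound of \<open>F\<close> and cutting them off outside its support makes dominated convergence
  applicable.
\<close>

lemma Lq_Cc_approximation_bounded:
  fixes F :: "real ^ 'd \<Rightarrow> complex"
  assumes F: "F \<in> borel_measurable lebesgue" and q: "q > 0" and b: "b \<ge> 1"
    and bound: "\<And>x. norm (F x) \<le> b" and supp: "\<And>x. norm x > b \<Longrightarrow> F x = 0" and \<epsilon>: "\<epsilon> > 0"
  obtains f1 where "f1 \<in> Cc_space" "(\<integral>\<^sup>+x. ennreal (norm (F x - f1 x) powr q) \<partial>lebesgue) \<le> ennreal \<epsilon>"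
proof -
  have "F measurable_on UNIV"
    using lebesgue_measurable_imp_measurable_on[OF F] by simp
  then obtain N g where N: "negligible N" and g: "\<And>n. continuous_on UNIV (g n)"
      "\<And>x. x \<notin> N \<Longrightarrow> (\<lambda>n. g n x) \<longlonglongrightarrow> F x"
    unfolding measurable_on_def by auto
  define G where "G = (\<lambda>(n::nat) x. cutoff (0 + inverse b *\<^sub>R x) * clip b (g n x))"
  have b0: "b > 0" using b by simp
  have cut: "(\<lambda>x :: real ^ 'd. cutoff (0 + inverse b *\<^sub>R x)) \<in> test_fun"
    using b0 by (intro test_fun_affine cutoff_test_fun) auto
  have G: "G n \<in> Cc_space" for n
    unfolding G_def
    by (intro Cc_space_mult test_fun_imp_Cc[OF cut] continuous_on_compose2[OF continuous_on_clip[OF b0] g(1)]) auto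
  have [measurable]: "G n \<in> borel_measurable lebesgue" for n
    by (rule measurable_completion) (use Cc_space_borel[OF G] in simp)
  note F [measurable]
  have G_0: "norm x > 2 * b \<Longrightarrow> G n x = 0" for n x
    using b0 by (simp add: G_def cutoff_eq_0 field_simps)
  have G_le: "norm (G n x) \<le> b" for n x
    using mult_mono[OF norm_cutoff_le_1[of "0 + inverse b *\<^sub>R x"] norm_clip_le[OF b0, of "g n x"]] b0
    by (simp add: G_def norm_mult)
  have "(\<lambda>n. \<integral>\<^sup>+x. ennreal (norm (F x - G n x) powr q) \<partial>lebesgue) \<longlonglongrightarrow> (\<integral>\<^sup>+x. 0 \<partial>(lebesgue :: (real ^ 'd) measure))"
  proof (rule nn_integral_dominated_convergence[where w = "\<lambda>x. ennreal ((2 * b) powr q) * indicator (cball 0 (2 * b)) x"])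
    show "AE x in lebesgue. ennreal (norm (F x - G n x) powr q) \<le> ennreal ((2 * b) powr q) * indicator (cball 0 (2 * b)) x" for n
    proof (rule AE_I2)
      fix x
      have "norm (F x - G n x) \<le> 2 * b"
        using norm_triangle_ineq4[of "F x" "G n x"] bound[of x] G_le[of n x] by linarith
      then have "norm (F x - G n x) powr q \<le> (2 * b) powr q"
        using q by (intro powr_mono2) auto
      then show "ennreal (norm (F x - G n x) powr q) \<le> ennreal ((2 * b) powr q) * indicator (cball 0 (2 * b)) x"
        using supp[of x] G_0[of x n] b0 q by (cases "norm x \<le> 2 * b") (auto intro: ennreal_leI)
    qed
    have "emeasure lebesgue (cball (0 :: real ^ 'd) (2 * b)) < \<infinity>"
      using emeasure_bounded_finite[of "cball (0 :: real ^ 'd) (2 * b)"] by simp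
    then show "(\<integral>\<^sup>+x. ennreal ((2 * b) powr q) * indicator (cball 0 (2 * b)) x \<partial>(lebesgue :: (real ^ 'd) measure)) < \<infinity>"
      by (subst nn_integral_cmult_indicator) (auto simp: ennreal_mult_less_top)
    have lim: "(\<lambda>n. ennreal (norm (F x - G n x) powr q)) \<longlonglongrightarrow> 0" if x: "x \<notin> N" for x
    proof -
      have "(\<lambda>n. clip b (g n x)) \<longlonglongrightarrow> clip b (F x)"
        using continuous_on_clip[OF b0] g(2)[OF x]
        by (intro isCont_tendsto_compose[of _ "clip b"]) (auto simp: continuous_on_eq_continuous_at)
      then have "(\<lambda>n. G n x) \<longlonglongrightarrow> cutoff (0 + inverse b *\<^sub>R x) * F x"
        unfolding G_def clip_id[OF b0 bound] by (intro tendsto_mult tendsto_const)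
      also have "cutoff (0 + inverse b *\<^sub>R x) * F x = F x"
        using supp[of x] b0 by (cases "norm x \<le> b") (auto simp: cutoff_eq_1 field_simps)
      finally have "(\<lambda>n. norm (F x - G n x) powr q) \<longlonglongrightarrow> norm (F x - F x) powr q"
        using q by (intro tendsto_powr' tendsto_norm tendsto_diff tendsto_const) auto
      then have "(\<lambda>n. ennreal (norm (F x - G n x) powr q)) \<longlonglongrightarrow> ennreal 0"
        by (intro tendsto_ennrealI) simp
      then show ?thesis by simp
    qed
    have "AE x in lebesgue. x \<notin> N"
      using N by (simp add: negligible_iff_null_sets AE_not_in)
    then show "AE x in lebesgue. (\<lambda>n. ennreal (norm (F x - G n x) powr q)) \<longlonglongrightarrow> 0"
      by eventually_elim (rule lim)
    show "(\<lambda>x. ennreal (norm (F x - G n x) powr q)) \<in> borel_measurable lebesgue" for n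
      by measurable
    show "(\<lambda>x. ennreal ((2 * b) powr q) * indicator (cball 0 (2 * b)) x) \<in> borel_measurable (lebesgue :: (real ^ 'd) measure)"
      by (intro borel_measurable_times_ennreal borel_measurable_const borel_measurable_indicator) simp
  qed simp
  then have "(\<lambda>n. \<integral>\<^sup>+x. ennreal (norm (F x - G n x) powr q) \<partial>lebesgue) \<longlonglongrightarrow> 0" by simp
  from eventually_small_imp_ex[OF this \<epsilon>] obtain n where
      "(\<integral>\<^sup>+x. ennreal (norm (F x - G n x) powr q) \<partial>lebesgue) \<le> ennreal \<epsilon>"
    by blast
  then show thesis by (rule that[OF G])
qed

lemma Lq_Cc_approximation:
  fixes f :: "real ^ 'd \<Rightarrow> complex"
  assumes f: "f \<in> borel_measurable lebesgue" and q: "q > 0"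
    and fin: "nn_mass lebesgue q f < \<infinity>" and \<epsilon>: "\<epsilon> > 0"
  obtains f1 where "f1 \<in> Cc_space" "(\<integral>\<^sup>+x. ennreal (norm (f x - f1 x) powr q) \<partial>lebesgue) \<le> ennreal \<epsilon>"
proof -
  define a where "a = \<epsilon> / (2 * 2 powr q)"
  have a: "a > 0" "2 powr q * (a + a) = \<epsilon>" using \<epsilon> by (auto simp: a_def field_simps)
  obtain n :: nat where n: "n \<ge> 1"
    "(\<integral>\<^sup>+x. ennreal (norm (f x - (if norm x \<le> n \<and> norm (f x) \<le> n then f x else 0)) powr q) \<partial>lebesgue) \<le> ennreal a"
    using Lq_truncation[OF f q fin a(1)] by blast
  define F where "F = (\<lambda>x. if norm x \<le> n \<and> norm (f x) \<le> n then f x else 0)"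
  note f [measurable]
  have [measurable]: "(\<lambda>x. x) \<in> lebesgue \<rightarrow>\<^sub>M (borel :: (real ^ 'd) measure)"
    by (rule measurable_completion) simp
  have F [measurable]: "F \<in> borel_measurable lebesgue"
    unfolding F_def by measurable
  obtain f1 where f1: "f1 \<in> Cc_space" "(\<integral>\<^sup>+x. ennreal (norm (F x - f1 x) powr q) \<partial>lebesgue) \<le> ennreal a"
    by (rule Lq_Cc_approximation_bounded[OF F q, of "real n" a]) (use n a in \<open>auto simp: F_def\<close>)
  have [measurable]: "f1 \<in> borel_measurable lebesgue"
    by (rule measurable_completion) (use Cc_space_borel[OF f1(1)] in simp)
  have "(\<integral>\<^sup>+x. ennreal (norm ((f x - F x) + (F x - f1 x)) powr q) \<partial>lebesgue) \<le> ennreal (2 powr q * (a + a))"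
    using n(2) f1(2) a by (intro nn_integral_norm_add_powr_le[OF q]) (auto simp: F_def)
  with f1(1) a(2) show thesis by (intro that[of f1]) simp_all
qed

lemma C0_Cc_approximation:
  fixes f :: "real ^ 'd \<Rightarrow> complex"
  assumes f: "f \<in> C0_space" and \<epsilon>: "\<epsilon> > 0"
  obtains f1 where "f1 \<in> Cc_space" "\<And>x. norm (f x - f1 x) \<le> \<epsilon>"
proof -
  have cont: "continuous_on UNIV f" and lim: "(f \<longlongrightarrow> 0) at_infinity"
    using f by (auto simp: C0_space_def)
  have "\<forall>\<^sub>F x in at_infinity. dist (f x) 0 < \<epsilon> / 2"
    using lim \<epsilon> by (intro tendstoD) auto
  then obtain b where b: "\<And>x. norm x \<ge> b \<Longrightarrow> norm (f x) < \<epsilon> / 2"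
    by (auto simp: eventually_at_infinity)
  define R where "R = max b 1"
  have R: "R > 0" "b \<le> R" by (auto simp: R_def)
  define f1 where "f1 = (\<lambda>x. cutoff (0 + inverse R *\<^sub>R x) * f x)"
  have f1: "f1 \<in> Cc_space"
    unfolding f1_def using R
    by (intro Cc_space_mult test_fun_imp_Cc test_fun_affine cutoff_test_fun cont) auto
  have "norm (f x - f1 x) \<le> \<epsilon>" for x
  proof (cases "norm x \<le> R")
    case True
    then have "cutoff (0 + inverse R *\<^sub>R x) = 1"
      using R by (intro cutoff_eq_1) (simp add: field_simps)
    then show ?thesis using \<epsilon> by (simp add: f1_def)
  next
    case False
    have "norm (f1 x) \<le> norm (f x)"
      using mult_right_mono[OF norm_cutoff_le_1[of "0 + inverse R *\<^sub>R x"], of "norm (f x)"]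
      by (simp add: f1_def norm_mult)
    then show ?thesis
      using norm_triangle_ineq4[of "f x" "f1 x"] b[of x] False R by linarith
  qed
  with f1 show thesis by (rule that)
qed

text \<open>
  This treats finite and infinite \<open>q\<close> alike: a weighted uniform approximation of a suitable compactly
  supported \<open>f1\<close> is an approximation of \<open>f\<close> in \<open>L\<^sub>q\<close>. For finite \<open>q\<close> the weight makes the error
  integrable; for \<open>q = \<infinity>\<close> the exponent \<open>0\<close> suffices.
\<close>

lemma Lp_norm_approximation:
  fixes f :: "real ^ 'd \<Rightarrow> complex"
  assumes q: "0 < q" and f: "f \<in> Lp_space q" "q = \<infinity> \<Longrightarrow> f \<in> C0_space" and \<eta>: "\<eta> > 0"
  obtains f1 K \<epsilon> where "f1 \<in> Cc_space" "\<epsilon> > 0"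
    "\<forall>g. continuous_on UNIV g \<longrightarrow> weighted_close K \<epsilon> f1 g \<longrightarrow> Lp_norm q (\<lambda>x. f x - g x) \<le> ennreal \<eta>"
proof (cases "q = \<infinity>")
  case True
  have f_borel [measurable]: "f \<in> borel_measurable lebesgue"
    using f(1) by (simp add: Lp_space_def)
  obtain f1 where f1: "f1 \<in> Cc_space" "\<And>x. norm (f x - f1 x) \<le> \<eta> / 2"
    using C0_Cc_approximation[OF f(2)[OF True], of "\<eta> / 2"] \<eta> by auto
  show thesis
  proof (rule that[OF f1(1)], rule half_gt_zero[OF \<eta>], intro allI impI)
    fix g assume g: "continuous_on UNIV g" "weighted_close 0 (\<eta> / 2) f1 g"
    have [measurable]: "g \<in> borel_measurable lebesgue"
      by (rule measurable_completion) (use borel_measurable_continuous_onI[OF g(1)] in simp)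
    have "esssup lebesgue (\<lambda>x. ennreal (norm (f x - g x))) \<le> ennreal \<eta>"
    proof (rule esssup_I, measurable, rule AE_I2)
      fix x
      have "norm (f x - g x) \<le> norm (f x - f1 x) + norm (f1 x - g x)"
        using norm_triangle_ineq[of "f x - f1 x" "f1 x - g x"] by simp
      then show "ennreal (norm (f x - g x)) \<le> ennreal \<eta>"
        using f1(2)[of x] weighted_closeD[OF g(2), of x] by (intro ennreal_leI) simp
    qed
    then show "Lp_norm q (\<lambda>x. f x - g x) \<le> ennreal \<eta>"
      using True by (simp add: Lp_norm_def)
  qed
next
  case False
  define r where "r = enn2real q"
  have r: "r > 0"
    using q False by (simp add: r_def enn2real_positive_iff top.not_eq_extremum)
  have f_borel [measurable]: "f \<in> borel_measurable lebesgue"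
    using f(1) by (simp add: Lp_space_def)
  have fin: "nn_mass lebesgue r f < \<infinity>"
    using f(1) False by (auto simp: Lp_space_def Lp_norm_def ennreal_power_def r_def top.not_eq_extremum split: if_splits)
  \<comment> \<open>Two errors of size \<open>a\<close> in the \<open>r\<close>-th power add up to \<open>\<eta>\<close> in the quasi-norm.\<close>
  define a where "a = \<eta> powr r / (2 * 2 powr r)"
  have a: "a > 0" "2 powr r * (a + a) = \<eta> powr r" using \<eta> by (auto simp: a_def field_simps)
  obtain f1 where f1: "f1 \<in> Cc_space" "(\<integral>\<^sup>+x. ennreal (norm (f x - f1 x) powr r) \<partial>lebesgue) \<le> ennreal a"
    using Lq_Cc_approximation[OF f_borel r fin a(1)] by blast
  obtain K :: nat where "2 * real CARD('d) / r \<le> real K"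
    using real_arch_simple by blast
  then have K: "2 * real CARD('d) \<le> real K * r" using r by (simp add: field_simps)
  \<comment> \<open>One is added since \<open>D\<close> serves as a denominator.\<close>
  define D where "D = decay_const TYPE('d) + 1"
  have D: "D > 0" using decay_const_nonneg[where 'd = 'd] by (simp add: D_def)
  define \<epsilon> where "\<epsilon> = (a / D) powr (1 / r)"
  have \<epsilon>: "\<epsilon> > 0" "\<epsilon> powr r = a / D"
    using a D r by (auto simp: \<epsilon>_def powr_powr)
  show thesis
  proof (rule that[OF f1(1) \<epsilon>(1)], intro allI impI)
    fix g assume g: "continuous_on UNIV g" "weighted_close K \<epsilon> f1 g"
    have [measurable]: "g \<in> borel_measurable lebesgue" "f1 \<in> borel_measurable lebesgue"
      by (rule measurable_completion, use borel_measurable_continuous_onI[OF g(1)] Cc_space_borel[OF f1(1)] in simp)+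
    have "(\<integral>\<^sup>+x. ennreal (norm (f1 x - g x) powr r) \<partial>lebesgue) \<le> ennreal (\<epsilon> powr r * decay_const TYPE('d))"
      unfolding nn_integral_completion by (rule nn_integral_powr_le_decay_const[OF r K weighted_closeD[OF g(2)]])
    also have "\<dots> \<le> ennreal a"
      unfolding \<epsilon>(2) using a D by (intro ennreal_leI) (simp add: field_simps D_def)
    finally have "(\<integral>\<^sup>+x. ennreal (norm ((f x - f1 x) + (f1 x - g x)) powr r) \<partial>lebesgue) \<le> ennreal (2 powr r * (a + a))"
      using f1(2) a by (intro nn_integral_norm_add_powr_le[OF r]) auto
    then have "Lp_norm q (\<lambda>x. f x - g x) \<le> ennreal ((\<eta> powr r) powr (1 / enn2real q))"
      using a(2) q False by (intro Lp_norm_leI) (auto simp: r_def)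
    then show "Lp_norm q (\<lambda>x. f x - g x) \<le> ennreal \<eta>"
      using r \<eta> by (simp add: powr_powr flip: r_def)
  qed
qed

theorem theorem4p1:
  fixes p \<alpha> \<delta> :: real and q :: ennreal
    and \<psi> f :: "real ^ 'd \<Rightarrow> complex"
  assumes "0 < p" and "p < 1"
    and "0 < q"
    and "\<alpha> > max (real CARD('d) * (1 / p - 1)) (real CARD('d) * (1 - enn2real (1 / q)))"
    and "\<psi> \<in> homogeneous_class \<alpha>"
    and "f \<in> Lp_space q"
    and "q = \<infinity> \<Longrightarrow> f \<in> C0_space"
    and "\<delta> > 0"
  shows "K_functional f \<delta> q (ennreal p) \<psi> = 0"
proof -
  have \<alpha>: "\<alpha> > real CARD('d) * (1 / p - 1)"
    using assms(4) by simp
  have le: "K_functional f \<delta> q (ennreal p) \<psi> \<le> 0 + ennreal \<eta>" if \<eta>: "\<eta> > 0" for \<eta>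
  proof -
    have \<eta>2: "\<eta> / 2 > 0" using \<eta> by simp
    obtain f1 K \<epsilon> where f1: "f1 \<in> Cc_space" and \<epsilon>: "\<epsilon> > 0"
      and approx: "\<forall>g. continuous_on UNIV g \<longrightarrow> weighted_close K \<epsilon> f1 g \<longrightarrow> Lp_norm q (\<lambda>x. f x - g x) \<le> ennreal (\<eta> / 2)"
      by (rule Lp_norm_approximation[OF assms(3,6) _ \<eta>2]) (erule assms(7), (rule that; assumption))
    define \<epsilon>' where "\<epsilon>' = min \<epsilon> (\<eta> / (2 * \<delta>))"
    have \<epsilon>': "\<epsilon>' > 0" using \<epsilon> \<eta> assms(8) by (simp add: \<epsilon>'_def)
    obtain g where g: "g \<in> W_space (ennreal p) \<psi>" "continuous_on UNIV g"
        "weighted_close K \<epsilon>' f1 g" "W_seminorm (ennreal p) \<psi> g \<le> ennreal \<epsilon>'"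
      by (rule Cc_W_approximation[OF assms(5,1,2) \<alpha> f1 \<epsilon>', where K = K]) (rule that; assumption)
    have "ennreal \<delta> * W_seminorm (ennreal p) \<psi> g \<le> ennreal \<delta> * ennreal \<epsilon>'"
      by (intro mult_left_mono g(4)) auto
    also have "\<dots> = ennreal (\<delta> * \<epsilon>')"
      using assms(8) \<epsilon>' by (simp add: ennreal_mult)
    also have "\<dots> \<le> ennreal (\<eta> / 2)"
    proof (rule ennreal_leI)
      have "\<delta> * \<epsilon>' \<le> \<delta> * (\<eta> / (2 * \<delta>))"
        using assms(8) by (intro mult_left_mono) (auto simp: \<epsilon>'_def)
      then show "\<delta> * \<epsilon>' \<le> \<eta> / 2" using assms(8) by simp
    qed
    finally have 2: "ennreal \<delta> * W_seminorm (ennreal p) \<psi> g \<le> ennreal (\<eta> / 2)" .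
    have 1: "Lp_norm q (\<lambda>x. f x - g x) \<le> ennreal (\<eta> / 2)"
      by (rule approx[rule_format, OF g(2) weighted_close_mono[OF g(3)]]) (simp add: \<epsilon>'_def)

    have "K_functional f \<delta> q (ennreal p) \<psi> \<le> Lp_norm q (\<lambda>x. f x - g x) + ennreal \<delta> * W_seminorm (ennreal p) \<psi> g"
      unfolding K_functional_def by (rule INF_lower[OF g(1)])
    also have "\<dots> \<le> ennreal (\<eta> / 2) + ennreal (\<eta> / 2)"
      by (rule add_mono[OF 1 2])
    also have "\<dots> = 0 + ennreal \<eta>"
      using \<eta> by (simp flip: ennreal_plus)
    finally show ?thesis .
  qed
  have "K_functional f \<delta> q (ennreal p) \<psi> \<le> 0"
    by (rule ennreal_le_epsilon) (rule le)
  then show ?thesis by simp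
qed

end
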